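(* The projective closure in $\mathbb{P}^1$ of the affine $\delta$-variety in $\mathbb{A}^1$ defined by $xx''=x'$ is $\delta$-complete.
   Context: All differential fields have characteristic zero and a single derivation $\delta$ (written $x'$, $x''$). $\mathcal{F}$ is a fixed arbitrary differentially closed field of characteristic zero (a model of $DCF_0$), contained in a large saturated model $\mathcal{U}$ of $DCF_0$. $\mathbb{P}^n$ and $\mathbb{A}^m$ mean $\mathbb{P}^n(\mathcal{U})$ and $\mathbb{A}^m(\mathcal{U})$. A $\delta$-polynomial $g(x_0,\dots,x_n)$ is $\delta$-homogeneous if there is a natural number $d$ with $g(\lambda\bar x)=\lambda^d g(\bar x)$ for all nonzero $\lambda$ in the ground $\delta$-field. $\delta$-varieties (Kolchin-closed subsets) in $\mathbb{A}^m$, resp. $\mathbb{P}^n$, are the zero loci, in $\mathcal{U}$-points, of sets of $\delta$-polynomials, resp. $\delta$-homogeneous $\delta$-polynomials, with coefficients in $\mathcal{F}$; Kolchin-closed subsets of a product with projective factors are defined by $\delta$-polynomials over $\mathcal{F}$ that are $\delta$-homogeneous in each group of projective coordinates. The projective closure of an affine $\delta$-variety $X\subseteq\mathbb{A}^1$ (embedded in $\mathbb{P}^1$ by $x\mapsto(x:1)$) is the intersection of all projective $\delta$-varieties in $\mathbb{P}^1$ containing it. A projective $\delta$-variety $V$ is $\delta$-complete if for every projective $\delta$-variety $W$ over $\mathcal{F}$ and every Kolchin-closed $Z\subseteq V\times W$, the image $\pi_2(Z)\subseteq W$ under the second projection is Kolchin-closed (equivalently, one may take $W=\mathbb{A}^m$,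 $m$ arbitrary). *)

theory Defs
  imports Complex_Main "HOL-Library.Poly_Mapping" "HOL-Library.Equipollence"
begin

section \<open>Differential polynomials\<close>

definition derivation :: "('u::field_char_0 \<Rightarrow> 'u) \<Rightarrow> bool" where
  "derivation D \<longleftrightarrow> (\<forall>x y. D (x + y) = D x + D y) \<and> (\<forall>x y. D (x * y) = D x * y + x * D y)"

text \<open>The pair \<open>(i, j)\<close> stands for the \<open>j\<close>-th derivative of the differential indeterminate \<open>x\<^sub>i\<close>:
  a differential polynomial is a polynomial in these indeterminates.\<close>

type_synonym ('i, 'u) dpoly = "('i \<times> nat \<Rightarrow>\<^sub>0 nat) \<Rightarrow>\<^sub>0 'u"

definition dpoly_eval :: "('u::field_char_0 \<Rightarrow> 'u) \<Rightarrow> ('i, 'u) dpoly \<Rightarrow> ('i \<Rightarrow> 'u) \<Rightarrow> 'u" where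
  "dpoly_eval D g x =
    (\<Sum>m\<in>Poly_Mapping.keys g. Poly_Mapping.lookup g m *
      (\<Prod>(i, j)\<in>Poly_Mapping.keys m. (D ^^ j) (x i) ^ Poly_Mapping.lookup m (i, j)))"

definition dpoly_indets :: "('i, 'u::zero) dpoly \<Rightarrow> ('i \<times> nat) set" where
  "dpoly_indets g = (\<Union>m\<in>Poly_Mapping.keys g. Poly_Mapping.keys m)"

text \<open>The differential polynomials over \<open>K\<close> in the differential indeterminates \<open>x\<^sub>i\<close>, \<open>i \<in> I\<close>.\<close>

definition dpolys_over :: "'u::zero set \<Rightarrow> 'i set \<Rightarrow> ('i, 'u) dpoly set" where
  "dpolys_over K I = {g. (\<forall>m. Poly_Mapping.lookup g m \<in> K) \<and> fst ` dpoly_indets g \<subseteq> I}"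

text \<open>The order of a differential polynomial in one indeterminate; constants have order \<open>-1\<close>.\<close>

definition dpoly_order :: "(unit, 'u::zero) dpoly \<Rightarrow> int" where
  "dpoly_order g =
    (if dpoly_indets g = {} then -1 else int (Max (snd ` dpoly_indets g)))"


section \<open>Differentially closed fields and saturation\<close>

definition delta_subfield :: "('u::field_char_0 \<Rightarrow> 'u) \<Rightarrow> 'u set \<Rightarrow> bool" where
  "delta_subfield D K \<longleftrightarrow>
    0 \<in> K \<and> 1 \<in> K \<and>
    (\<forall>x\<in>K. \<forall>y\<in>K. x + y \<in> K \<and> x * y \<in> K) \<and>
    (\<forall>x\<in>K. - x \<in> K \<and> inverse x \<in> K \<and> D x \<in> K)"

text \<open>Models of \<open>DCF\<^sub>0\<close> inside the ambient differential field, by Blum's axioms. The characteristic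
  is zero by the type class.\<close>

definition model_DCF0 :: "('u::field_char_0 \<Rightarrow> 'u) \<Rightarrow> 'u set \<Rightarrow> bool" where
  "model_DCF0 D K \<longleftrightarrow>
    derivation D \<and> delta_subfield D K \<and>
    (\<forall>f\<in>dpolys_over K UNIV. \<forall>g\<in>dpolys_over K UNIV.
      g \<noteq> 0 \<and> dpoly_order g < dpoly_order f \<longrightarrow>
      (\<exists>a\<in>K. dpoly_eval D f (\<lambda>_. a) = 0 \<and> dpoly_eval D g (\<lambda>_. a) \<noteq> 0))"

text \<open>First-order formulas in the language of differential rings, with de Bruijn variables and with
  parameters, so that \<open>set_dformula \<phi>\<close> is the set of parameters occurring in \<open>\<phi>\<close>.\<close>

datatype 'u dterm =
    TVar nat
  | TParam 'u
  | TZero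
  | TOne
  | TAdd "'u dterm" "'u dterm"
  | TNeg "'u dterm"
  | TMult "'u dterm" "'u dterm"
  | TDeriv "'u dterm"

datatype 'u dformula =
    FEq "'u dterm" "'u dterm"
  | FNot "'u dformula"
  | FAnd "'u dformula" "'u dformula"
  | FEx "'u dformula"

primrec tval :: "('u::field_char_0 \<Rightarrow> 'u) \<Rightarrow> (nat \<Rightarrow> 'u) \<Rightarrow> 'u dterm \<Rightarrow> 'u" where
  "tval D e (TVar n) = e n"
| "tval D e (TParam a) = a"
| "tval D e TZero = 0"
| "tval D e TOne = 1"
| "tval D e (TAdd s t) = tval D e s + tval D e t"
| "tval D e (TNeg t) = - tval D e t"
| "tval D e (TMult s t) = tval D e s * tval D e t"
| "tval D e (TDeriv t) = D (tval D e t)"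

primrec fsat :: "('u::field_char_0 \<Rightarrow> 'u) \<Rightarrow> (nat \<Rightarrow> 'u) \<Rightarrow> 'u dformula \<Rightarrow> bool" where
  "fsat D e (FEq s t) \<longleftrightarrow> tval D e s = tval D e t"
| "fsat D e (FNot \<phi>) \<longleftrightarrow> \<not> fsat D e \<phi>"
| "fsat D e (FAnd \<phi> \<psi>) \<longleftrightarrow> fsat D e \<phi> \<and> fsat D e \<psi>"
| "fsat D e (FEx \<phi>) \<longleftrightarrow> (\<exists>a. fsat D (case_nat a e) \<phi>)"

primrec tfree :: "'u dterm \<Rightarrow> nat set" where
  "tfree (TVar n) = {n}"
| "tfree (TParam a) = {}"
| "tfree TZero = {}"
| "tfree TOne = {}"
| "tfree (TAdd s t) = tfree s \<union> tfree t"
| "tfree (TNeg t) = tfree t"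
| "tfree (TMult s t) = tfree s \<union> tfree t"
| "tfree (TDeriv t) = tfree t"

primrec ffree :: "'u dformula \<Rightarrow> nat set" where
  "ffree (FEq s t) = tfree s \<union> tfree t"
| "ffree (FNot \<phi>) = ffree \<phi>"
| "ffree (FAnd \<phi> \<psi>) = ffree \<phi> \<union> ffree \<psi>"
| "ffree (FEx \<phi>) = {n. Suc n \<in> ffree \<phi>}"

text \<open>Saturation of the ambient differential field: every finitely satisfiable set of formulas in
  one variable over fewer than \<open>\<bar>UNIV\<bar>\<close> parameters is realised. The value of the assignment
  outside variable \<open>0\<close> is immaterial.\<close>

definition saturated :: "('u::field_char_0 \<Rightarrow> 'u) \<Rightarrow> bool" where
  "saturated D \<longleftrightarrow>
    (\<forall>A \<Phi>. A \<prec> (UNIV :: 'u set) \<and>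
      (\<forall>\<phi>\<in>\<Phi>. set_dformula \<phi> \<subseteq> A \<and> ffree \<phi> \<subseteq> {0}) \<and>
      (\<forall>\<Psi>. finite \<Psi> \<and> \<Psi> \<subseteq> \<Phi> \<longrightarrow> (\<exists>a. \<forall>\<phi>\<in>\<Psi>. fsat D (\<lambda>_. a) \<phi>)) \<longrightarrow>
      (\<exists>a. \<forall>\<phi>\<in>\<Phi>. fsat D (\<lambda>_. a) \<phi>))"


section \<open>Projective Kolchin-closed sets\<close>

text \<open>Homogeneous coordinates of points of \<open>n\<close>-dimensional projective space over the ambient field
  are sequences indexed by \<open>0, \<dots>, n\<close>, extended by \<open>0\<close>; a point is the class of its
  homogeneous coordinates.\<close>

definition hom_coords :: "nat \<Rightarrow> (nat \<Rightarrow> 'u::field_char_0) set" where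
  "hom_coords n = {x. (\<forall>i>n. x i = 0) \<and> (\<exists>i\<le>n. x i \<noteq> 0)}"

definition proj_rel :: "nat \<Rightarrow> ((nat \<Rightarrow> 'u::field_char_0) \<times> (nat \<Rightarrow> 'u)) set" where
  "proj_rel n =
    {(x, y). x \<in> hom_coords n \<and> y \<in> hom_coords n \<and> (\<exists>c. c \<noteq> 0 \<and> y = (\<lambda>i. c * x i))}"

type_synonym 'u proj_point = "(nat \<Rightarrow> 'u) set"

definition proj_space :: "nat \<Rightarrow> 'u::field_char_0 proj_point set" where
  "proj_space n = hom_coords n // proj_rel n"

text \<open>Homogeneity in the group of coordinates \<open>J\<close>, over the ground field \<open>F\<close>.\<close>

definition delta_homogeneous ::
    "('u::field_char_0 \<Rightarrow> 'u) \<Rightarrow> 'u set \<Rightarrow> 'i set \<Rightarrow> ('i, 'u) dpoly \<Rightarrow> bool" where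
  "delta_homogeneous D F J g \<longleftrightarrow>
    (\<exists>d::nat. \<forall>c\<in>F - {0}. \<forall>x.
      dpoly_eval D g (\<lambda>i. if i \<in> J then c * x i else x i) = c ^ d * dpoly_eval D g x)"

definition proj_zeros ::
    "('u::field_char_0 \<Rightarrow> 'u) \<Rightarrow> nat \<Rightarrow> (nat, 'u) dpoly set \<Rightarrow> 'u proj_point set" where
  "proj_zeros D n S = {P \<in> proj_space n. \<forall>g\<in>S. \<forall>x\<in>P. dpoly_eval D g x = 0}"

definition proj_variety ::
    "('u::field_char_0 \<Rightarrow> 'u) \<Rightarrow> 'u set \<Rightarrow> nat \<Rightarrow> 'u proj_point set \<Rightarrow> bool" where
  "proj_variety D F n V \<longleftrightarrow>
    (\<exists>S. S \<subseteq> {g \<in> dpolys_over F {..n}. delta_homogeneous D F {..n} g} \<and> V = proj_zeros D n S)"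

text \<open>In a product of two projective spaces, the coordinates of the first factor are indexed by
  \<open>Inl 0, \<dots>, Inl m\<close> and those of the second by \<open>Inr 0, \<dots>, Inr n\<close>.\<close>

definition biproj_zeros ::
    "('u::field_char_0 \<Rightarrow> 'u) \<Rightarrow> nat \<Rightarrow> nat \<Rightarrow> (nat + nat, 'u) dpoly set \<Rightarrow>
      ('u proj_point \<times> 'u proj_point) set" where
  "biproj_zeros D m n S =
    {(P, Q). P \<in> proj_space m \<and> Q \<in> proj_space n \<and>
      (\<forall>g\<in>S. \<forall>x\<in>P. \<forall>y\<in>Q. dpoly_eval D g (case_sum x y) = 0)}"

definition biproj_closed ::
    "('u::field_char_0 \<Rightarrow> 'u) \<Rightarrow> 'u set \<Rightarrow> nat \<Rightarrow> nat \<Rightarrow>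
      ('u proj_point \<times> 'u proj_point) set \<Rightarrow> bool" where
  "biproj_closed D F m n Z \<longleftrightarrow>
    (\<exists>S. S \<subseteq> {g \<in> dpolys_over F (Inl ` {..m} \<union> Inr ` {..n}).
               delta_homogeneous D F (Inl ` {..m}) g \<and> delta_homogeneous D F (Inr ` {..n}) g} \<and>
         Z = biproj_zeros D m n S)"

text \<open>Products of projective varieties and projective varieties themselves are closed in the
  ambient spaces, so closedness in \<open>V \<times> W\<close> and in \<open>W\<close> is closedness in the ambient space.\<close>

definition delta_complete ::
    "('u::field_char_0 \<Rightarrow> 'u) \<Rightarrow> 'u set \<Rightarrow> nat \<Rightarrow> 'u proj_point set \<Rightarrow> bool" where
  "delta_complete D F m V \<longleftrightarrow>
    proj_variety D F m V \<and>
    (\<forall>n W Z. proj_variety D F n W \<and> biproj_closed D F m n Z \<and> Z \<subseteq> V \<times> W \<longrightarrow>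
      proj_variety D F n (snd ` Z))"

text \<open>The embedding of the affine line into the projective line sends \<open>a\<close> to \<open>(a : 1)\<close>.\<close>

definition affine_embed :: "'u::field_char_0 \<Rightarrow> 'u proj_point" where
  "affine_embed a = proj_rel 1 `` {(\<lambda>_. 0)(0 := a, 1 := 1)}"

definition proj_closure ::
    "('u::field_char_0 \<Rightarrow> 'u) \<Rightarrow> 'u set \<Rightarrow> 'u set \<Rightarrow> 'u proj_point set" where
  "proj_closure D F X = \<Inter>{V. proj_variety D F 1 V \<and> affine_embed ` X \<subseteq> V}"

end

theory Submission
  imports Defs "HOL-Computational_Algebra.Polynomial"
begin

text \<open>Besides the point at infinity, the closure \<open>V\<close> contains only solutions of \<open>x x'' = x'\<close>. Let \<open>Z\<close> be
a closed subset of \<open>V \<times> W\<close> and \<open>w\<close> a point at which all \<open>\<delta>\<close>-homogeneous polynomials over \<open>F\<close> vanish that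
vanish on the projection of \<open>Z\<close>. By saturation there is a point \<open>(v, u)\<close> of \<open>Z\<close> such that every
differential polynomial over \<open>F\<close> that vanishes at \<open>u\<close> vanishes at \<open>w\<close>
(\<open>generic_specialization\<close>). The quotients \<open>a(u) / b(u)\<close> with \<open>b(w) \<noteq> 0\<close> form a local differential
ring \<open>R\<close>, and \<open>u \<mapsto> w\<close> induces a differential homomorphism \<open>f\<close> on it
(\<open>place_of_specialization\<close>). If \<open>f\<close> extends to \<open>x = v\<^sub>0 / v\<^sub>1\<close> or to \<open>1/x\<close>, then \<open>w\<close> lies in the
projection of \<open>Z\<close>; this extension result is \<open>solution_specializes\<close>, and it carries the proof.

Let \<open>\<mm>\<close> be the kernel of \<open>f\<close> and put \<open>u = x'\<close>, \<open>y = 1/x\<close>, \<open>s = x'/x\<close> (the letter \<open>u\<close> is reused).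
Then \<open>y' = - s y\<close> and \<open>s' = s y - s\<^sup>2\<close>, so that \<open>R[y, s]\<close> is a differential ring on whose generators
the derivation raises the degree by exactly one. There are three cases.

If no power of \<open>y\<close> lies in \<open>\<mm> R[y, s]\<close>, then the relations between \<open>x\<close> and \<open>u\<close> over \<open>R\<close> reduce,
modulo \<open>\<mm>\<close>, to a differential ideal of polynomials in two variables that contains no power of the
first variable. A maximal ideal of this kind is prime, and Blum's axioms of order at most one give
it a point with non-zero first coordinate (\<open>point_of_xD_ideal\<close>). That point is the image of \<open>x\<close>.

If a power of \<open>y\<close> lies in \<open>\<mm> R[y, s]\<close>, but \<open>1\<close> does not, then \<open>y\<close> generates together with \<open>\<mm>\<close> a
proper differential ideal, and \<open>1/x\<close> can be sent to \<open>0\<close>.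

The remaining case \<open>1 \<in> \<mm> R[y, s]\<close> is the heart of the proof: here \<open>x\<close> can be sent to \<open>0\<close>. Suppose
that \<open>1\<close> is a combination of monomials of degree at most \<open>n\<close> with coefficients in \<open>\<mm>\<close>. On monomials
of degree \<open>d\<close> the operator \<open>D + d s\<close> is, up to terms of lower degree coming from the coefficients,
diagonal: it maps \<open>y\<^sup>a s\<^sup>b\<close> to \<open>b y\<close> times itself. Hence a product of operators \<open>D + d s - i y\<close>
annihilates the leading part of the relation, while on the left-hand side it only produces integral
forms that are monic in \<open>s\<close> up to a non-zero integer. Repeating this, one obtains such a form of
degree \<open>e\<close> that is a combination of monomials of degree at most \<open>e\<close> with coefficients in \<open>\<mm>\<close>
(\<open>int_form_in_own_degree\<close>). After division by \<open>y\<^sup>e\<close> it says, together with the original relation,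
that \<open>x\<close> and \<open>u\<close> are integral over \<open>R\<close>. Next, \<open>x D\<close> acts on \<open>R[x, u]\<close> modulo \<open>x\<close> with
eigenvalue \<open>j\<close> on \<open>u\<^sup>j\<close>; comparing eigenvalues shows that one power \<open>u\<^sup>e\<close> is divisible in \<open>R[x, u]\<close>
by all powers of \<open>x\<close> (\<open>u_power_divisible\<close>). Therefore all \<open>u / x\<^sup>k\<close> are integral, and the
differential ideal generated by \<open>\<mm>\<close>, \<open>x\<close> and these elements is proper by Nakayama's lemma.\<close>

section \<open>Linear spans over a subset of the ambient ring\<close>

text \<open>The coefficients range over an arbitrary subset, because spans over a ring \<open>R\<close>, over its maximal
ideal and over the integers occur side by side.\<close>

inductive_set lin :: "'a::comm_ring_1 set \<Rightarrow> 'a set \<Rightarrow> 'a set" for A G where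
  lin_zero: "0 \<in> lin A G"
| lin_step: "a \<in> A \<Longrightarrow> g \<in> G \<Longrightarrow> z \<in> lin A G \<Longrightarrow> a * g + z \<in> lin A G"

lemma lin_gen: "a \<in> A \<Longrightarrow> g \<in> G \<Longrightarrow> a * g \<in> lin A G"
  using lin_step[OF _ _ lin_zero, of a A g G] by simp

lemma lin_add: "u \<in> lin A G \<Longrightarrow> v \<in> lin A G \<Longrightarrow> u + v \<in> lin A G"
  by (induction rule: lin.induct) (auto simp: add.assoc intro: lin_step)

lemma lin_subset:
  assumes "0 \<in> X" "\<And>u v. u \<in> X \<Longrightarrow> v \<in> X \<Longrightarrow> u + v \<in> X"
    "\<And>a g. a \<in> A \<Longrightarrow> g \<in> G \<Longrightarrow> a * g \<in> X"
  shows "lin A G \<subseteq> X"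
proof
  fix z assume "z \<in> lin A G"
  then show "z \<in> X" by induction (auto simp: assms)
qed

lemma lin_mono: "A \<subseteq> B \<Longrightarrow> G \<subseteq> H \<Longrightarrow> lin A G \<subseteq> lin B H"
  by (rule lin_subset) (auto intro: lin_zero lin_add lin_gen)

lemma lin_additive_image:
  assumes "z \<in> lin A G" "h 0 \<in> X" "\<And>u v. h (u + v) = h u + h v"
    "\<And>u v. u \<in> X \<Longrightarrow> v \<in> X \<Longrightarrow> u + v \<in> X"
    "\<And>a g. a \<in> A \<Longrightarrow> g \<in> G \<Longrightarrow> h (a * g) \<in> X"
  shows "h z \<in> X"
  using assms(1) by induction (auto simp: assms)

lemma lin_mult:
  assumes "u \<in> lin A G" "v \<in> lin B H"
    "\<And>a b. a \<in> A \<Longrightarrow> b \<in> B \<Longrightarrow> a * b \<in> C"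
    "\<And>g h. g \<in> G \<Longrightarrow> h \<in> H \<Longrightarrow> g * h \<in> K"
  shows "u * v \<in> lin C K"
  using assms(1)
proof (rule lin_additive_image)
  fix a g assume ag: "a \<in> A" "g \<in> G"
  show "a * g * v \<in> lin C K"
    using assms(2)
  proof (rule lin_additive_image)
    fix b h assume "b \<in> B" "h \<in> H"
    then have "(a * b) * (g * h) \<in> lin C K"
      using ag assms by (intro lin_gen) auto
    then show "a * g * (b * h) \<in> lin C K" by (simp add: ac_simps)
  qed (auto intro: lin_zero lin_add simp: algebra_simps)
qed (auto intro: lin_zero lin_add simp: algebra_simps)

lemma lin_mult_left:
  assumes "v \<in> lin B H" "\<And>b h. b \<in> B \<Longrightarrow> h \<in> H \<Longrightarrow> u * (b * h) \<in> lin C K"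
  shows "u * v \<in> lin C K"
  using assms(1)
proof (rule lin_additive_image)
  show "u * (b * h) \<in> lin C K" if "b \<in> B" "h \<in> H" for b h
    using that by (rule assms(2))
qed (auto intro: lin_zero lin_add simp: algebra_simps)

text \<open>For multiplication by a fixed element only the generators have to be controlled; the coefficient
set is unchanged.\<close>

lemma lin_mult_elem: "v \<in> lin B H \<Longrightarrow> (\<And>h. h \<in> H \<Longrightarrow> u * h \<in> K) \<Longrightarrow> u * v \<in> lin B K"
proof (erule lin_mult_left)
  fix b h assume "\<And>h. h \<in> H \<Longrightarrow> u * h \<in> K" "b \<in> B" "h \<in> H"
  then have "b * (u * h) \<in> lin B K" by (intro lin_gen)
  then show "u * (b * h) \<in> lin B K" by (simp add: mult.left_commute)
qed

definition mons :: "'a::comm_ring_1 \<Rightarrow> 'a \<Rightarrow> nat \<Rightarrow> 'a set" where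
  "mons p q n = {p ^ i * q ^ j | i j. i + j \<le> n}"

definition allmons :: "'a::comm_ring_1 \<Rightarrow> 'a \<Rightarrow> 'a set" where
  "allmons p q = {p ^ i * q ^ j | i j. True}"

lemma monsI: "i + j \<le> n \<Longrightarrow> p ^ i * q ^ j \<in> mons p q n"
  by (auto simp: mons_def)

lemma allmonsI: "p ^ i * q ^ j \<in> allmons p q"
  by (auto simp: allmons_def)

lemma finite_mons: "finite (mons p q n)"
proof -
  have "mons p q n = (\<lambda>(i, j). p ^ i * q ^ j) ` {(i, j). i + j \<le> n}" by (auto simp: mons_def)
  moreover have "finite {(i, j). i + j \<le> n}"
    by (rule finite_subset[of _ "{..n} \<times> {..n}"]) auto
  ultimately show ?thesis by simp
qed

lemma mons_mono: "k \<le> n \<Longrightarrow> mons p q k \<subseteq> mons p q n"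
  by (force simp: mons_def)

lemma mons_subset_allmons: "mons p q n \<subseteq> allmons p q"
  by (auto simp: mons_def allmons_def)

lemma mons_mult: "g \<in> mons p q k \<Longrightarrow> h \<in> mons p q n \<Longrightarrow> g * h \<in> mons p q (k + n)"
proof -
  assume "g \<in> mons p q k" "h \<in> mons p q n"
  then obtain i j i' j' where "g = p ^ i * q ^ j" "h = p ^ i' * q ^ j'" "i + j \<le> k" "i' + j' \<le> n"
    by (auto simp: mons_def)
  then have "g * h = p ^ (i + i') * q ^ (j + j')" "(i + i') + (j + j') \<le> k + n"
    by (auto simp: power_add ac_simps)
  then show ?thesis by (metis monsI)
qed

lemma allmons_mult: "g \<in> allmons p q \<Longrightarrow> h \<in> allmons p q \<Longrightarrow> g * h \<in> allmons p q"
proof -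
  assume "g \<in> allmons p q" "h \<in> allmons p q"
  then obtain i j i' j' where "g = p ^ i * q ^ j" "h = p ^ i' * q ^ j'"
    by (auto simp: allmons_def)
  then have "g * h = p ^ (i + i') * q ^ (j + j')" by (auto simp: power_add ac_simps)
  then show ?thesis by (metis allmonsI)
qed

text \<open>A single element involves finitely many monomials, hence has a bounded degree.\<close>

lemma lin_allmons_bounded:
  assumes "z \<in> lin A (allmons p q)"
  obtains n where "z \<in> lin A (mons p q n)"
proof -
  have "\<exists>n. z \<in> lin A (mons p q n)" using assms
  proof induction
    case lin_zero
    then show ?case by (auto intro: lin.lin_zero)
  next
    case (lin_step a g z)
    then obtain n i j where n: "z \<in> lin A (mons p q n)" and g: "g = p ^ i * q ^ j"
      by (auto simp: allmons_def)
    have "z \<in> lin A (mons p q (n + (i + j)))" using n lin_mono[OF order_refl mons_mono] 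
      by (metis le_add1 subsetD)
    moreover have "g \<in> mons p q (n + (i + j))" unfolding g by (rule monsI) simp
    ultimately show ?case using lin_step(1) by (metis lin.lin_step)
  qed
  then show ?thesis using that by blast
qed

section \<open>Differential places\<close>

text \<open>A differential homomorphism \<open>f\<close> on a differential subring \<open>R\<close> of the field, such that every
element outside the kernel is a unit of \<open>R\<close>. So \<open>R\<close> is local, its maximal ideal \<open>\<mm>\<close> is a
differential ideal, and \<open>R\<close> contains the rational numbers.\<close>

locale diff_place =
  fixes D :: "'u::field_char_0 \<Rightarrow> 'u" and R :: "'u set" and f :: "'u \<Rightarrow> 'u"
  assumes D_add: "D (a + b) = D a + D b"
    and D_mult: "D (a * b) = D a * b + a * D b"
    and R_one: "1 \<in> R"
    and R_add: "a \<in> R \<Longrightarrow> b \<in> R \<Longrightarrow> a + b \<in> R"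
    and R_mult: "a \<in> R \<Longrightarrow> b \<in> R \<Longrightarrow> a * b \<in> R"
    and R_uminus: "a \<in> R \<Longrightarrow> - a \<in> R"
    and R_D: "a \<in> R \<Longrightarrow> D a \<in> R"
    and R_inverse: "a \<in> R \<Longrightarrow> f a \<noteq> 0 \<Longrightarrow> inverse a \<in> R"
    and f_one: "f 1 = 1"
    and f_add: "a \<in> R \<Longrightarrow> b \<in> R \<Longrightarrow> f (a + b) = f a + f b"
    and f_mult: "a \<in> R \<Longrightarrow> b \<in> R \<Longrightarrow> f (a * b) = f a * f b"
    and f_D: "a \<in> R \<Longrightarrow> f (D a) = D (f a)"
begin

definition \<mm> :: "'u set" where "\<mm> = {a \<in> R. f a = 0}"

lemma D_zero: "D 0 = 0" using D_add[of 0 0] by simp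

lemma D_one: "D 1 = 0" using D_mult[of 1 1] by simp

lemma D_uminus: "D (- a) = - D a"
proof -
  have "D a + D (- a) = 0" by (metis D_add D_zero add.right_inverse)
  then show ?thesis by (metis add.inverse_unique)
qed

lemma D_diff: "D (a - b) = D a - D b"
  using D_add[of a "- b"] D_uminus[of b] by simp

lemma D_of_nat: "D (of_nat n) = 0"
  by (induction n) (auto simp: D_zero D_add D_one)

lemma D_of_int: "D (of_int n) = 0"
  by (cases n) (auto simp: D_of_nat D_uminus D_diff D_one simp del: of_nat_Suc)

lemma D_power: "D (a ^ n) = of_nat n * a ^ (n - 1) * D a"
proof (induction n)
  case 0
  then show ?case by (simp add: D_one)
next
  case (Suc n)
  then show ?case
    by (cases n) (auto simp: D_mult algebra_simps)
qed

lemma D_inverse: "a \<noteq> 0 \<Longrightarrow> D (inverse a) = - D a * (inverse a)\<^sup>2"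
proof -
  assume a: "a \<noteq> 0"
  have "D (a * inverse a) = 0" using a by (simp add: D_one)
  then have "D a * inverse a + a * D (inverse a) = 0" by (simp add: D_mult)
  then have eq: "a * D (inverse a) = - D a * inverse a" by (simp add: eq_neg_iff_add_eq_0 add.commute)
  have "D (inverse a) = inverse a * (a * D (inverse a))" using a by simp
  also have "\<dots> = - D a * (inverse a)\<^sup>2"
    unfolding eq by (simp add: power2_eq_square)
  finally show ?thesis .
qed

lemma R_zero: "0 \<in> R" using R_add[OF R_one R_uminus[OF R_one]] by simp

lemma R_diff: "a \<in> R \<Longrightarrow> b \<in> R \<Longrightarrow> a - b \<in> R"
  using R_add[of a "- b"] R_uminus[of b] by simp

lemma R_of_nat: "of_nat n \<in> R"
  by (induction n) (auto simp: R_zero R_one R_add)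

lemma R_of_int: "of_int n \<in> R"
  by (cases n) (auto intro: R_of_nat R_uminus simp del: of_nat_Suc)

lemma Ints_R: "\<int> \<subseteq> R"
  by (auto elim!: Ints_cases intro: R_of_int)

lemma f_zero: "f 0 = 0" using f_add[OF R_zero R_zero] by simp

lemma f_uminus: "a \<in> R \<Longrightarrow> f (- a) = - f a"
  using f_add[of a "- a"] R_uminus[of a] f_zero by (simp add: eq_neg_iff_add_eq_0 add.commute)

lemma f_diff: "a \<in> R \<Longrightarrow> b \<in> R \<Longrightarrow> f (a - b) = f a - f b"
  using f_add[of a "- b"] f_uminus[of b] R_uminus[of b] by simp

lemma f_of_nat: "f (of_nat n) = of_nat n"
  by (induction n) (auto simp: f_zero f_one f_add R_one R_of_nat)

lemma f_of_int: "f (of_int n) = of_int n"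
  by (cases n) (auto simp: f_of_nat f_uminus R_of_nat simp del: of_nat_Suc)

lemma m_R: "\<mm> \<subseteq> R" by (auto simp: \<mm>_def)

lemma m_zero: "0 \<in> \<mm>" by (simp add: \<mm>_def R_zero f_zero)

lemma m_add: "a \<in> \<mm> \<Longrightarrow> b \<in> \<mm> \<Longrightarrow> a + b \<in> \<mm>" by (simp add: \<mm>_def R_add f_add)

lemma m_mult: "a \<in> R \<Longrightarrow> b \<in> \<mm> \<Longrightarrow> a * b \<in> \<mm>" by (simp add: \<mm>_def R_mult f_mult)

lemma m_mult': "b \<in> \<mm> \<Longrightarrow> a \<in> R \<Longrightarrow> b * a \<in> \<mm>" by (simp add: \<mm>_def R_mult f_mult)

lemma m_D: "a \<in> \<mm> \<Longrightarrow> D a \<in> \<mm>" by (simp add: \<mm>_def R_D f_D D_zero)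

lemma one_notin_m: "1 \<notin> \<mm>" by (simp add: \<mm>_def f_one)

lemma lin_R_smult: "a \<in> R \<Longrightarrow> z \<in> lin R G \<Longrightarrow> a * z \<in> lin R G"
  by (rule lin_mult_left, assumption) (metis R_mult lin_gen mult.assoc)

lemma lin_m_smult: "a \<in> R \<Longrightarrow> z \<in> lin \<mm> G \<Longrightarrow> a * z \<in> lin \<mm> G"
  by (rule lin_mult_left, assumption) (metis m_mult lin_gen mult.assoc)

lemma lin_m_mult_R: "a \<in> \<mm> \<Longrightarrow> z \<in> lin R G \<Longrightarrow> a * z \<in> lin \<mm> G"
  by (rule lin_mult_left, assumption) (metis m_mult' lin_gen mult.assoc)

lemma lin_R_uminus: "z \<in> lin R G \<Longrightarrow> - z \<in> lin R G"
  using lin_R_smult[of "-1" z G] R_uminus[OF R_one] by simp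

lemma lin_R_diff: "z \<in> lin R G \<Longrightarrow> w \<in> lin R G \<Longrightarrow> z - w \<in> lin R G"
  using lin_add[of z R G "- w"] lin_R_uminus[of w] by simp

lemma lin_R_gen: "g \<in> G \<Longrightarrow> g \<in> lin R G"
  using lin_gen[OF R_one, of g G] by simp

lemma lin_m_subset_lin_R: "lin \<mm> G \<subseteq> lin R G"
  by (rule lin_mono[OF m_R order_refl])

lemma lin_m_lin_R: "G \<subseteq> lin R H \<Longrightarrow> lin \<mm> G \<subseteq> lin \<mm> H"
  by (rule lin_subset) (auto intro: lin_zero lin_add lin_m_mult_R)

lemma lin_R_lin_R: "G \<subseteq> lin R H \<Longrightarrow> lin R G \<subseteq> lin R H"
  by (rule lin_subset) (auto intro: lin_zero lin_add lin_R_smult)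

lemma lin_R_mult_m: "u \<in> lin R G \<Longrightarrow> v \<in> lin \<mm> H \<Longrightarrow> (\<And>g h. g \<in> G \<Longrightarrow> h \<in> H \<Longrightarrow> g * h \<in> K)
    \<Longrightarrow> u * v \<in> lin \<mm> K"
  by (erule lin_mult) (auto intro: m_mult)

lemma lin_R_mult_R: "u \<in> lin R G \<Longrightarrow> v \<in> lin R H \<Longrightarrow> (\<And>g h. g \<in> G \<Longrightarrow> h \<in> H \<Longrightarrow> g * h \<in> K)
    \<Longrightarrow> u * v \<in> lin R K"
  by (erule lin_mult) (auto intro: R_mult)

lemma unit_minus_m: "a \<in> \<mm> \<Longrightarrow> inverse (1 - a) \<in> R"
  by (rule R_inverse) (auto simp: \<mm>_def R_diff R_one f_diff f_one)

lemma unit_nonzero: "a \<in> \<mm> \<Longrightarrow> 1 - a \<noteq> 0"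
  using one_notin_m by auto

lemma of_int_unit: "n \<noteq> 0 \<Longrightarrow> inverse (of_int n) \<in> R"
  by (rule R_inverse) (auto simp: R_of_int f_of_int)

lemma of_nat_unit: "n \<noteq> 0 \<Longrightarrow> inverse (of_nat n) \<in> R"
  by (rule R_inverse) (auto simp: R_of_nat f_of_nat)

lemma lin_insert:
  assumes "z \<in> lin A (insert g G)" "\<And>a b. a \<in> A \<Longrightarrow> b \<in> A \<Longrightarrow> a + b \<in> A" "0 \<in> A"
  shows "\<exists>a\<in>A. \<exists>w\<in>lin A G. z = a * g + w"
  using assms(1)
proof induction
  case lin_zero
  show ?case using assms(3) by (rule_tac x = 0 in bexI, rule_tac x = 0 in bexI) (auto intro: lin.lin_zero)
next
  case (lin_step c h z)
  then obtain a w where aw: "a \<in> A" "w \<in> lin A G" "z = a * g + w" by blast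
  show ?case
  proof (cases "h = g")
    case True
    then have "c * h + z = (c + a) * g + w" by (simp add: aw algebra_simps)
    then show ?thesis using aw lin_step assms(2) by blast
  next
    case False
    then have "c * h + w \<in> lin A G" using lin_step aw by (auto intro: lin.lin_step)
    moreover have "c * h + z = a * g + (c * h + w)" by (simp add: aw algebra_simps)
    ultimately show ?thesis using aw by blast
  qed
qed

text \<open>Nakayama's lemma in the form: finitely many generators of a module that lie in a submodule modulo
\<open>\<mm>\<close> times the module all lie in the submodule. One generator is eliminated at a time, since its own
coefficient \<open>a \<in> \<mm>\<close> can be moved to the left, where \<open>1 - a\<close> is a unit.\<close>

lemma nakayama:
  assumes "finite G" "\<And>g. g \<in> G \<Longrightarrow> \<exists>n\<in>lin R N. \<exists>w\<in>lin \<mm> G. g = n + w"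
  shows "G \<subseteq> lin R N"
  using assms
proof (induction G rule: finite_induct)
  case empty
  then show ?case by simp
next
  case (insert g G)
  obtain n w where nw: "n \<in> lin R N" "w \<in> lin \<mm> (insert g G)" "g = n + w"
    using insert.prems[of g] by blast
  obtain a w' where aw: "a \<in> \<mm>" "w' \<in> lin \<mm> G" "w = a * g + w'"
    using lin_insert[OF nw(2) m_add m_zero] by blast
  let ?c = "inverse (1 - a)"
  have c: "?c \<in> R" using aw(1) by (rule unit_minus_m)
  have eq: "(1 - a) * g = n + w'"
    unfolding left_diff_distrib using nw(3) aw(3) by (simp add: diff_eq_eq add.assoc add.commute)
  have "g = ?c * ((1 - a) * g)"
    using unit_nonzero[OF aw(1)] by (simp add: mult.assoc[symmetric])
  also have "\<dots> = ?c * n + ?c * w'" unfolding eq by (rule distrib_left)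
  finally have g: "g = ?c * n + ?c * w'" .
  have gn: "?c * n \<in> lin R N" by (rule lin_R_smult[OF c nw(1)])
  have gw: "?c * w' \<in> lin \<mm> G" by (rule lin_m_smult[OF c aw(2)])
  have "G \<subseteq> lin R N"
  proof (rule insert.IH)
    fix h assume "h \<in> G"
    then obtain n2 w2 where nw2: "n2 \<in> lin R N" "w2 \<in> lin \<mm> (insert g G)" "h = n2 + w2"
      using insert.prems[of h] by blast
    obtain b w3 where bw: "b \<in> \<mm>" "w3 \<in> lin \<mm> G" "w2 = b * g + w3"
      using lin_insert[OF nw2(2) m_add m_zero] by blast
    have "b * g = b * (?c * n + ?c * w')" by (rule arg_cong[OF g])
    also have "\<dots> = b * (?c * n) + b * (?c * w')" by (rule distrib_left)
    finally have "b * g = b * (?c * n) + b * (?c * w')" .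
    then have "h = (n2 + b * (?c * n)) + (b * (?c * w') + w3)"
      by (simp add: nw2(3) bw(3) add.assoc)
    moreover have "n2 + b * (?c * n) \<in> lin R N"
      using nw2(1) gn bw(1) m_R by (auto intro!: lin_add lin_R_smult)
    moreover have "b * (?c * w') + w3 \<in> lin \<mm> G"
      using gw bw m_R by (auto intro!: lin_add lin_m_smult)
    ultimately show "\<exists>n\<in>lin R N. \<exists>w\<in>lin \<mm> G. h = n + w" by blast
  qed
  moreover have "g \<in> lin R N"
  proof -
    have "?c * w' \<in> lin R G" using gw lin_m_subset_lin_R by blast
    then have "?c * w' \<in> lin R N" using lin_R_lin_R[OF \<open>G \<subseteq> lin R N\<close>] by blast
    with gn have "?c * n + ?c * w' \<in> lin R N" by (rule lin_add)
    then show ?thesis by (subst g)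
  qed
  ultimately show ?case by simp
qed

text \<open>The elements of \<open>\<mm>\<close> and of \<open>X\<close>, closed under the operations of an \<open>R\<close>-algebra without unit: the
augmentation ideal of \<open>R[X]\<close> enlarged by \<open>\<mm>\<close>. All of it is to be sent to \<open>0\<close>.\<close>

inductive_set nil_ideal :: "'u set \<Rightarrow> 'u set" for X where
  nil_m: "a \<in> \<mm> \<Longrightarrow> a \<in> nil_ideal X"
| nil_gen: "a \<in> X \<Longrightarrow> a \<in> nil_ideal X"
| nil_add: "a \<in> nil_ideal X \<Longrightarrow> b \<in> nil_ideal X \<Longrightarrow> a + b \<in> nil_ideal X"
| nil_smult: "r \<in> R \<Longrightarrow> a \<in> nil_ideal X \<Longrightarrow> r * a \<in> nil_ideal X"
| nil_mult: "a \<in> nil_ideal X \<Longrightarrow> b \<in> nil_ideal X \<Longrightarrow> a * b \<in> nil_ideal X"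

lemma nil_ideal_D:
  assumes "\<And>a. a \<in> X \<Longrightarrow> D a \<in> nil_ideal X" "a \<in> nil_ideal X"
  shows "D a \<in> nil_ideal X"
  using assms(2)
  by induction (auto simp: D_add D_mult assms(1) intro: nil_ideal.intros m_D R_D)

text \<open>The differential subring of the product of the field with itself that is generated by the graph of
\<open>f\<close> and the pair \<open>(z, z')\<close>. It is the graph of an extension of \<open>f\<close> to the differential ring
generated by \<open>z\<close> as soon as no pair \<open>(0, b)\<close> with \<open>b \<noteq> 0\<close> occurs.\<close>

inductive_set ext_graph :: "'u \<Rightarrow> 'u \<Rightarrow> ('u \<times> 'u) set" for z z' where
  ext_R: "a \<in> R \<Longrightarrow> (a, f a) \<in> ext_graph z z'"
| ext_gen: "(z, z') \<in> ext_graph z z'"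
| ext_add: "(a, b) \<in> ext_graph z z' \<Longrightarrow> (c, d) \<in> ext_graph z z' \<Longrightarrow> (a + c, b + d) \<in> ext_graph z z'"
| ext_mult: "(a, b) \<in> ext_graph z z' \<Longrightarrow> (c, d) \<in> ext_graph z z' \<Longrightarrow> (a * c, b * d) \<in> ext_graph z z'"
| ext_D: "(a, b) \<in> ext_graph z z' \<Longrightarrow> (D a, D b) \<in> ext_graph z z'"

definition specializes :: "'u \<Rightarrow> 'u \<Rightarrow> bool" where
  "specializes z z' \<longleftrightarrow> (\<forall>b. (0, b) \<in> ext_graph z z' \<longrightarrow> b = 0)"

text \<open>Every element of the differential ring generated by \<open>z\<close> is the sum of an element of \<open>R\<close> and an
element of the ideal. Applying \<open>f\<close> to the first summand is well defined, because an element of \<open>R\<close>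
that lies in the proper ideal is not a unit, hence is killed by \<open>f\<close>.\<close>

lemma specializes_zero_if_nil:
  assumes "\<And>a. a \<in> X \<Longrightarrow> D a \<in> nil_ideal X" "z \<in> nil_ideal X" "1 \<notin> nil_ideal X"
  shows "specializes z 0"
  unfolding specializes_def
proof safe
  have *: "\<exists>r\<in>R. \<exists>n\<in>nil_ideal X. a = r + n \<and> b = f r" if "(a, b) \<in> ext_graph z 0" for a b
    using that
  proof induction
    case (ext_R a)
    then show ?case using nil_m[OF m_zero] by (rule_tac x = a in bexI, rule_tac x = 0 in bexI) auto
  next
    case ext_gen
    then show ?case using assms(2) R_zero f_zero by (rule_tac x = 0 in bexI, rule_tac x = z in bexI) auto
  next
    case (ext_add a b c d)
    then obtain r n r' n' where "r \<in> R" "n \<in> nil_ideal X" "a = r + n" "b = f r"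
      "r' \<in> R" "n' \<in> nil_ideal X" "c = r' + n'" "d = f r'" by blast
    then show ?case
      by (rule_tac x = "r + r'" in bexI, rule_tac x = "n + n'" in bexI) (auto simp: R_add f_add nil_add)
  next
    case (ext_mult a b c d)
    then obtain r n r' n' where *: "r \<in> R" "n \<in> nil_ideal X" "a = r + n" "b = f r"
      "r' \<in> R" "n' \<in> nil_ideal X" "c = r' + n'" "d = f r'" by blast
    have "r * n' + (r' * n + n * n') \<in> nil_ideal X"
      by (rule nil_add[OF nil_smult[OF *(1,6)] nil_add[OF nil_smult[OF *(5,2)] nil_mult[OF *(2,6)]]])
    moreover have "a * c = r * r' + (r * n' + (r' * n + n * n'))"
      by (simp add: * algebra_simps)
    ultimately show ?case using * R_mult f_mult by metis
  next
    case (ext_D a b)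
    then obtain r n where "r \<in> R" "n \<in> nil_ideal X" "a = r + n" "b = f r" by blast
    then show ?case
      using nil_ideal_D[OF assms(1)]
      by (rule_tac x = "D r" in bexI, rule_tac x = "D n" in bexI) (auto simp: D_add R_D f_D)
  qed
  fix b assume "(0, b) \<in> ext_graph z 0"
  then obtain r n where rn: "r \<in> R" "n \<in> nil_ideal X" "0 = r + n" "b = f r" using * by blast
  show "b = 0"
  proof (rule ccontr)
    assume "b \<noteq> 0"
    then have "inverse r \<in> R" "r \<noteq> 0" using R_inverse rn f_zero by auto
    moreover have "r = - n" using rn(3) by (simp add: eq_neg_iff_add_eq_0)
    ultimately have "1 = (- inverse r) * n" by simp
    moreover have "(- inverse r) * n \<in> nil_ideal X"
      using \<open>inverse r \<in> R\<close> rn by (intro nil_smult R_uminus)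
    ultimately show False using assms(3) by metis
  qed
qed

section \<open>Making a relation between y and s monic in s\<close>

context
  fixes y s :: 'u
  assumes Dy: "D y = - s * y" and Ds: "D s = s * y - s\<^sup>2"
begin

lemma D_monomial:
  "D (y ^ i * s ^ j) = of_nat j * (y ^ Suc i * s ^ j) - of_nat (i + j) * (y ^ i * s ^ Suc j)"
proof -
  have "D (y ^ i) = - of_nat i * s * y ^ i"
    unfolding D_power[of y i] Dy by (cases i) (auto simp: algebra_simps simp del: of_nat_Suc)
  moreover have "D (s ^ j) = of_nat j * (y * s ^ j - s ^ Suc j)"
    unfolding D_power[of s j] Ds
    by (cases j) (auto simp: algebra_simps power2_eq_square simp del: of_nat_Suc)
  ultimately show ?thesis by (simp add: D_mult ring_distribs mult.left_commute mult.commute add.commute)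
qed

text \<open>The monomials of degree \<open>e - 1\<close>, and none if \<open>e = 0\<close>.\<close>

definition mons_pred :: "nat \<Rightarrow> 'u set" where
  "mons_pred e = {y ^ i * s ^ j | i j. Suc (i + j) = e}"

text \<open>Forms of degree \<open>e\<close> in \<open>y\<close> and \<open>s\<close> with integral coefficients, where \<open>q\<close> is the coefficient of
\<open>s\<^sup>e\<close>. Integral coefficients are constants, so that the derivation maps such forms to such forms.\<close>

definition int_form :: "nat \<Rightarrow> int \<Rightarrow> 'u set" where
  "int_form e q = {of_int q * s ^ e + y * h | h. h \<in> lin \<int> (mons_pred e)}"

text \<open>Combinations with coefficients in \<open>\<mm>\<close> of degree at most \<open>n + i\<close>, where the monomials of top degree
\<open>n + i\<close> contain \<open>s\<close> at least \<open>i\<close> times. For \<open>i = 0\<close> this is everything of degree at most \<open>n\<close> with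
coefficients in \<open>\<mm>\<close>; for \<open>i > n\<close> the top degree has disappeared.\<close>

definition filtered :: "nat \<Rightarrow> nat \<Rightarrow> 'u set" where
  "filtered n i = lin \<mm> {y ^ a * s ^ b | a b. a + b < n + i \<or> (a + b = n + i \<and> i \<le> b \<and> b \<le> n)}"

text \<open>With \<open>c\<close> the degree of a monomial \<open>y\<^sup>a s\<^sup>b\<close>, the terms with \<open>s\<^bsup>b+1\<^esup>\<close> in \<open>D\<close> and in multiplication by
\<open>c s\<close> cancel, and the monomial is multiplied by \<open>(b - i) y\<close>. The choice \<open>i = b\<close> annihilates it.\<close>

definition degree_raise :: "nat \<Rightarrow> nat \<Rightarrow> 'u \<Rightarrow> 'u" where
  "degree_raise c i g = D g + of_nat c * s * g - of_nat i * y * g"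

lemma degree_raise_add: "degree_raise c i (u + v) = degree_raise c i u + degree_raise c i v"
  by (simp add: degree_raise_def D_add algebra_simps)

lemma Ints_lin_smult: "a \<in> \<int> \<Longrightarrow> z \<in> lin \<int> G \<Longrightarrow> a * z \<in> lin \<int> G"
  by (rule lin_mult_left, assumption) (metis Ints_mult lin_gen mult.assoc)

text \<open>The leading coefficient is multiplied by the difference between \<open>c\<close> and the degree of the form,
which does not vanish in the situation of interest: there \<open>c\<close> is the larger degree in which the form
is a combination with coefficients in \<open>\<mm>\<close>.\<close>

lemma degree_raise_int_form:
  assumes "g \<in> int_form e q"
  shows "degree_raise c i g \<in> int_form (Suc e) (q * (int c - int e))"
proof -
  let ?G = "mons_pred e" and ?H = "mons_pred (Suc e)"
  obtain h where h: "h \<in> lin \<int> ?G" "g = of_int q * s ^ e + y * h"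
    using assms by (auto simp: int_form_def)
  have HI: "y ^ a * s ^ b \<in> ?H" if "a + b = e" for a b using that by (auto simp: mons_pred_def)
  have yG: "y * g \<in> ?H" and sG: "s * g \<in> ?H" if "g \<in> ?G" for g
  proof -
    from that obtain i j where *: "g = y ^ i * s ^ j" "Suc (i + j) = e" by (auto simp: mons_pred_def)
    have eq: "y * g = y ^ Suc i * s ^ j" "s * g = y ^ i * s ^ Suc j" by (simp_all add: *)
    show "y * g \<in> ?H" "s * g \<in> ?H" unfolding eq by (rule HI, use *(2) in simp)+
  qed
  have yh: "y * h \<in> lin \<int> ?H" and sh: "s * h \<in> lin \<int> ?H"
    using lin_mult_elem[OF h(1)] yG sG by blast+
  have Dh: "D h \<in> lin \<int> ?H"
    using h(1)
  proof (rule lin_additive_image)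
    fix a g :: 'u assume a: "a \<in> \<int>" and g: "g \<in> ?G"
    from g obtain i j where *: "g = y ^ i * s ^ j" "Suc (i + j) = e" by (auto simp: mons_pred_def)
    have 1: "y ^ Suc i * s ^ j \<in> ?H" "y ^ i * s ^ Suc j \<in> ?H"
      using HI[of "Suc i" j] HI[of i "Suc j"] *(2) by auto
    have "D (a * g) = (a * of_nat j) * (y ^ Suc i * s ^ j) + (- a * of_nat (i + j)) * (y ^ i * s ^ Suc j)"
    proof -
      have "D a = 0" using a by (auto elim!: Ints_cases simp: D_of_int)
      then show ?thesis unfolding D_mult[of a] unfolding *(1) D_monomial by (simp add: algebra_simps)
    qed
    also have "\<dots> \<in> lin \<int> ?H"
      using a by (intro lin_add lin_gen 1 Ints_mult Ints_minus Ints_of_nat)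
    finally show "D (a * g) \<in> lin \<int> ?H" .
  qed (auto simp: D_zero D_add intro: lin_zero lin_add)
  have se: "s ^ e \<in> ?H" using HI[of 0 e] by simp
  define h' where "h' = of_int (q * (int e - int i)) * s ^ e
      + ((- 1) * (s * h) + (D h + (of_nat c * (s * h) + (- of_nat i) * (y * h))))"
  have "h' \<in> lin \<int> ?H"
    unfolding h'_def
    by (intro lin_add lin_gen[OF _ se] Ints_lin_smult[OF _ sh] Ints_lin_smult[OF _ yh] Dh) auto
  moreover have Dse: "D (s ^ e) = of_nat e * (y * s ^ e - s ^ Suc e)"
    using D_monomial[of 0 e] by (simp add: algebra_simps)
  have "degree_raise c i g = of_int (q * (int c - int e)) * s ^ Suc e + y * h'"
    unfolding degree_raise_def h h'_def
    by (simp add: D_add D_mult D_of_int Dy Dse algebra_simps)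
  ultimately show ?thesis unfolding int_form_def by blast
qed

text \<open>Differentiating the coefficients does not raise the degree, and \<open>\<mm>\<close> is a differential ideal. So in
top degree only the diagonal action remains, and it removes the monomials with exactly \<open>i\<close> factors
\<open>s\<close>.\<close>

lemma degree_raise_filtered:
  assumes "g \<in> filtered n i"
  shows "degree_raise (n + i) i g \<in> filtered n (Suc i)"
  using assms unfolding filtered_def
proof (rule lin_additive_image)
  let ?H = "{y ^ a * s ^ b | a b. a + b < n + Suc i \<or> (a + b = n + Suc i \<and> Suc i \<le> b \<and> b \<le> n)}"
  show "degree_raise (n + i) i 0 \<in> lin \<mm> ?H" by (simp add: degree_raise_def D_zero lin_zero)
  fix r g assume r: "r \<in> \<mm>"
    and "g \<in> {y ^ a * s ^ b | a b. a + b < n + i \<or> (a + b = n + i \<and> i \<le> b \<and> b \<le> n)}"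
  then obtain a b where g: "g = y ^ a * s ^ b" and ab: "a + b < n + i \<or> (a + b = n + i \<and> i \<le> b \<and> b \<le> n)"
    by blast
  have 0: "g \<in> ?H" unfolding g using ab by fastforce
  have rs: "of_int k * r \<in> \<mm>" for k using r m_mult R_of_int by blast
  have eq: "degree_raise (n + i) i (r * g) = D r * g + ((of_int (int b - int i) * r) * (y ^ Suc a * s ^ b)
      + (of_int (int (n + i) - int (a + b)) * r) * (y ^ a * s ^ Suc b))"
    unfolding degree_raise_def D_mult[of r] unfolding g D_monomial by (simp add: algebra_simps)
  have 1: "(of_int (int b - int i) * r) * (y ^ Suc a * s ^ b) \<in> lin \<mm> ?H"
  proof (cases "b = i \<and> a + b = n + i")
    case True
    then show ?thesis by (simp add: lin_zero)
  next
    case False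
    then have "y ^ Suc a * s ^ b \<in> ?H" using ab by fastforce
    then show ?thesis using rs by (rule lin_gen[rotated])
  qed
  have 2: "(of_int (int (n + i) - int (a + b)) * r) * (y ^ a * s ^ Suc b) \<in> lin \<mm> ?H"
  proof (cases "a + b = n + i")
    case True
    then show ?thesis by (simp add: lin_zero)
  next
    case False
    then have "y ^ a * s ^ Suc b \<in> ?H" using ab by fastforce
    then show ?thesis using rs by (rule lin_gen[rotated])
  qed
  show "degree_raise (n + i) i (r * g) \<in> lin \<mm> ?H"
    unfolding eq by (intro lin_add lin_gen m_D r 0 1 2)
qed (auto simp: degree_raise_add intro: lin_add)

text \<open>Applying the operators for \<open>i = 0, \<dots>, n\<close> removes the whole top degree \<open>2 n + 1\<close>. The excess of the
degree of the combination over the degree of the form drops from \<open>n - e\<close> to \<open>n - e - 1\<close>.\<close>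

lemma lower_excess:
  assumes "g \<in> int_form e q" "g \<in> lin \<mm> (mons y s n)" "e < n" "q \<noteq> 0"
  shows "\<exists>g' q'. q' \<noteq> 0 \<and> g' \<in> int_form (e + n + 1) q' \<and> g' \<in> lin \<mm> (mons y s (2 * n))"
proof -
  have "mons y s n \<subseteq> {y ^ a * s ^ b | a b. a + b < n + 0 \<or> (a + b = n + 0 \<and> 0 \<le> b \<and> b \<le> n)}"
    by (fastforce simp: mons_def)
  then have "g \<in> filtered n 0" using assms(2) lin_mono[OF order_refl] unfolding filtered_def by blast
  then have "\<exists>g' q'. q' \<noteq> 0 \<and> g' \<in> int_form (e + i) q' \<and> g' \<in> filtered n i" for i
  proof (induction i)
    case 0
    then show ?case using assms by auto
  next
    case (Suc i)
    then obtain g' q' where *: "q' \<noteq> 0" "g' \<in> int_form (e + i) q'" "g' \<in> filtered n i" by blast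
    have "q' * (int (n + i) - int (e + i)) \<noteq> 0" using * assms by simp
    then show ?case
      using degree_raise_int_form[OF *(2), of "n + i" i] degree_raise_filtered[OF *(3)] by (metis add_Suc_right)
  qed
  from this[of "Suc n"] obtain g' q' where *: "q' \<noteq> 0" "g' \<in> int_form (e + Suc n) q'" "g' \<in> filtered n (Suc n)"
    by blast
  have "{y ^ a * s ^ b | a b. a + b < n + Suc n \<or> (a + b = n + Suc n \<and> Suc n \<le> b \<and> b \<le> n)} \<subseteq> mons y s (2 * n)"
    by (fastforce simp: mons_def)
  then have "g' \<in> lin \<mm> (mons y s (2 * n))"
    using *(3) lin_mono[OF order_refl] unfolding filtered_def by blast
  then show ?thesis using * by auto
qed

lemma int_form_in_own_degree:
  assumes "1 \<in> lin \<mm> (mons y s n)"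
  shows "\<exists>e g q. q \<noteq> 0 \<and> g \<in> int_form e q \<and> g \<in> lin \<mm> (mons y s e)"
proof -
  have *: "\<exists>e g q. q \<noteq> 0 \<and> g \<in> int_form e q \<and> g \<in> lin \<mm> (mons y s e)"
    if "g \<in> int_form e q" "g \<in> lin \<mm> (mons y s (e + j))" "q \<noteq> 0" for g e q j
    using that
  proof (induction j arbitrary: g e q)
    case 0
    then show ?case by auto
  next
    case (Suc j)
    from lower_excess[OF Suc.prems(1,2) _ Suc.prems(3)]
    obtain g' q' where "q' \<noteq> 0" "g' \<in> int_form (e + (e + Suc j) + 1) q'" "g' \<in> lin \<mm> (mons y s (2 * (e + Suc j)))"
      by auto
    moreover have "2 * (e + Suc j) = (e + (e + Suc j) + 1) + j" by simp
    ultimately show ?case using Suc.IH by metis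
  qed
  have "1 \<in> int_form 0 1" unfolding int_form_def by (auto intro!: exI[of _ 0] lin_zero)
  then show ?thesis using *[of 1 0 1 n] assms by auto
qed

end

section \<open>The specialization to zero\<close>

lemma lin_empty: "lin A {} = {0}"
  by (auto elim: lin.cases intro: lin_zero)

text \<open>Throughout, \<open>x\<close> is a non-zero solution, and \<open>B\<close> is the ring \<open>R[x, u]\<close>.\<close>

context
  fixes x u y s :: 'u
  assumes x0: "x \<noteq> 0" and u: "u = D x" and eqn: "x * D u = u"
    and y: "y = inverse x" and s: "s = u * y"
begin

lemma Du: "D u = u * y"
proof -
  have "D u = inverse x * (x * D u)" using x0 by simp
  then show ?thesis by (simp add: eqn y mult.commute)
qed

lemma D_y: "D y = - s * y"
  by (simp add: y D_inverse[OF x0] s u[symmetric] power2_eq_square)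

lemma D_s: "D s = s * y - s\<^sup>2"
  by (simp add: s D_mult Du D_y power2_eq_square algebra_simps)

lemma xy: "x * y = 1" using x0 by (simp add: y)

lemma u_sx: "u = x * s" using x0 by (simp add: s y)

text \<open>The passage from the coordinates \<open>y, s\<close> near infinity to \<open>x, u\<close>.\<close>

lemma rescale: "z \<in> lin A (mons y s n) \<Longrightarrow> x ^ n * z \<in> lin A (mons x u n)"
proof (erule lin_mult_elem)
  fix h assume "h \<in> mons y s n"
  then obtain i j where h: "h = y ^ i * s ^ j" "i + j \<le> n" by (auto simp: mons_def)
  then have "x ^ n = x ^ (n - (i + j)) * x ^ j * x ^ i" by (simp flip: power_add)
  then have "x ^ n * h = x ^ (n - (i + j)) * (x * s) ^ j * (x * y) ^ i"
    by (simp add: h power_mult_distrib mult_ac)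
  also have "\<dots> = x ^ (n - (i + j)) * u ^ j" by (simp add: xy u_sx)
  finally show "x ^ n * h \<in> mons x u n" using h by (auto intro: monsI)
qed

abbreviation "B \<equiv> lin R (allmons x u)"

definition xB :: "'u set" where "xB = {x * b | b. b \<in> B}"

lemma B_add: "a \<in> B \<Longrightarrow> b \<in> B \<Longrightarrow> a + b \<in> B" by (rule lin_add)

lemma B_mult: "a \<in> B \<Longrightarrow> b \<in> B \<Longrightarrow> a * b \<in> B"
  by (erule (1) lin_R_mult_R) (rule allmons_mult)

lemma B_mon: "x ^ i * u ^ j \<in> B" by (intro lin_R_gen allmonsI)

lemma B_R: "r \<in> R \<Longrightarrow> r \<in> B"
  using lin_gen[OF _ allmonsI[of x 0 u 0], of r R] by simp

lemma B_x: "x \<in> B" and B_u: "u \<in> B" and B_u_power: "u ^ j \<in> B"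
  using B_mon[of 1 0] B_mon[of 0 1] B_mon[of 0 j] by simp_all

lemma B_power: "b \<in> B \<Longrightarrow> b ^ n \<in> B"
  by (induction n) (auto simp: B_R[OF R_one] intro: B_mult)

lemma xB_add: "a \<in> xB \<Longrightarrow> b \<in> xB \<Longrightarrow> a + b \<in> xB"
  unfolding xB_def by (auto simp flip: distrib_left intro: B_add)

lemma xB_mult: "b \<in> B \<Longrightarrow> a \<in> xB \<Longrightarrow> b * a \<in> xB"
  unfolding xB_def by (auto simp: mult.left_commute intro: B_mult)

lemma xB_zero: "0 \<in> xB"
  unfolding xB_def by (auto intro: lin_zero exI[of _ 0])

lemma xB_I: "b \<in> B \<Longrightarrow> x * b \<in> xB"
  unfolding xB_def by blast

text \<open>The derivation \<open>x D\<close> preserves \<open>B\<close>, although \<open>D\<close> does not. Modulo \<open>x\<close> it has the eigenvector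
\<open>u\<^sup>j\<close> with eigenvalue \<open>j\<close>.\<close>

lemma xD_monomial: "x * D (x ^ i * u ^ j) = of_nat i * (x ^ i * u ^ Suc j) + of_nat j * (x ^ i * u ^ j)"
proof -
  have "x * D (x ^ i) = of_nat i * (x ^ i * u)"
    unfolding D_power[of x i] u by (cases i) (auto simp: algebra_simps simp del: of_nat_Suc)
  moreover have "x * D (u ^ j) = of_nat j * u ^ j"
    unfolding D_power[of u j] Du using x0
    by (cases j) (auto simp: y field_simps simp del: of_nat_Suc)
  moreover have "x * D (x ^ i * u ^ j) = (x * D (x ^ i)) * u ^ j + x ^ i * (x * D (u ^ j))"
    by (simp add: D_mult algebra_simps)
  ultimately show ?thesis by (simp add: algebra_simps)
qed

lemma xD_B: "b \<in> B \<Longrightarrow> x * D b \<in> B"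
proof (erule lin_additive_image)
  fix r g assume r: "r \<in> R" and "g \<in> allmons x u"
  then obtain i j where g: "g = x ^ i * u ^ j" by (auto simp: allmons_def)
  have "x * D (r * g) = (x * D r) * g + r * (x * D g)" by (simp add: D_mult algebra_simps)
  also have "\<dots> \<in> B"
    unfolding g xD_monomial
    by (intro B_add B_mult[OF B_mult[OF B_x B_R[OF R_D[OF r]]] B_mon] B_mult[OF B_R[OF r]]
        B_mult[OF B_R[OF R_of_nat] B_mon])
  finally show "x * D (r * g) \<in> B" .
qed (auto simp: D_zero D_add distrib_left intro: lin_zero lin_add)

text \<open>The operator \<open>x D - l\<close> transported to \<open>x\<^sup>t B\<close>, that is, conjugated by multiplication with \<open>x\<^sup>t\<close>; this
produces the term \<open>t u\<close>.\<close>

definition shift :: "nat \<Rightarrow> nat \<Rightarrow> 'u \<Rightarrow> 'u" where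
  "shift t l b = x * D b + of_nat t * u * b - of_nat l * b"

lemma shift_add: "shift t l (a + b) = shift t l a + shift t l b"
  by (simp add: shift_def D_add algebra_simps)

lemma shift_zero: "shift t l 0 = 0"
  by (simp add: shift_def D_zero)

lemma shift_B: "b \<in> B \<Longrightarrow> shift t l b \<in> B"
  unfolding shift_def
  by (intro lin_R_diff B_add xD_B B_mult[OF B_mult[OF B_R[OF R_of_nat] B_u]] B_mult[OF B_R[OF R_of_nat]])

lemma shift_x_power: "shift t l (x ^ k * b) = x ^ k * shift (t + k) l b"
proof -
  have "x * D (x ^ k) = of_nat k * u * x ^ k"
    using xD_monomial[of k 0] by (simp add: algebra_simps)
  moreover have "shift t l (x ^ k * b) = (x * D (x ^ k)) * b + x ^ k * (x * D b + of_nat t * u * b - of_nat l * b)"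
    by (simp add: shift_def D_mult algebra_simps)
  ultimately show ?thesis by (simp add: shift_def algebra_simps)
qed

lemma shift_xB: "b \<in> xB \<Longrightarrow> shift t l b \<in> xB"
  unfolding xB_def using shift_x_power[of t l 1] shift_B by auto

definition upow :: "nat \<Rightarrow> nat \<Rightarrow> 'u set" where
  "upow l e = {u ^ j | j. l \<le> j \<and> j < e}"

text \<open>Modulo \<open>x\<close>, the span of the powers \<open>u\<^sup>l, \<dots>, u\<^bsup>e-1\<^esup>\<close>.\<close>

definition low :: "nat \<Rightarrow> nat \<Rightarrow> 'u set" where
  "low l e = {a + b | a b. a \<in> lin R (upow l e) \<and> b \<in> xB}"

lemma low_add: "a \<in> low l e \<Longrightarrow> b \<in> low l e \<Longrightarrow> a + b \<in> low l e"
proof -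
  assume "a \<in> low l e" "b \<in> low l e"
  then obtain a1 a2 b1 b2 where "a1 \<in> lin R (upow l e)" "a2 \<in> lin R (upow l e)" "b1 \<in> xB" "b2 \<in> xB"
    "a = a1 + b1" "b = a2 + b2" by (auto simp: low_def)
  moreover from this have "a + b = (a1 + a2) + (b1 + b2)" by simp
  ultimately show ?thesis unfolding low_def using lin_add xB_add by blast
qed

lemma low_xB: "b \<in> xB \<Longrightarrow> b \<in> low l e"
  unfolding low_def by (force intro: lin_zero)

lemma low_u: "r \<in> R \<Longrightarrow> l \<le> j \<Longrightarrow> j < e \<Longrightarrow> r * u ^ j \<in> low l e"
  unfolding low_def upow_def by (force intro: lin_gen xB_zero)

lemma low_end: "low e e = xB"
proof -
  have "upow e e = {}" by (auto simp: upow_def)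
  then show ?thesis by (auto simp: low_def lin_empty)
qed

lemma shift_u_power: "shift t l (r * u ^ j) =
    x * (D r * u ^ j) + ((of_int (int j - int l) * r) * u ^ j + (of_nat t * r) * u ^ Suc j)"
proof -
  have "x * D (u ^ j) = of_nat j * u ^ j" using xD_monomial[of 0 j] by simp
  moreover have "shift t l (r * u ^ j) = x * (D r * u ^ j) + (r * (x * D (u ^ j)) + (of_nat t * r) * u ^ Suc j - of_nat l * r * u ^ j)"
    by (simp add: shift_def D_mult algebra_simps)
  ultimately show ?thesis by (simp add: algebra_simps)
qed

text \<open>On the powers of \<open>u\<close> the operator is triangular, with eigenvalue \<open>j - l\<close> on \<open>u\<^sup>j\<close>. Hence it removes
the lowest power.\<close>

lemma shift_low:
  assumes "t = 0 \<or> u ^ e \<in> xB" "z \<in> low l e"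
  shows "shift t l z \<in> low (Suc l) e"
proof -
  obtain a b where ab: "a \<in> lin R (upow l e)" "b \<in> xB" "z = a + b" using assms(2) by (auto simp: low_def)
  have "shift t l a \<in> low (Suc l) e" using ab(1)
  proof (rule lin_additive_image)
    fix r g assume r: "r \<in> R" and "g \<in> upow l e"
    then obtain j where g: "g = u ^ j" "l \<le> j" "j < e" by (auto simp: upow_def)
    have 1: "x * (D r * u ^ j) \<in> low (Suc l) e"
      by (intro low_xB xB_I B_mult B_R R_D r B_u_power)
    have 2: "(of_int (int j - int l) * r) * u ^ j \<in> low (Suc l) e"
    proof (cases "j = l")
      case True
      then show ?thesis by (simp add: low_xB xB_zero)
    next
      case False
      then show ?thesis using g r by (intro low_u R_mult R_of_int) auto
    qed
    have 3: "(of_nat t * r) * u ^ Suc j \<in> low (Suc l) e"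
    proof (cases "Suc j = e")
      case True
      show ?thesis
      proof (cases "t = 0")
        case False
        then show ?thesis unfolding True using assms(1) by (blast intro: low_xB xB_mult B_R R_mult R_of_nat r)
      qed (simp add: low_xB xB_zero)
    next
      case False
      then show ?thesis using g r by (intro low_u R_mult R_of_nat) auto
    qed
    show "shift t l (r * g) \<in> low (Suc l) e"
      unfolding g(1) shift_u_power by (intro low_add 1 2 3)
  qed (auto simp: shift_zero shift_add intro: low_add low_xB xB_zero)
  moreover have "shift t l b \<in> low (Suc l) e" by (intro low_xB shift_xB ab)
  ultimately show ?thesis by (simp add: ab(3) shift_add low_add)
qed

text \<open>Modulo \<open>x\<close> the hypothesis is a relation of degree \<open>e\<close> for \<open>u\<close> whose leading coefficient is a unit.
The operators \<open>x D - l\<close> for \<open>l < e\<close> remove its lower terms one after another and multiply the leading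
term by \<open>e - l \<noteq> 0\<close>, up to multiples of \<open>x\<close>.\<close>

lemma u_power_in_xB:
  assumes "q \<noteq> 0" "r \<in> lin \<int> (upow 0 e)" "of_int q * u ^ e + r \<in> lin \<mm> (mons x u e)"
  shows "u ^ e \<in> xB"
proof -
  let ?X = "{\<mu> * u ^ e + w | \<mu> w. \<mu> \<in> \<mm> \<and> w \<in> low 0 e}"
  have "lin \<mm> (mons x u e) \<subseteq> ?X"
  proof (rule lin_subset)
    show "0 \<in> ?X" using m_zero low_xB[OF xB_zero] by force
  next
    fix a b assume "a \<in> ?X" "b \<in> ?X"
    then obtain \<mu> w \<mu>' w' where "\<mu> \<in> \<mm>" "\<mu>' \<in> \<mm>" "w \<in> low 0 e" "w' \<in> low 0 e"
      "a = \<mu> * u ^ e + w" "b = \<mu>' * u ^ e + w'" by blast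
    moreover from this have "a + b = (\<mu> + \<mu>') * u ^ e + (w + w')" by (simp add: algebra_simps)
    ultimately show "a + b \<in> ?X" using m_add low_add by blast
  next
    fix \<mu> g assume \<mu>: "\<mu> \<in> \<mm>" and "g \<in> mons x u e"
    then obtain i j where g: "g = x ^ i * u ^ j" "i + j \<le> e" by (auto simp: mons_def)
    then consider "i > 0" | "i = 0" "j = e" | "i = 0" "j < e" by fastforce
    then show "\<mu> * g \<in> ?X"
    proof cases
      case 1
      then obtain k where "i = Suc k" by (cases i) auto
      then have "\<mu> * g = x * (\<mu> * (x ^ k * u ^ j))" by (simp add: g)
      also have "\<dots> \<in> xB" using \<mu> m_R by (intro xB_I B_mult B_R B_mon) auto
      finally have "\<mu> * g = 0 * u ^ e + \<mu> * g \<and> 0 \<in> \<mm> \<and> \<mu> * g \<in> low 0 e"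
        by (simp add: low_xB m_zero)
      then show ?thesis by blast
    next
      case 2
      then have "\<mu> * g = \<mu> * u ^ e + 0 \<and> \<mu> \<in> \<mm> \<and> 0 \<in> low 0 e" by (simp add: g \<mu> low_xB xB_zero)
      then show ?thesis by blast
    next
      case 3
      then have "\<mu> * g = 0 * u ^ e + \<mu> * g \<and> 0 \<in> \<mm> \<and> \<mu> * g \<in> low 0 e"
        using \<mu> m_R by (auto simp: g m_zero intro: low_u)
      then show ?thesis by blast
    qed
  qed
  then obtain \<mu> w where \<mu>: "\<mu> \<in> \<mm>" "w \<in> low 0 e" "of_int q * u ^ e + r = \<mu> * u ^ e + w"
    using assms(3) by blast
  have "\<exists>c\<in>R. f c \<noteq> 0 \<and> c * u ^ e \<in> low l e" for l
  proof (induction l)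
    case 0
    have "r \<in> lin R (upow 0 e)" using assms(2) lin_mono[OF Ints_R order_refl] by blast
    then have "- r \<in> low 0 e" unfolding low_def using lin_R_uminus xB_zero by force
    moreover have "(of_int q - \<mu>) * u ^ e = w + - r" using \<mu>(3) by (simp add: algebra_simps)
    ultimately have "(of_int q - \<mu>) * u ^ e \<in> low 0 e" using \<mu>(2) low_add by metis
    moreover have "of_int q - \<mu> \<in> R" "f (of_int q - \<mu>) \<noteq> 0"
      using \<mu>(1) assms(1) by (auto simp: \<mm>_def R_diff R_of_int f_diff f_of_int)
    ultimately show ?case by blast
  next
    case (Suc l)
    then obtain c where c: "c \<in> R" "f c \<noteq> 0" "c * u ^ e \<in> low l e" by blast
    show ?case
    proof (cases "l < e")
      case True
      have eq: "(of_int (int e - int l) * c) * u ^ e = shift 0 l (c * u ^ e) + x * (- D c * u ^ e)"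
        by (simp add: shift_u_power)
      have "x * (- D c * u ^ e) \<in> low (Suc l) e"
        by (intro low_xB xB_I B_mult B_u_power B_R R_uminus R_D c)
      then have "(of_int (int e - int l) * c) * u ^ e \<in> low (Suc l) e"
        unfolding eq using shift_low[OF _ c(3), of 0] by (intro low_add) auto
      moreover have "of_int (int e - int l) * c \<in> R" by (intro R_mult R_of_int c)
      moreover have "f (of_int (int e - int l) * c) \<noteq> 0"
        using True c(2) f_mult[OF R_of_int c(1), of "int e - int l"] f_of_int[of "int e - int l"]
        by (simp del: of_int_diff)
      ultimately show ?thesis by blast
    next
      case False
      then have "upow l e = upow (Suc l) e" unfolding upow_def by auto
      then have "low l e = low (Suc l) e" unfolding low_def by simp
      then show ?thesis using c by auto
    qed
  qed
  from this[of e] obtain c where c: "c \<in> R" "f c \<noteq> 0" "c * u ^ e \<in> xB" by (auto simp: low_end)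
  have "inverse c * (c * u ^ e) \<in> xB" by (rule xB_mult[OF B_R[OF R_inverse[OF c(1,2)]] c(3)])
  moreover have "c \<noteq> 0" using c f_zero by auto
  then have "inverse c * (c * u ^ e) = u ^ e" by simp
  ultimately show ?thesis by simp
qed

lemma B_subset_low:
  assumes "u ^ e \<in> xB"
  shows "B \<subseteq> low 0 e"
proof (rule lin_subset)
  show "0 \<in> low 0 e" by (rule low_xB[OF xB_zero])
  fix r g assume r: "r \<in> R" and "g \<in> allmons x u"
  then obtain i j where g: "g = x ^ i * u ^ j" by (auto simp: allmons_def)
  consider k where "i = Suc k" | "i = 0" "j < e" | "i = 0" "e \<le> j" by (cases i) fastforce+
  then show "r * g \<in> low 0 e"
  proof cases
    case 1
    then have eq: "r * g = x * (r * (x ^ k * u ^ j))" by (simp add: g)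
    show ?thesis unfolding eq by (intro low_xB xB_I B_mult B_R B_mon r)
  next
    case 2
    then show ?thesis using r by (simp add: g low_u)
  next
    case 3
    then have eq: "r * g = (r * u ^ (j - e)) * u ^ e" by (simp add: g mult.assoc flip: power_add)
    show ?thesis unfolding eq by (intro low_xB xB_mult B_mult B_R B_u_power r assms)
  qed
qed (rule low_add)

text \<open>If \<open>u\<^sup>e = x\<^sup>k b\<close>, then the operators \<open>x D - l\<close> for \<open>l < e\<close> multiply the left-hand side by the numbers
\<open>e - l\<close>, whereas they move \<open>b\<close> into \<open>x B\<close>. So one more factor \<open>x\<close> can be split off.\<close>

lemma u_power_divisible:
  assumes "u ^ e \<in> xB"
  shows "\<exists>b\<in>B. u ^ e = x ^ k * b"
proof (induction k)
  case 0
  show ?case by (intro bexI[of _ "u ^ e"] B_u_power) simp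
next
  case (Suc k)
  then obtain b0 where b0: "b0 \<in> B" "u ^ e = x ^ k * b0" by blast
  have "l \<le> e \<Longrightarrow> \<exists>c. c \<noteq> 0 \<and> (\<exists>b\<in>low l e. of_nat c * u ^ e = x ^ k * b)" for l
  proof (induction l)
    case 0
    show ?case using b0 B_subset_low[OF assms] by (auto intro!: exI[of _ 1])
  next
    case (Suc l)
    then obtain c b where c: "c \<noteq> 0" "b \<in> low l e" "of_nat c * u ^ e = x ^ k * b" by auto
    have "shift 0 l (of_nat c * u ^ e) = of_nat ((e - l) * c) * u ^ e"
      using Suc.prems by (simp add: shift_u_power D_of_nat of_nat_diff)
    moreover have "shift 0 l (x ^ k * b) = x ^ k * shift k l b" by (simp add: shift_x_power)
    moreover have "shift k l b \<in> low (Suc l) e" using shift_low[OF _ c(2)] assms by blast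
    ultimately have "of_nat ((e - l) * c) * u ^ e = x ^ k * shift k l b" "shift k l b \<in> low (Suc l) e"
      using c(3) by metis+
    moreover have "(e - l) * c \<noteq> 0" using c(1) Suc.prems by simp
    ultimately show ?case by blast
  qed
  from this[of e] obtain c b where c: "c \<noteq> 0" "b \<in> xB" "of_nat c * u ^ e = x ^ k * b"
    by (auto simp: low_end)
  then obtain b' where b': "b' \<in> B" "b = x * b'" by (auto simp: xB_def)
  have "u ^ e = inverse (of_nat c) * (of_nat c * u ^ e)" using c(1) by simp
  also have "\<dots> = x ^ Suc k * (inverse (of_nat c) * b')" by (simp add: c(3) b'(2) algebra_simps)
  finally show ?case using b'(1) B_mult[OF B_R[OF of_nat_unit[OF c(1)]]] by blast
qed

text \<open>The two relations reduce every monomial of large degree to smaller degree modulo \<open>\<mm>\<close>; then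
Nakayama's lemma applies in each degree.\<close>

lemma B_finite:
  assumes xN: "x ^ N \<in> lin \<mm> (mons x u N)"
    and q: "q \<noteq> 0" "r \<in> lin \<int> (upow 0 e)" "of_int q * u ^ e + r \<in> lin \<mm> (mons x u e)"
  shows "B \<subseteq> lin R (mons x u (N + e))"
proof -
  have "mons x u n \<subseteq> lin R (mons x u (N + e))" for n
  proof (induction n)
    case 0
    show ?case using mons_mono[of 0 "N + e" x u] by (auto intro: lin_R_gen)
  next
    case (Suc n)
    show ?case
    proof (rule nakayama)
      show "finite (mons x u (Suc n))" by (rule finite_mons)
    next
      fix g assume "g \<in> mons x u (Suc n)"
      then obtain i j where g: "g = x ^ i * u ^ j" "i + j \<le> Suc n" by (auto simp: mons_def)
      let ?L = "lin R (mons x u (N + e))" and ?S = "lin \<mm> (mons x u (Suc n))"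
      consider "i + j \<le> n" | "i + j \<le> N + e" | "N \<le> i" | "i + j = Suc n" "e \<le> j" "\<not> N \<le> i" using g(2) by fastforce
      then show "\<exists>a\<in>?L. \<exists>w\<in>?S. g = a + w"
      proof cases
        case 1
        then have "g \<in> mons x u n" unfolding g(1) by (rule monsI)
        then show ?thesis using Suc.IH lin_zero by force
      next
        case 2
        then have "g \<in> ?L" unfolding g(1) by (intro lin_R_gen monsI)
        then show ?thesis using lin_zero by force
      next
        case 3
        have "(x ^ (i - N) * u ^ j) * x ^ N \<in> lin \<mm> (mons x u (Suc n))"
        proof (rule lin_mult_elem[OF xN])
          fix h assume "h \<in> mons x u N"
          then have "(x ^ (i - N) * u ^ j) * h \<in> mons x u ((i - N + j) + N)"
            by (intro mons_mult monsI) auto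
          moreover have "(i - N + j) + N \<le> Suc n" using 3 g(2) by simp
          ultimately show "(x ^ (i - N) * u ^ j) * h \<in> mons x u (Suc n)" using mons_mono by blast
        qed
        moreover have "(x ^ (i - N) * u ^ j) * x ^ N = g"
          using 3 by (simp add: g ac_simps flip: power_add mult.assoc)
        ultimately show ?thesis using lin_zero by force
      next
        case 4
        let ?c = "x ^ i * u ^ (j - e)" and ?p = "of_int q * u ^ e + r"
        have "?c * ?p \<in> ?S"
        proof (rule lin_mult_elem[OF q(3)])
          fix h assume "h \<in> mons x u e"
          then have "?c * h \<in> mons x u ((i + (j - e)) + e)"
            by (intro mons_mult monsI) auto
          moreover have "(i + (j - e)) + e \<le> Suc n" using 4 by simp
          ultimately show "?c * h \<in> mons x u (Suc n)" using mons_mono by blast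
        qed
        then have 1: "inverse (of_int q) * (?c * ?p) \<in> ?S" by (rule lin_m_smult[OF of_int_unit[OF q(1)]])
        have "?c * r \<in> lin \<int> (mons x u n)"
        proof (rule lin_mult_elem[OF q(2)])
          fix h assume "h \<in> upow 0 e"
          then obtain l where l: "h = u ^ l" "l < e" by (auto simp: upow_def)
          have "?c * h = x ^ i * u ^ (j - e + l)" by (simp add: l power_add)
          also have "\<dots> \<in> mons x u n" using 4 l by (intro monsI) auto
          finally show "?c * h \<in> mons x u n" .
        qed
        then have "?c * r \<in> ?L" using lin_mono[OF Ints_R order_refl] lin_R_lin_R[OF Suc.IH] by blast
        then have 2: "- (inverse (of_int q) * (?c * r)) \<in> ?L"
          by (intro lin_R_uminus lin_R_smult[OF of_int_unit[OF q(1)]])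
        have "g = ?c * u ^ e" using 4 by (simp add: g mult.assoc flip: power_add)
        also have "\<dots> = - (inverse (of_int q) * (?c * r)) + inverse (of_int q) * (?c * ?p)"
          using q(1) by (simp add: field_simps)
        finally show ?thesis using 1 2 by blast
      qed
    qed
  qed
  then have "allmons x u \<subseteq> lin R (mons x u (N + e))"
    by (force simp: allmons_def intro: monsI)
  then show ?thesis by (rule lin_R_lin_R)
qed

text \<open>Put \<open>v = u / x\<^sup>k\<close>. Then \<open>v\<^sup>e\<close> is divisible by \<open>x\<close>, and a power of \<open>x\<close> lies in \<open>\<mm> B\<close>, so that \<open>x\<close> and
\<open>v\<close> are nilpotent modulo \<open>\<mm>\<close> in \<open>R[x, v]\<close>. If \<open>1\<close> were in the ideal generated by \<open>x\<close> and \<open>v\<close>, then it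
would be in \<open>\<mm> R[x, v]\<close>, which is impossible for a non-zero finite module.\<close>

lemma no_unit_in_positive_part:
  assumes xN: "x ^ N \<in> lin \<mm> (mons x u N)"
    and fin: "B \<subseteq> lin R (mons x u d)" and ue: "u ^ e \<in> xB" and e: "e \<noteq> 0"
  shows "1 \<notin> lin R {x ^ i * (u * y ^ k) ^ j | i j. 0 < i + j}"
proof
  define v where "v = u * y ^ k"
  define T where "T = lin \<mm> (allmons x v)"
  have uv: "u = x ^ k * v" using x0 by (simp add: v_def y field_simps)
  have mons_v: "allmons x u \<subseteq> allmons x v"
  proof
    fix g assume "g \<in> allmons x u"
    then obtain i j where "g = x ^ i * u ^ j" by (auto simp: allmons_def)
    then have "g = x ^ (i + k * j) * v ^ j" by (simp add: uv power_mult_distrib power_add power_mult)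
    then show "g \<in> allmons x v" by (auto intro: allmonsI)
  qed
  have T_mult: "a * b \<in> T" if "a \<in> lin R (allmons x v)" "b \<in> T" for a b
    using that unfolding T_def by (rule lin_R_mult_m) (rule allmons_mult)
  have xN_T: "x ^ N \<in> T"
    using xN mons_subset_allmons[of x u N] mons_v lin_mono[OF order_refl] unfolding T_def by blast
  obtain b where b: "b \<in> B" "v ^ e = x * b"
  proof -
    obtain b where b: "b \<in> B" "u ^ e = x ^ Suc (k * e) * b" using u_power_divisible[OF ue] by blast
    have "u ^ e = x ^ (k * e) * v ^ e" unfolding uv by (simp add: power_mult_distrib power_mult)
    moreover have "x ^ Suc (k * e) * b = x ^ (k * e) * (x * b)" by simp
    ultimately have "x ^ (k * e) * v ^ e = x ^ (k * e) * (x * b)" using b(2) by (simp only:)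
    moreover have "x ^ (k * e) \<noteq> 0" using x0 by simp
    ultimately have "v ^ e = x * b" by (metis mult_left_cancel)
    then show ?thesis using that b(1) by blast
  qed
  have B_v: "B \<subseteq> lin R (allmons x v)" by (rule lin_mono[OF order_refl mons_v])
  have veN: "v ^ (e * N) \<in> T"
  proof -
    have "v ^ (e * N) = b ^ N * x ^ N" by (simp add: power_mult b(2) power_mult_distrib)
    then show ?thesis using T_mult[OF _ xN_T] B_v B_power[OF b(1)] by auto
  qed
  have high: "x ^ i * v ^ j \<in> T" if "N + e * N \<le> i + j" for i j
  proof (cases "N \<le> i")
    case True
    then have "x ^ i * v ^ j = (x ^ (i - N) * v ^ j) * x ^ N"
      by (simp add: ac_simps flip: power_add mult.assoc)
    then show ?thesis using T_mult[OF lin_R_gen[OF allmonsI] xN_T] by metis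
  next
    case False
    then have "e * N \<le> j" using that by simp
    then have "x ^ i * v ^ j = (x ^ i * v ^ (j - e * N)) * v ^ (e * N)"
      by (simp add: mult.assoc flip: power_add)
    then show ?thesis using T_mult[OF lin_R_gen[OF allmonsI] veN] by metis
  qed
  assume "1 \<in> lin R {x ^ i * (u * y ^ k) ^ j | i j. 0 < i + j}"
  then have pos: "1 \<in> lin R {x ^ i * v ^ j | i j. 0 < i + j}" by (simp add: v_def)
  \<comment> \<open>The ideal is supposed to be the unit ideal, hence so are its powers.\<close>
  have "1 \<in> lin R {x ^ i * v ^ j | i j. L \<le> i + j}" for L
  proof (induction L)
    case 0
    have "1 \<in> {x ^ i * v ^ j | i j. 0 \<le> i + j}"
      by (rule CollectI, rule exI[of _ 0], rule exI[of _ 0]) simp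
    then show ?case by (rule lin_R_gen)
  next
    case (Suc L)
    have "1 * 1 \<in> lin R {x ^ i * v ^ j | i j. Suc L \<le> i + j}"
    proof (rule lin_R_mult_R[OF Suc pos])
      fix g h assume "g \<in> {x ^ i * v ^ j | i j. L \<le> i + j}" "h \<in> {x ^ i * v ^ j | i j. 0 < i + j}"
      then obtain i j i' j' where "g = x ^ i * v ^ j" "h = x ^ i' * v ^ j'" "L \<le> i + j" "0 < i' + j'"
        by blast
      then have "g * h = x ^ (i + i') * v ^ (j + j')" by (simp add: power_add ac_simps)
      moreover have "Suc L \<le> (i + i') + (j + j')" using \<open>L \<le> i + j\<close> \<open>0 < i' + j'\<close> by linarith
      ultimately show "g * h \<in> {x ^ i * v ^ j | i j. Suc L \<le> i + j}" by blast
    qed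
    then show ?case by simp
  qed
  moreover have "lin R {x ^ i * v ^ j | i j. N + e * N \<le> i + j} \<subseteq> T"
  proof (rule lin_subset)
    fix r g assume "r \<in> R" "g \<in> {x ^ i * v ^ j | i j. N + e * N \<le> i + j}"
    then show "r * g \<in> T" using high unfolding T_def by (auto intro: lin_m_smult)
  qed (auto simp: T_def intro: lin_zero lin_add)
  ultimately have one_T: "1 \<in> T" by blast
  define G where "G = {g * v ^ l | g l. g \<in> mons x u d \<and> l < e}"
  have B_G: "\<forall>c\<in>B. c * v ^ j \<in> lin R G" for j
  proof (induction j rule: less_induct)
    case (less j)
    show ?case
    proof
      fix c assume c: "c \<in> B"
      show "c * v ^ j \<in> lin R G"
      proof (cases "j < e")
        case True
        have "v ^ j * c \<in> lin R G"
          using c fin True by (intro lin_mult_elem[of c R "mons x u d"]) (auto simp: G_def mult.commute)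
        then show ?thesis by (simp add: mult.commute)
      next
        case False
          have "c * v ^ j = (c * (x * b)) * v ^ (j - e)"
            using False by (simp add: b(2)[symmetric] mult.assoc flip: power_add)
          moreover have "c * (x * b) \<in> B" by (intro B_mult c B_x b)
          moreover have "\<forall>c\<in>B. c * v ^ (j - e) \<in> lin R G" using less[of "j - e"] False e by simp
          ultimately show ?thesis by metis
      qed
    qed
  qed
  have M_G: "allmons x v \<subseteq> lin R G"
  proof
    fix g assume "g \<in> allmons x v"
    then obtain i j where "g = x ^ i * v ^ j" by (auto simp: allmons_def)
    then show "g \<in> lin R G" using B_G B_mon[of i 0] by auto
  qed
  have T_G: "T \<subseteq> lin \<mm> G" unfolding T_def by (rule lin_m_lin_R[OF M_G])
  have G_M: "G \<subseteq> lin R (allmons x v)"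
  proof
    fix h assume "h \<in> G"
    then obtain g l where h: "h = g * v ^ l" "g \<in> mons x u d" by (auto simp: G_def)
    then have "g \<in> allmons x v" using mons_subset_allmons mons_v by blast
    moreover have "v ^ l \<in> allmons x v" using allmonsI[of x 0 v l] by simp
    ultimately show "h \<in> lin R (allmons x v)" unfolding h(1) by (intro lin_R_gen allmons_mult)
  qed
  have "G \<subseteq> lin R {}"
  proof (rule nakayama)
    have "G = (\<lambda>(g, l). g * v ^ l) ` (mons x u d \<times> {..<e})" by (auto simp: G_def)
    then show "finite G" by (simp add: finite_mons)
  next
    fix g assume "g \<in> G"
    then have "g * 1 \<in> T" using G_M one_T by (intro T_mult) auto
    then have "g \<in> lin \<mm> G" using T_G by auto
    then show "\<exists>n\<in>lin R {}. \<exists>w\<in>lin \<mm> G. g = n + w" using lin_zero by force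
  qed
  then have "lin \<mm> G \<subseteq> {0}" by (intro lin_subset) (auto simp: lin_empty)
  then show False using one_T T_G by auto
qed

text \<open>The derivative of \<open>u / x\<^sup>k\<close> is a polynomial in \<open>u\<close> and \<open>u / x\<^bsup>k+1\<^esup>\<close> without constant term, so \<open>x\<close> and
all these quotients generate a differential ideal. They form an increasing sequence of rings
\<open>R[x, u / x\<^sup>k]\<close>, which reduces the properness of the ideal to a single \<open>k\<close>.\<close>

lemma specializes_zero_if_unit:
  assumes "1 \<in> lin \<mm> (mons y s n)"
  shows "specializes x 0"
proof -
  obtain e g q where g: "q \<noteq> 0" "g \<in> int_form y s e q" "g \<in> lin \<mm> (mons y s e)"
    using int_form_in_own_degree[OF D_y D_s assms] by blast
  then obtain h where h: "h \<in> lin \<int> (mons_pred y s e)" "g = of_int q * s ^ e + y * h"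
    by (auto simp: int_form_def[OF D_y D_s])
  have xe: "x ^ e * g = of_int q * u ^ e + (x ^ e * y) * h"
    by (simp add: h(2) u_sx power_mult_distrib algebra_simps)
  have r: "(x ^ e * y) * h \<in> lin \<int> (upow 0 e)"
  proof (rule lin_mult_elem[OF h(1)])
    fix a assume "a \<in> mons_pred y s e"
    then obtain i j where a: "a = y ^ i * s ^ j" "Suc (i + j) = e" by (auto simp: mons_pred_def[OF D_y D_s])
    have "x ^ e * y * a = (x * y) ^ Suc i * (x * s) ^ j"
      by (simp add: a(1) a(2)[symmetric] power_mult_distrib power_add mult_ac)
    then have "x ^ e * y * a = u ^ j" by (simp add: xy u_sx)
    then show "x ^ e * y * a \<in> upow 0 e" using a(2) by (auto simp: upow_def)
  qed
  have P: "of_int q * u ^ e + (x ^ e * y) * h \<in> lin \<mm> (mons x u e)"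
    unfolding xe[symmetric] by (rule rescale[OF g(3)])
  have xn: "x ^ n \<in> lin \<mm> (mons x u n)" using rescale[OF assms] by simp
  have ue: "u ^ e \<in> xB" by (rule u_power_in_xB[OF g(1) r P])
  have fin: "B \<subseteq> lin R (mons x u (n + e))" by (rule B_finite[OF xn g(1) r P])
  have ue': "u ^ Suc e \<in> xB" using xB_mult[OF B_u ue] by simp
  define X where "X = insert x (range (\<lambda>k. u * y ^ k))"
  have v: "u * y ^ k \<in> nil_ideal X" for k by (rule nil_gen) (auto simp: X_def)
  show ?thesis
  proof (rule specializes_zero_if_nil)
    show "x \<in> nil_ideal X" by (rule nil_gen) (simp add: X_def)
  next
    fix a assume "a \<in> X"
    then consider "a = x" | k where "a = u * y ^ k" by (auto simp: X_def)
    then show "D a \<in> nil_ideal X"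
    proof cases
      case 1
      then show ?thesis using v[of 0] by (simp add: u)
    next
      case 2
      have "D (y ^ k) = - of_nat k * (s * y ^ k)"
        unfolding D_power[of y k] D_y by (cases k) (auto simp: algebra_simps simp del: of_nat_Suc)
      then have "D a = u * y ^ Suc k + (- of_nat k) * ((u * y ^ 0) * (u * y ^ Suc k))"
        by (simp add: 2 D_mult Du s algebra_simps)
      also have "\<dots> \<in> nil_ideal X"
        by (intro nil_add[OF v] nil_smult[OF _ nil_mult[OF v v]] R_uminus R_of_nat)
      finally show ?thesis .
    qed
  next
    define P where "P k = {x ^ i * (u * y ^ k) ^ j | i j. 0 < i + j}" for k
    define N where "N k = {a + b | a b. a \<in> \<mm> \<and> b \<in> lin R (P k)}" for k
    have PI: "x ^ i * (u * y ^ k) ^ j \<in> P k" if "0 < i + j" for i j k using that by (auto simp: P_def)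
    have P_mono: "lin R (P k) \<subseteq> lin R (P (k + l))" for k l
    proof (rule lin_mono[OF order_refl], rule subsetI)
      fix g assume "g \<in> P k"
      then obtain i j where g: "g = x ^ i * (u * y ^ k) ^ j" "0 < i + j" by (auto simp: P_def)
      have "x ^ l * y ^ l = 1" by (simp add: xy flip: power_mult_distrib)
      then have "u * y ^ k = x ^ l * y ^ l * (u * y ^ k)" by simp
      also have "\<dots> = x ^ l * (u * y ^ (k + l))" by (simp only: power_add mult_ac)
      finally have "g = x ^ i * (x ^ l * (u * y ^ (k + l))) ^ j" by (simp only: g(1))
      also have "\<dots> = x ^ (i + l * j) * (u * y ^ (k + l)) ^ j"
        by (simp only: power_mult_distrib power_add power_mult mult.assoc)
      finally have "g = x ^ (i + l * j) * (u * y ^ (k + l)) ^ j" .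
      moreover have "0 < (i + l * j) + j" using g(2) by auto
      ultimately show "g \<in> P (k + l)" by (simp only: PI)
    qed
    have P_mult: "a * b \<in> lin R (P k)" if "a \<in> lin R (P k)" "b \<in> lin R (P k)" for a b k
      using that
    proof (rule lin_R_mult_R)
      fix g h assume "g \<in> P k" "h \<in> P k"
      then obtain i j i' j' where "g = x ^ i * (u * y ^ k) ^ j" "h = x ^ i' * (u * y ^ k) ^ j'" "0 < i + j"
        by (auto simp: P_def)
      then have "g * h = x ^ (i + i') * (u * y ^ k) ^ (j + j')" "0 < (i + i') + (j + j')"
        by (auto simp: power_add ac_simps)
      then show "g * h \<in> P k" by (simp only: PI)
    qed
    have "\<exists>k. z \<in> N k" if "z \<in> nil_ideal X" for z
      using that
    proof induction
      case (nil_m a)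
      then have "a \<in> N 0" unfolding N_def by (force intro: lin_zero)
      then show ?case ..
    next
      case (nil_gen a)
      then consider "a = x ^ 1 * (u * y ^ 0) ^ 0" | k where "a = x ^ 0 * (u * y ^ k) ^ 1" by (auto simp: X_def)
      then have "\<exists>k. a \<in> lin R (P k)"
      proof cases
        case 1
        show ?thesis unfolding 1 by (rule exI, rule lin_R_gen, rule PI) simp
      next
        case (2 k)
        show ?thesis unfolding 2 by (rule exI, rule lin_R_gen, rule PI) simp
      qed
      then show ?case unfolding N_def using m_zero by force
    next
      case (nil_add a b)
      then obtain k l where "a \<in> N k" "b \<in> N l" by blast
      then obtain a1 a2 b1 b2 where *: "a = a1 + a2" "b = b1 + b2" "a1 \<in> \<mm>" "b1 \<in> \<mm>"
        "a2 \<in> lin R (P k)" "b2 \<in> lin R (P l)" by (auto simp: N_def)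
      then have "a2 + b2 \<in> lin R (P (k + l))"
        using P_mono[of k l] P_mono[of l k] by (auto simp: add.commute intro: lin_add)
      moreover have "a + b = (a1 + b1) + (a2 + b2)" by (simp add: *)
      ultimately show ?case unfolding N_def using m_add[OF *(3,4)] by blast
    next
      case (nil_smult r a)
      then obtain k a1 a2 where *: "a = a1 + a2" "a1 \<in> \<mm>" "a2 \<in> lin R (P k)" by (auto simp: N_def)
      have "r * a = r * a1 + r * a2" by (simp add: *(1) distrib_left)
      moreover have "r * a1 \<in> \<mm>" "r * a2 \<in> lin R (P k)"
        using nil_smult(1) * by (auto intro: m_mult lin_R_smult)
      ultimately show ?case unfolding N_def by blast
    next
      case (nil_mult a b)
      then obtain k l where "a \<in> N k" "b \<in> N l" by blast
      then obtain a1 a2 b1 b2 where *: "a = a1 + a2" "b = b1 + b2" "a1 \<in> \<mm>" "b1 \<in> \<mm>"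
        "a2 \<in> lin R (P k)" "b2 \<in> lin R (P l)" by (auto simp: N_def)
      then have 1: "a2 \<in> lin R (P (k + l))" "b2 \<in> lin R (P (k + l))"
        using P_mono[of k l] P_mono[of l k] by (auto simp: add.commute)
      have R: "a1 \<in> R" "b1 \<in> R" using * m_R by auto
      have "a1 * b2 + (b1 * a2 + a2 * b2) \<in> lin R (P (k + l))"
        by (intro lin_add lin_R_smult P_mult 1 R)
      moreover have "a * b = a1 * b1 + (a1 * b2 + (b1 * a2 + a2 * b2))" by (simp add: * algebra_simps)
      ultimately show ?case unfolding N_def using m_mult[OF R(1) *(4)] by blast
    qed
    moreover have "1 \<notin> N k" for k
    proof
      assume "1 \<in> N k"
      then obtain a b where ab: "a \<in> \<mm>" "b \<in> lin R (P k)" "1 = a + b" by (auto simp: N_def)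
      have "1 - a = b" using ab(3) by (simp add: diff_eq_eq add.commute)
      then have "inverse (1 - a) * b = 1" using unit_nonzero[OF ab(1)] by auto
      moreover have "inverse (1 - a) * b \<in> lin R (P k)" by (intro lin_R_smult unit_minus_m ab)
      ultimately show False using no_unit_in_positive_part[OF xn fin ue'] unfolding P_def by auto
    qed
    ultimately show "1 \<notin> nil_ideal X" by blast
  qed
qed

end

section \<open>The specialization to infinity\<close>

text \<open>The ideal generated by \<open>\<mm>\<close> and \<open>y\<close> in \<open>R[y, s]\<close> is differential since \<open>y'\<close> is a multiple of \<open>y\<close>, and
it is proper since \<open>y\<close> is nilpotent modulo \<open>\<mm> R[y, s]\<close>.\<close>

lemma specializes_zero_if_nilpotent:
  assumes Dy: "D y = - s * y" and Ds: "D s = s * y - s\<^sup>2"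
    and yk: "y ^ k \<in> lin \<mm> (mons y s n)" and proper: "\<And>n. 1 \<notin> lin \<mm> (mons y s n)"
  shows "specializes y 0"
proof -
  define X where "X = {y ^ Suc i * s ^ j | i j. True} \<union> {\<mu> * s ^ j | \<mu> j. \<mu> \<in> \<mm>}"
  have Xy: "y ^ Suc i * s ^ j \<in> nil_ideal X" for i j by (rule nil_gen) (unfold X_def, blast)
  have Xm: "\<mu> * s ^ j \<in> nil_ideal X" if "\<mu> \<in> \<mm>" for \<mu> j
    by (rule nil_gen) (unfold X_def, use that in blast)
  show ?thesis
  proof (rule specializes_zero_if_nil)
    show "y \<in> nil_ideal X" using Xy[of 0 0] by simp
  next
    fix a assume "a \<in> X"
    then consider i j where "a = y ^ Suc i * s ^ j" | \<mu> j where "a = \<mu> * s ^ j" "\<mu> \<in> \<mm>"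
      by (auto simp: X_def)
    then show "D a \<in> nil_ideal X"
    proof cases
      case 1
      have "D a = of_nat j * (y ^ Suc (Suc i) * s ^ j) + (- of_nat (Suc i + j)) * (y ^ Suc i * s ^ Suc j)"
        unfolding 1 D_monomial[OF Dy Ds] by (simp del: of_nat_add of_nat_Suc power_Suc)
      also have "\<dots> \<in> nil_ideal X" by (intro nil_add nil_smult[OF _ Xy] R_uminus R_of_nat)
      finally show ?thesis .
    next
      case 2
      have Dsj: "D (s ^ j) = of_nat j * (y * s ^ j) - of_nat j * s ^ Suc j"
        using D_monomial[OF Dy Ds, of 0 j] by simp
      have "D a = D \<mu> * s ^ j + ((of_nat j * \<mu>) * (y ^ Suc 0 * s ^ j) + (- of_nat j) * (\<mu> * s ^ Suc j))"
        by (simp add: 2 D_mult Dsj algebra_simps)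
      also have "\<dots> \<in> nil_ideal X"
        using 2(2) m_R by (intro nil_add Xm m_D nil_smult[OF _ Xy] nil_smult[OF _ Xm] R_uminus R_of_nat R_mult) auto
      finally show ?thesis .
    qed
  next
    let ?C = "lin R (allmons y s)" and ?L = "lin \<mm> (allmons y s)"
    define K where "K = {a + y * b | a b. a \<in> ?L \<and> b \<in> ?C}"
    have CC: "a * b \<in> ?C" if "a \<in> ?C" "b \<in> ?C" for a b
      using that by (rule lin_R_mult_R) (rule allmons_mult)
    have CL: "a * b \<in> ?L" if "a \<in> ?C" "b \<in> ?L" for a b
      using that by (rule lin_R_mult_m) (rule allmons_mult)
    have LC: "a \<in> ?C" if "a \<in> ?L" for a using that lin_m_subset_lin_R by blast
    have mon: "y ^ i * s ^ j \<in> ?C" for i j by (intro lin_R_gen allmonsI)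
    have RC: "r \<in> ?C" if "r \<in> R" for r using lin_R_smult[OF that mon[of 0 0]] by simp
    have yC: "y \<in> ?C" using mon[of 1 0] by simp
    have KC: "a \<in> ?C" if "a \<in> K" for a using that yC by (auto simp: K_def intro: lin_add LC CC)
    have K_add: "a + b \<in> K" if "a \<in> K" "b \<in> K" for a b
    proof -
      from that obtain a1 a2 b1 b2 where "a = a1 + y * a2" "b = b1 + y * b2"
        "a1 \<in> ?L" "b1 \<in> ?L" "a2 \<in> ?C" "b2 \<in> ?C" by (auto simp: K_def)
      moreover from this have "a + b = (a1 + b1) + y * (a2 + b2)" by (simp add: algebra_simps)
      ultimately show ?thesis unfolding K_def using lin_add by blast
    qed
    have K_mult: "c * a \<in> K" if "c \<in> ?C" "a \<in> K" for a c
    proof -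
      from that obtain a1 a2 where "a = a1 + y * a2" "a1 \<in> ?L" "a2 \<in> ?C" by (auto simp: K_def)
      moreover from this have "c * a = c * a1 + y * (c * a2)" by (simp add: algebra_simps)
      ultimately show ?thesis unfolding K_def using that(1) CL CC by blast
    qed
    have K_L: "a \<in> K" if "a \<in> ?L" for a
      using that unfolding K_def by (force intro: lin_zero)
    have K_y: "y * b \<in> K" if "b \<in> ?C" for b
      using that unfolding K_def by (force intro: lin_zero)
    have "nil_ideal X \<subseteq> K"
    proof
      fix z assume "z \<in> nil_ideal X"
      then show "z \<in> K"
      proof induction
        case (nil_m a)
        then show ?case using K_L lin_gen[of a \<mm> "y ^ 0 * s ^ 0" "allmons y s"] allmonsI[of y 0 s 0] by simp
      next
        case (nil_gen a)
        then consider i j where "a = y ^ Suc i * s ^ j" | \<mu> j where "a = \<mu> * s ^ j" "\<mu> \<in> \<mm>"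
          by (auto simp: X_def)
        then show ?case
        proof cases
          case 1
          then show ?thesis using K_y[OF mon[of i j]] by (simp add: mult.assoc)
        next
          case 2
          then show ?thesis using K_L lin_gen[of \<mu> \<mm> "y ^ 0 * s ^ j" "allmons y s"] allmonsI[of y 0 s j] by simp
        qed
      qed (auto intro: K_add K_mult RC KC)
    qed
    moreover have "1 \<notin> K"
    proof
      assume "1 \<in> K"
      then obtain a b where ab: "a \<in> ?L" "b \<in> ?C" "1 = a + y * b" by (auto simp: K_def)
      have "1 - (1 - a) ^ l \<in> ?L" for l
      proof (induction l)
        case 0
        then show ?case by (simp add: lin_zero)
      next
        case (Suc l)
        have "1 - a \<in> ?C" using RC[OF R_one] LC[OF ab(1)] by (rule lin_R_diff)
        then have "a + (1 - a) * (1 - (1 - a) ^ l) \<in> ?L" by (intro lin_add ab CL Suc)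
        moreover have "a + (1 - a) * (1 - (1 - a) ^ l) = 1 - (1 - a) ^ Suc l" by (simp add: algebra_simps)
        ultimately show ?case by simp
      qed
      moreover have "(1 - a) ^ k \<in> ?L"
      proof -
        have "b ^ k \<in> ?C" by (induction k) (auto intro: RC R_one CC ab)
        then have "b ^ k * y ^ k \<in> ?L"
          using yk mons_subset_allmons lin_mono[OF order_refl] by (intro CL) blast+
        moreover have "1 - a = y * b" using ab(3) by (simp add: diff_eq_eq add.commute)
        ultimately show ?thesis by (simp add: power_mult_distrib mult.commute)
      qed
      ultimately have "(1 - (1 - a) ^ k) + (1 - a) ^ k \<in> ?L" by (rule lin_add)
      then have "1 \<in> ?L" by simp
      from lin_allmons_bounded[OF this] show False using proper by blast
    qed
    ultimately show "1 \<notin> nil_ideal X" by blast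
  qed
qed

end

section \<open>Polynomials over a subring\<close>

definition subring :: "'a::comm_ring_1 set \<Rightarrow> bool" where
  "subring S \<longleftrightarrow> 1 \<in> S \<and> (\<forall>a\<in>S. \<forall>b\<in>S. a + b \<in> S \<and> a * b \<in> S) \<and> (\<forall>a\<in>S. - a \<in> S)"

lemma subring_simps:
  assumes "subring S"
  shows subring_one: "1 \<in> S" and subring_zero: "0 \<in> S"
    and subring_add: "a \<in> S \<Longrightarrow> b \<in> S \<Longrightarrow> a + b \<in> S"
    and subring_mult: "a \<in> S \<Longrightarrow> b \<in> S \<Longrightarrow> a * b \<in> S"
    and subring_uminus: "a \<in> S \<Longrightarrow> - a \<in> S"
    and subring_diff: "a \<in> S \<Longrightarrow> b \<in> S \<Longrightarrow> a - b \<in> S"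
proof -
  show "1 \<in> S" "a \<in> S \<Longrightarrow> b \<in> S \<Longrightarrow> a + b \<in> S" "a \<in> S \<Longrightarrow> b \<in> S \<Longrightarrow> a * b \<in> S" "a \<in> S \<Longrightarrow> - a \<in> S"
    using assms by (auto simp: subring_def)
  show "a \<in> S \<Longrightarrow> b \<in> S \<Longrightarrow> a - b \<in> S"
    using assms unfolding subring_def by (metis add_uminus_conv_diff)
  show "0 \<in> S" using assms unfolding subring_def by (metis add.right_inverse)
qed

lemma subring_power: "subring S \<Longrightarrow> a \<in> S \<Longrightarrow> a ^ n \<in> S"
  by (induction n) (auto intro: subring_one subring_mult)

lemma subring_of_nat: "subring S \<Longrightarrow> of_nat n \<in> S"
  by (induction n) (auto intro: subring_zero subring_one subring_add)

lemma subring_sum: "subring S \<Longrightarrow> (\<And>i. i \<in> A \<Longrightarrow> g i \<in> S) \<Longrightarrow> sum g A \<in> S"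
  by (induction A rule: infinite_finite_induct) (auto intro: subring_zero subring_add)

definition polys :: "'a::comm_ring_1 set \<Rightarrow> 'a poly set" where
  "polys S = {p. \<forall>i. coeff p i \<in> S}"

lemma polys_coeff: "p \<in> polys S \<Longrightarrow> coeff p i \<in> S" by (simp add: polys_def)

lemma subring_polys: "subring S \<Longrightarrow> subring (polys S)"
  unfolding subring_def[of "polys S"]
  by (auto simp: polys_def coeff_mult coeff_1
      intro!: subring_one subring_zero subring_add subring_uminus subring_sum subring_mult)

lemma polys_pCons: "c \<in> S \<Longrightarrow> p \<in> polys S \<Longrightarrow> pCons c p \<in> polys S"
  by (auto simp: polys_def coeff_pCons split: nat.split)

lemma polys_zero: "subring S \<Longrightarrow> 0 \<in> polys S" by (simp add: polys_def subring_zero)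

lemma polys_const: "subring S \<Longrightarrow> c \<in> S \<Longrightarrow> [:c:] \<in> polys S"
  by (intro polys_pCons polys_zero)

lemma polys_smult: "subring S \<Longrightarrow> c \<in> S \<Longrightarrow> p \<in> polys S \<Longrightarrow> smult c p \<in> polys S"
  by (auto simp: polys_def intro: subring_mult)

lemma polys_monom: "subring S \<Longrightarrow> c \<in> S \<Longrightarrow> monom c n \<in> polys S"
  by (auto simp: polys_def intro: subring_zero)

lemma polys_pderiv: "subring S \<Longrightarrow> p \<in> polys S \<Longrightarrow> pderiv p \<in> polys S"
  unfolding polys_def mem_Collect_eq coeff_pderiv
  by (intro allI subring_mult) (auto intro: subring_of_nat subring_add subring_one)

lemma polys_map_poly: "(\<And>c. c \<in> S \<Longrightarrow> h c \<in> T) \<Longrightarrow> h 0 = 0 \<Longrightarrow> p \<in> polys S \<Longrightarrow> map_poly h p \<in> polys T"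
  by (auto simp: polys_def coeff_map_poly)

text \<open>Division with remainder without leaving the subring \<open>S\<close>, at the price of a power of the leading
coefficient.\<close>

lemma pseudo_division:
  fixes g :: "'a::idom poly"
  assumes S: "subring S" and g: "g \<in> polys S" "g \<noteq> 0"
  shows "p \<in> polys S \<Longrightarrow> \<exists>n. \<exists>q\<in>polys S. \<exists>r\<in>polys S. smult (lead_coeff g ^ n) p = q * g + r
    \<and> (r = 0 \<or> degree r < degree g)"
proof (induction "degree p" arbitrary: p rule: less_induct)
  case less
  show ?case
  proof (cases "p = 0 \<or> degree p < degree g")
    case True
    then show ?thesis using less.prems polys_zero[OF S]
      by (intro exI[of _ 0] bexI[of _ 0] bexI[of _ p]) auto
  next
    case False
    define m where "m = monom (lead_coeff p) (degree p - degree g)"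
    define p' where "p' = smult (lead_coeff g) p - m * g"
    have m: "m \<in> polys S" unfolding m_def using less.prems by (intro polys_monom S polys_coeff)
    have lg: "lead_coeff g \<in> S" using g by (intro polys_coeff)
    have p': "p' \<in> polys S" unfolding p'_def
      using subring_polys[OF S] m g less.prems lg S by (intro subring_diff subring_mult polys_smult) auto
    have m0: "m \<noteq> 0" using False by (simp add: m_def)
    have dm: "degree (m * g) = degree p"
      using False g(2) m0 by (simp add: degree_mult_eq m_def degree_monom_eq)
    have "degree p' < degree p \<or> p' = 0"
    proof -
      have "degree p' \<le> degree p" unfolding p'_def
        using dm degree_smult_le[of "lead_coeff g" p] by (intro degree_diff_le) auto
      moreover have "coeff (m * g) (degree p) = lead_coeff p * lead_coeff g"
        using lead_coeff_mult[of m g] dm False by (simp add: m_def degree_monom_eq lead_coeff_monom)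
      then have "coeff p' (degree p) = 0" by (simp add: p'_def)
      ultimately show ?thesis
        by (metis eq_zero_or_degree_less le_eq_less_or_eq leading_coeff_0_iff)
    qed
    then have "\<exists>n. \<exists>q\<in>polys S. \<exists>r\<in>polys S. smult (lead_coeff g ^ n) p' = q * g + r \<and> (r = 0 \<or> degree r < degree g)"
    proof
      assume "p' = 0"
      then show ?thesis using polys_zero[OF S] by (intro exI[of _ 0] bexI[of _ 0]) auto
    qed (rule less.hyps[OF _ p'])
    then obtain n q r where *: "q \<in> polys S" "r \<in> polys S" "smult (lead_coeff g ^ n) p' = q * g + r"
      "r = 0 \<or> degree r < degree g" by blast
    have "smult (lead_coeff g ^ Suc n) p = smult (lead_coeff g ^ n) p' + smult (lead_coeff g ^ n) (m * g)"
      by (simp add: p'_def smult_diff_right mult.commute)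
    also have "\<dots> = (q + smult (lead_coeff g ^ n) m) * g + r" by (simp add: * algebra_simps)
    finally have "smult (lead_coeff g ^ Suc n) p = (q + smult (lead_coeff g ^ n) m) * g + r" .
    moreover have "q + smult (lead_coeff g ^ n) m \<in> polys S"
      using subring_polys[OF S] * m lg S by (intro subring_add polys_smult subring_power) auto
    ultimately show ?thesis using * by blast
  qed
qed

text \<open>A prime ideal of \<open>S[T]\<close> that contains no non-zero constant. Over the field of fractions of \<open>S\<close> such
an ideal is zero or generated by an irreducible polynomial; the lemmas of the locale express this
without fractions.\<close>

locale prime_poly_ideal =
  fixes S :: "'a::idom set" and I :: "'a poly set"
  assumes S: "subring S" and I_polys: "I \<subseteq> polys S"
    and I_add: "p \<in> I \<Longrightarrow> q \<in> I \<Longrightarrow> p + q \<in> I"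
    and I_mult: "p \<in> polys S \<Longrightarrow> q \<in> I \<Longrightarrow> p * q \<in> I"
    and I_prime: "p \<in> polys S \<Longrightarrow> q \<in> polys S \<Longrightarrow> p * q \<in> I \<Longrightarrow> p \<in> I \<or> q \<in> I"
    and I_const: "[:c:] \<in> I \<Longrightarrow> c = 0"
begin

lemma minimal_element:
  assumes "p \<in> I" "p \<noteq> 0"
  obtains g where "g \<in> I" "g \<noteq> 0" "\<And>h. h \<in> I \<Longrightarrow> h \<noteq> 0 \<Longrightarrow> degree g \<le> degree h" "degree g > 0"
proof -
  obtain g where g: "g \<in> I \<and> g \<noteq> 0" "\<And>h. h \<in> I \<and> h \<noteq> 0 \<Longrightarrow> degree g \<le> degree h"
    using ex_has_least_nat[of "\<lambda>h. h \<in> I \<and> h \<noteq> 0" p degree] assms by blast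
  have "degree g > 0"
  proof (rule ccontr)
    assume "\<not> degree g > 0"
    then obtain c where "g = [:c:]" using degree_eq_zeroE by blast
    then show False using g I_const by auto
  qed
  then show ?thesis using that g by blast
qed

context
  fixes g assumes g: "g \<in> I" "g \<noteq> 0" and gmin: "\<And>h. h \<in> I \<Longrightarrow> h \<noteq> 0 \<Longrightarrow> degree g \<le> degree h"
begin

lemma divides_up_to_lead_coeff:
  assumes "p \<in> I"
  shows "\<exists>n. \<exists>q\<in>polys S. smult (lead_coeff g ^ n) p = q * g"
proof -
  have gS: "g \<in> polys S" using g I_polys by blast
  obtain n q r where *: "q \<in> polys S" "r \<in> polys S" "smult (lead_coeff g ^ n) p = q * g + r"
      "r = 0 \<or> degree r < degree g"
    using pseudo_division[OF S gS g(2)] assms I_polys by blast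
  have "r = [:lead_coeff g ^ n:] * p + (- q) * g" using *(3) by simp
  also have "\<dots> \<in> I"
    using * gS assms g subring_uminus[OF subring_polys[OF S]]
    by (intro I_add I_mult polys_const S subring_power polys_coeff) auto
  finally have "r = 0" using gmin[of r] *(4) by fastforce
  then show ?thesis using * by auto
qed

text \<open>An element \<open>h\<close> of least degree in the ideal generated by \<open>g\<close> and \<open>p\<close> divides both up to constants. If
\<open>h\<close> had positive degree, primality would put into \<open>I\<close> either the cofactor of \<open>g\<close>, whose degree is
too small, or \<open>h\<close> and with it \<open>p\<close>.\<close>

lemma coprime_up_to_constant:
  assumes p: "p \<in> polys S" "p \<notin> I"
  shows "\<exists>c\<in>S. c \<noteq> 0 \<and> (\<exists>a\<in>polys S. \<exists>b\<in>polys S. [:c:] = a * g + b * p)"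
proof -
  have gS: "g \<in> polys S" using g I_polys by blast
  define H where "H = {a * g + b * p | a b. a \<in> polys S \<and> b \<in> polys S}"
  note SS = subring_polys[OF S]
  have H_S: "H \<subseteq> polys S" using gS p unfolding H_def by (auto intro!: subring_add[OF SS] subring_mult[OF SS])
  have gH: "g \<in> H" unfolding H_def using subring_one[OF SS] subring_zero[OF SS] by force
  have pH: "p \<in> H" unfolding H_def using subring_one[OF SS] subring_zero[OF SS] by force
  have H_comb: "a * h + b * h' \<in> H" if H: "a \<in> polys S" "b \<in> polys S" "h \<in> H" "h' \<in> H" for a b h h'
  proof -
    obtain u v where "h = u * g + v * p" "u \<in> polys S" "v \<in> polys S"
      using H(3) unfolding H_def by blast
    moreover obtain u' v' where "h' = u' * g + v' * p" "u' \<in> polys S" "v' \<in> polys S"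
      using H(4) unfolding H_def by blast
    ultimately have "a * h + b * h' = (a * u + b * u') * g + (a * v + b * v') * p"

      "a * u + b * u' \<in> polys S" "a * v + b * v' \<in> polys S"
      using H SS by (auto simp: algebra_simps intro: subring_add subring_mult)
    then show ?thesis unfolding H_def by blast
  qed
  obtain h where h: "h \<in> H" "h \<noteq> 0" and hmin: "\<And>h'. h' \<in> H \<and> h' \<noteq> 0 \<Longrightarrow> degree h \<le> degree h'"
    using ex_has_least_nat[of "\<lambda>h. h \<in> H \<and> h \<noteq> 0" g degree] gH g by blast
  have hS: "h \<in> polys S" using h H_S by blast
  have div: "\<exists>n. \<exists>q\<in>polys S. smult (lead_coeff h ^ n) z = q * h" if z: "z \<in> H" for z
  proof -
    obtain n q r where *: "q \<in> polys S" "r \<in> polys S" "smult (lead_coeff h ^ n) z = q * h + r"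
        "r = 0 \<or> degree r < degree h"
      using pseudo_division[OF S hS h(2)] H_S z by blast
    have "r = [:lead_coeff h ^ n:] * z + (- q) * h" using *(3) by simp
    also have "\<dots> \<in> H"
      using * hS z h subring_uminus[OF SS]
      by (intro H_comb polys_const S subring_power polys_coeff) auto
    finally have "r = 0" using hmin[of r] *(4) by fastforce
    then show ?thesis using * by auto
  qed
  have "degree h = 0"
  proof (rule ccontr)
    assume dh: "degree h \<noteq> 0"
    obtain n q where q: "q \<in> polys S" "smult (lead_coeff h ^ n) g = q * h" using div[OF gH] by blast
    have "[:lead_coeff h ^ n:] * g \<in> I"
      using hS by (intro I_mult g polys_const S subring_power polys_coeff)
    then have "q * h \<in> I" using q(2) by simp
    then have "q \<in> I \<or> h \<in> I" by (rule I_prime[OF q(1) hS])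
    then show False
    proof
      assume "q \<in> I"
      moreover have "q * h \<noteq> 0" using q(2) g(2) h(2) by (metis leading_coeff_0_iff power_eq_0_iff smult_eq_0_iff)
      moreover have "degree (q * h) = degree g" using q(2) h(2) by (metis degree_smult_eq leading_coeff_0_iff power_eq_0_iff)
      ultimately show False using gmin[of q] dh by (auto simp: degree_mult_eq)
    next
      assume "h \<in> I"
      obtain n q where q: "q \<in> polys S" "smult (lead_coeff h ^ n) p = q * h" using div[OF pH] by blast
      have "[:lead_coeff h ^ n:] * p \<in> I" using q I_mult[OF q(1) \<open>h \<in> I\<close>] by simp
      then have "[:lead_coeff h ^ n:] \<in> I"
        using I_prime[of "[:lead_coeff h ^ n:]" p] p hS by (meson polys_coeff polys_const S subring_power)
      then show False using I_const h(2) by fastforce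
    qed
  qed
  then obtain c where "h = [:c:]" using degree_eq_zeroE by blast
  then show ?thesis using h hS polys_coeff[of h S 0] unfolding H_def by auto
qed

end

end

section \<open>Derivations of polynomial rings\<close>

definition is_der :: "('a::comm_ring_1 \<Rightarrow> 'a) \<Rightarrow> bool" where
  "is_der d \<longleftrightarrow> (\<forall>a b. d (a + b) = d a + d b \<and> d (a * b) = d a * b + a * d b)"

lemma is_der_add: "is_der d \<Longrightarrow> d (a + b) = d a + d b"
  and is_der_mult: "is_der d \<Longrightarrow> d (a * b) = d a * b + a * d b"
  by (auto simp: is_der_def)

lemma is_der_zero: "is_der d \<Longrightarrow> d 0 = 0"
  using is_der_add[of d 0 0] by simp

lemma is_der_sum: "is_der d \<Longrightarrow> d (sum g A) = (\<Sum>i\<in>A. d (g i))"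
  by (induction A rule: infinite_finite_induct) (auto simp: is_der_zero is_der_add)

lemma is_der_map_poly:
  assumes d: "is_der d"
  shows "is_der (map_poly d)"
  unfolding is_der_def
proof (intro allI conjI)
  fix p q
  note [simp] = coeff_map_poly[of d, OF is_der_zero[OF d]]
  show "map_poly d (p + q) = map_poly d p + map_poly d q"
    by (rule poly_eqI) (simp add: is_der_add[OF d])
  show "map_poly d (p * q) = map_poly d p * q + p * map_poly d q"
    by (rule poly_eqI) (simp add: coeff_mult is_der_sum[OF d] is_der_mult[OF d] sum.distrib)
qed

lemma is_der_pderiv: "is_der (pderiv :: 'a::idom poly \<Rightarrow> 'a poly)"
  by (simp add: is_der_def pderiv_add pderiv_mult algebra_simps)

lemma is_der_times: "is_der d \<Longrightarrow> is_der (\<lambda>p. c * d p)"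
  by (auto simp: is_der_def algebra_simps)

lemma is_der_plus: "is_der d \<Longrightarrow> is_der d' \<Longrightarrow> is_der (\<lambda>p. d p + d' p)"
  by (auto simp: is_der_def algebra_simps)

text \<open>The inner variable is evaluated at \<open>a\<close>, the outer variable at \<open>b\<close>. Later \<open>a\<close> is a solution and \<open>b\<close> its
derivative.\<close>

definition ev :: "'a::comm_ring_1 poly poly \<Rightarrow> 'a \<Rightarrow> 'a \<Rightarrow> 'a" where
  "ev p a b = poly (poly p [:b:]) a"

lemma ev_simps: "ev (p + q) a b = ev p a b + ev q a b" "ev (p * q) a b = ev p a b * ev q a b"
  "ev 0 a b = 0" "ev 1 a b = 1" "ev (- p) a b = - ev p a b" "ev (p - q) a b = ev p a b - ev q a b"
  "ev (pCons c p) a b = poly c a + b * ev p a b" "ev (p ^ n) a b = ev p a b ^ n"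
  "ev (smult c p) a b = poly c a * ev p a b"
  by (simp_all add: ev_def)

lemma ev_in_lin: "w \<in> polys (polys M) \<Longrightarrow> ev w x u \<in> lin M (allmons x u)"
proof (induction w)
  case 0
  then show ?case by (simp add: ev_simps lin_zero)
next
  case (pCons c w)
  have c: "c \<in> polys M" using polys_coeff[OF pCons.prems, of 0] by simp
  have w: "w \<in> polys (polys M)" using polys_coeff[OF pCons.prems, of "Suc i" for i] by (auto simp: polys_def)
  have "poly c x \<in> lin M (allmons x u)" using c
  proof (induction c)
    case 0
    then show ?case by (simp add: lin_zero)
  next
    case (pCons a c)
    have a: "a \<in> M" using polys_coeff[OF pCons.prems, of 0] by simp
    have c: "c \<in> polys M" using polys_coeff[OF pCons.prems, of "Suc i" for i] by (auto simp: polys_def)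
    have "a * (x ^ 0 * u ^ 0) \<in> lin M (allmons x u)" by (intro lin_gen a allmonsI)
    moreover have "x * poly c x \<in> lin M (allmons x u)"
    proof (rule lin_mult_elem[OF pCons.IH[OF c]])
      fix h assume "h \<in> allmons x u"
      then have "(x ^ 1 * u ^ 0) * h \<in> allmons x u" by (intro allmons_mult allmonsI)
      then show "x * h \<in> allmons x u" by simp
    qed
    ultimately show ?case using lin_add by fastforce
  qed
  moreover have "u * ev w x u \<in> lin M (allmons x u)"
  proof (rule lin_mult_elem[OF pCons.IH[OF w]])
    fix h assume "h \<in> allmons x u"
    then have "(x ^ 0 * u ^ 1) * h \<in> allmons x u" by (intro allmons_mult allmonsI)
    then show "u * h \<in> allmons x u" by simp
  qed
  ultimately show ?case by (simp add: ev_simps lin_add)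
qed

section \<open>Ring homomorphisms defined on a subring\<close>

definition ring_hom_on :: "'a::comm_ring_1 set \<Rightarrow> ('a \<Rightarrow> 'b::comm_ring_1) \<Rightarrow> bool" where
  "ring_hom_on S h \<longleftrightarrow> h 1 = 1 \<and> h 0 = 0
    \<and> (\<forall>a\<in>S. \<forall>b\<in>S. h (a + b) = h a + h b \<and> h (a * b) = h a * h b)"

lemma ring_hom_on_sum:
  "subring S \<Longrightarrow> ring_hom_on S h \<Longrightarrow> (\<And>i. i \<in> A \<Longrightarrow> g i \<in> S) \<Longrightarrow> h (sum g A) = (\<Sum>i\<in>A. h (g i))"
proof (induction A rule: infinite_finite_induct)
  case (insert x F)
  then have "sum g F \<in> S" by (auto intro: subring_sum)
  with insert show ?case by (auto simp: ring_hom_on_def)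
qed (auto simp: ring_hom_on_def)

text \<open>Proved for an arbitrary subring so that it can be applied twice, to polynomials in two variables.\<close>

lemma ring_hom_on_map_poly:
  assumes S: "subring S" and h: "ring_hom_on S h"
  shows "ring_hom_on (polys S) (map_poly h)"
proof -
  have h0: "h 0 = 0" using h by (simp add: ring_hom_on_def)
  note [simp] = coeff_map_poly[of h, OF h0]
  have "map_poly h (p + q) = map_poly h p + map_poly h q" if "p \<in> polys S" "q \<in> polys S" for p q
    using that h by (intro poly_eqI) (simp add: ring_hom_on_def polys_def)
  moreover have "map_poly h (p * q) = map_poly h p * map_poly h q" if pq: "p \<in> polys S" "q \<in> polys S" for p q
  proof (rule poly_eqI)
    fix n
    have "h (\<Sum>i\<le>n. coeff p i * coeff q (n - i)) = (\<Sum>i\<le>n. h (coeff p i * coeff q (n - i)))"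
      using pq S by (intro ring_hom_on_sum[OF S h] subring_mult) (auto simp: polys_def)
    also have "\<dots> = (\<Sum>i\<le>n. h (coeff p i) * h (coeff q (n - i)))"
      using pq h by (intro sum.cong) (auto simp: ring_hom_on_def polys_def)
    finally show "coeff (map_poly h (p * q)) n = coeff (map_poly h p * map_poly h q) n"
      by (simp add: coeff_mult)
  qed
  moreover have "map_poly h 1 = 1"
    using h by (intro poly_eqI) (simp add: coeff_1 ring_hom_on_def)
  ultimately show ?thesis by (simp add: ring_hom_on_def)
qed

context diff_place
begin

definition xpoly :: "'u poly" where "xpoly = [:0, 1:]"

text \<open>The derivation \<open>x D\<close> on polynomials in two variables \<open>x\<close> and \<open>u\<close> that extends \<open>x D\<close> on the
coefficients and satisfies \<open>x \<mapsto> x u\<close>, \<open>u \<mapsto> u\<close>. The factor \<open>x\<close> clears the denominator of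
\<open>u' = u / x\<close>.\<close>

definition xD :: "'u poly poly \<Rightarrow> 'u poly poly" where
  "xD p = [:xpoly:] * map_poly (map_poly D) p
    + ([:0, xpoly:] * map_poly pderiv p + [:0, 1:] * pderiv p)"

lemma is_der_D: "is_der D" by (simp add: is_der_def D_add D_mult)

lemma is_der_xD: "is_der xD"
  unfolding xD_def
  by (intro is_der_plus is_der_times is_der_map_poly is_der_pderiv is_der_D)

lemma D_poly: "D (poly c a) = poly (map_poly D c) a + poly (pderiv c) a * D a"
  by (induction c) (auto simp: D_zero D_add D_mult map_poly_pCons[of D, OF D_zero] pderiv_pCons algebra_simps)

lemma D_ev: "D (ev p a b) = ev (map_poly (map_poly D) p) a b + ev (map_poly pderiv p) a b * D a
    + ev (pderiv p) a b * D b"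
  by (induction p)
    (auto simp: D_zero D_add D_mult D_poly ev_simps map_poly_pCons[of pderiv] pderiv_pCons
      map_poly_pCons[of "map_poly D"] algebra_simps)

text \<open>Chain rule. Its defect is the partial derivative in \<open>u\<close> times the equation; read backwards, it turns a
zero of a polynomial and of its derivation into a solution, if the partial derivative does not
vanish.\<close>

lemma xD_ev: "a * D (ev p a (D a)) = ev (xD p) a (D a) + ev (pderiv p) a (D a) * (a * D (D a) - D a)"
  by (simp add: D_ev xD_def ev_simps xpoly_def algebra_simps)

end

section \<open>Differential ideals with a non-zero point\<close>

lemma is_der_power:
  assumes "is_der d"
  shows "d (a ^ n) = of_nat n * a ^ (n - 1) * d a"
proof (induction n)
  case 0
  have "d (1 * 1) = d 1 * 1 + 1 * d 1" using is_der_mult[OF assms] .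
  then show ?case by simp
next
  case (Suc n)
  then show ?case
    by (cases n) (auto simp: is_der_mult[OF assms] algebra_simps)
qed

context diff_place
begin

text \<open>The residue field of \<open>R\<close>, realized inside the ambient field.\<close>

abbreviation \<kappa> :: "'u set" where "\<kappa> \<equiv> f ` R"

abbreviation Pk :: "'u poly poly set" where "Pk \<equiv> polys (polys \<kappa>)"

lemma subring_R: "subring R"
  by (simp add: subring_def R_one R_add R_mult R_uminus)

lemma subring_k: "subring \<kappa>"
  unfolding subring_def
  by (auto simp: image_iff Bex_def)
    (metis R_one f_one, metis R_add f_add, metis R_mult f_mult, metis R_uminus f_uminus)

lemma k_inverse: "c \<in> \<kappa> \<Longrightarrow> inverse c \<in> \<kappa>"
proof -
  assume "c \<in> \<kappa>"
  then obtain r where r: "r \<in> R" "c = f r" by blast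
  show ?thesis
  proof (cases "c = 0")
    case True
    then show ?thesis using \<open>c \<in> \<kappa>\<close> by simp
  next
    case False
    then have ir: "inverse r \<in> R" "r \<noteq> 0" using r R_inverse f_zero by auto
    then have "c * f (inverse r) = 1" using r f_mult[of r "inverse r"] f_one by simp
    then have "inverse c = f (inverse r)" by (rule inverse_unique)
    then show ?thesis using ir by blast
  qed
qed

lemma k_D: "c \<in> \<kappa> \<Longrightarrow> D c \<in> \<kappa>"
  using f_D R_D by (auto simp: image_iff) metis

lemma xpoly_polys: "subring S \<Longrightarrow> xpoly \<in> polys S"
  unfolding xpoly_def by (intro polys_pCons polys_zero subring_zero subring_one)

lemma X_polys: "subring S \<Longrightarrow> [:xpoly:] \<in> polys (polys S)"
  by (intro polys_const subring_polys xpoly_polys)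

lemma xD_polys:
  assumes S: "subring S" "\<And>c. c \<in> S \<Longrightarrow> D c \<in> S" and p: "p \<in> polys (polys S)"
  shows "xD p \<in> polys (polys S)"
proof -
  note SS = subring_polys[OF S(1)] and SSS = subring_polys[OF subring_polys[OF S(1)]]
  have 1: "map_poly (map_poly D) p \<in> polys (polys S)"
    using p by (intro polys_map_poly[of "polys S"] polys_map_poly[of S]) (auto intro: S D_zero)
  have 2: "map_poly pderiv p \<in> polys (polys S)"
    using p by (intro polys_map_poly[of "polys S"]) (auto intro: polys_pderiv S)
  show ?thesis unfolding xD_def
    using 1 2 S xpoly_polys[OF S(1)]
    by (intro subring_add[OF SSS] subring_mult[OF SSS] X_polys polys_pderiv[OF SS p] polys_pCons
        subring_zero subring_one polys_zero SS)
qed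

text \<open>An ideal that contains a power of the first variable has no zero with non-zero first coordinate; the
last condition excludes these ideals.\<close>

definition xD_ideal :: "'u poly poly set \<Rightarrow> bool" where
  "xD_ideal J \<longleftrightarrow> J \<subseteq> Pk \<and> 0 \<in> J \<and> (\<forall>p\<in>J. \<forall>q\<in>J. p + q \<in> J) \<and> (\<forall>p\<in>Pk. \<forall>q\<in>J. p * q \<in> J)
    \<and> (\<forall>p\<in>J. xD p \<in> J) \<and> (\<forall>n. [:xpoly:] ^ n \<notin> J)"

lemma xD_ideal_sum: "xD_ideal J \<Longrightarrow> (\<And>i. i \<in> A \<Longrightarrow> g i \<in> J) \<Longrightarrow> sum g A \<in> J"
  by (induction A rule: infinite_finite_induct) (auto simp: xD_ideal_def)

lemmas subring_Pk = subring_polys[OF subring_polys[OF subring_k]]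
lemmas Pk_zero = subring_zero[OF subring_Pk] and Pk_add = subring_add[OF subring_Pk]
  and Pk_mult = subring_mult[OF subring_Pk] and Pk_uminus = subring_uminus[OF subring_Pk]
  and Pk_of_nat = subring_of_nat[OF subring_Pk] and Pk_power = subring_power[OF subring_Pk]

lemma xD_Pk: "p \<in> Pk \<Longrightarrow> xD p \<in> Pk"
  by (rule xD_polys[OF subring_k k_D])

lemma const_Pk: "c \<in> \<kappa> \<Longrightarrow> [:[:c:]:] \<in> Pk"
  by (intro polys_const subring_polys subring_k)

text \<open>In characteristic zero the radical of a differential ideal is differential: from \<open>p\<^sup>n\<close> one passes, by
applying the derivation and dividing by integers, to \<open>p\<^bsup>n-1\<^esup> p'\<^sup>2\<close>, \<open>p\<^bsup>n-2\<^esup> p'\<^sup>4\<close> and so on, up to \<open>p'\<^bsup>2n\<^esup>\<close>.\<close>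

lemma xD_power_in_ideal:
  assumes J: "xD_ideal J" and p: "p \<in> Pk" and pn: "p ^ n \<in> J"
  shows "j \<le> n \<Longrightarrow> p ^ (n - j) * xD p ^ (2 * j) \<in> J"
proof (induction j)
  case 0
  then show ?case using pn by simp
next
  case (Suc j)
  define a where "a = n - Suc j"
  define d where "d = xD p"
  have a: "n - j = Suc a" using Suc.prems by (simp add: a_def)
  define z where "z = p ^ Suc a * d ^ (2 * j)"
  have z: "z \<in> J" using Suc by (simp add: z_def d_def a)
  have dP: "d \<in> Pk" unfolding d_def by (rule xD_Pk[OF p])
  have "d * xD z = of_nat (Suc a) * (p ^ a * d ^ (2 * Suc j)) + (of_nat (2 * j) * xD d) * z"
    unfolding z_def is_der_mult[OF is_der_xD] is_der_power[OF is_der_xD]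
    by (cases j) (simp_all add: d_def[symmetric] algebra_simps del: of_nat_Suc of_nat_mult)
  moreover have "d * xD z \<in> J" using z dP J by (auto simp: xD_ideal_def)
  moreover have "- (of_nat (2 * j) * xD d) \<in> Pk"
    by (intro Pk_uminus Pk_mult Pk_of_nat xD_Pk dP)
  then have "(- (of_nat (2 * j) * xD d)) * z \<in> J"
    using J z unfolding xD_ideal_def by blast
  ultimately have "(of_nat (Suc a) * (p ^ a * d ^ (2 * Suc j)) + (of_nat (2 * j) * xD d) * z) + (- (of_nat (2 * j) * xD d)) * z \<in> J"
    using J unfolding xD_ideal_def by metis
  then have aJ: "of_nat (Suc a) * (p ^ a * d ^ (2 * Suc j)) \<in> J" by (simp only: mult_minus_left add_diff_cancel_right' add_uminus_conv_diff)
  have ck: "inverse (of_nat (Suc a)) \<in> \<kappa>"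
    by (intro k_inverse subring_of_nat subring_k)
  define c where "c = [:[:inverse (of_nat (Suc a)) :: 'u:]:]"
  have c1: "c * of_nat (Suc a) = 1"
    by (simp add: c_def of_nat_poly one_pCons del: of_nat_Suc)
  have cP: "c \<in> Pk" unfolding c_def by (rule const_Pk[OF ck])
  have "c * (of_nat (Suc a) * (p ^ a * d ^ (2 * Suc j))) \<in> J"
    using J cP aJ unfolding xD_ideal_def by blast
  then show ?case by (simp only: mult.assoc[symmetric] c1 mult_1_left) (simp only: a_def d_def mult_1_left)
qed

context
  fixes J assumes J: "xD_ideal J" and Jmax: "\<And>J'. xD_ideal J' \<Longrightarrow> J \<subseteq> J' \<Longrightarrow> J' = J"
begin

lemma J_simps: "J \<subseteq> Pk" "0 \<in> J" "p \<in> J \<Longrightarrow> q \<in> J \<Longrightarrow> p + q \<in> J"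
  "p \<in> Pk \<Longrightarrow> q \<in> J \<Longrightarrow> p * q \<in> J" "p \<in> J \<Longrightarrow> xD p \<in> J" "[:xpoly:] ^ n \<notin> J"
  using J by (auto simp: xD_ideal_def)

lemma J_radical: "p \<in> Pk \<Longrightarrow> p ^ n \<in> J \<Longrightarrow> p \<in> J"
proof -
  let ?rad = "{p \<in> Pk. \<exists>n. p ^ n \<in> J}"
  have "xD_ideal ?rad"
    unfolding xD_ideal_def
  proof (intro conjI ballI allI)
    show "?rad \<subseteq> Pk" by blast
    show "0 \<in> ?rad" using J_simps(2) Pk_zero by (auto intro!: exI[of _ 1])
  next
    fix p q assume p: "p \<in> ?rad" and q: "q \<in> ?rad"
    then have P: "p \<in> Pk" "q \<in> Pk" by blast+
    from p q obtain n m where nm: "p ^ n \<in> J" "q ^ m \<in> J" by blast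
    have "(p + q) ^ (n + m) \<in> J" unfolding binomial_ring
    proof (rule xD_ideal_sum[OF J])
      fix k assume "k \<in> {..n + m}"
      consider "n \<le> k" | "m \<le> n + m - k" using \<open>k \<in> _\<close> by fastforce
      then show "of_nat (n + m choose k) * p ^ k * q ^ (n + m - k) \<in> J"
      proof cases
        case 1
        then have pk: "p ^ k = p ^ (k - n) * p ^ n" by (simp flip: power_add)
        have eq: "of_nat (n + m choose k) * p ^ k * q ^ (n + m - k)
            = (of_nat (n + m choose k) * p ^ (k - n) * q ^ (n + m - k)) * p ^ n"
          unfolding pk by (simp only: mult_ac)
        show ?thesis unfolding eq
          by (rule J_simps(4)[OF _ nm(1)])
            (intro Pk_mult Pk_of_nat Pk_power P)
      next
        case 2
        then have "q ^ (n + m - k) = q ^ (n + m - k - m) * q ^ m" by (metis le_add_diff_inverse2 power_add)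
        then have eq: "of_nat (n + m choose k) * p ^ k * q ^ (n + m - k)
            = (of_nat (n + m choose k) * p ^ k * q ^ (n + m - k - m)) * q ^ m"
          by (simp add: mult.assoc)
        show ?thesis unfolding eq
          by (rule J_simps(4)[OF _ nm(2)])
            (intro Pk_mult Pk_of_nat Pk_power P)
      qed
    qed
    then show "p + q \<in> ?rad" using p q by (auto intro: Pk_add)
  next
    fix p q assume p: "p \<in> Pk" and q: "q \<in> ?rad"
    then obtain n where "q ^ n \<in> J" by blast
    then have "(p * q) ^ n \<in> J"
      unfolding power_mult_distrib by (intro J_simps(4) Pk_power p)
    then show "p * q \<in> ?rad" using p q by (auto intro: Pk_mult)
  next
    fix p assume p: "p \<in> ?rad"
    then obtain n where "p ^ n \<in> J" by blast
    then have "p ^ (n - n) * xD p ^ (2 * n) \<in> J" using xD_power_in_ideal[OF J, of p n n] p by blast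
    then show "xD p \<in> ?rad" using p xD_Pk by auto
  next
    fix n show "[:xpoly:] ^ n \<notin> ?rad"
      using J_simps(6) by (auto simp flip: power_mult)
  qed
  moreover have "J \<subseteq> ?rad" using J_simps(1) by (auto intro: exI[of _ 1])
  ultimately have "?rad = J" by (rule Jmax)
  then show "p \<in> Pk \<Longrightarrow> p ^ n \<in> J \<Longrightarrow> p \<in> J" by blast
qed

text \<open>For a radical differential ideal \<open>r p \<in> J\<close> implies \<open>r' p \<in> J\<close>, because \<open>(r' p)\<^sup>2\<close> is congruent to
\<open>- r p r' p'\<close>, which lies in \<open>J\<close>.\<close>

lemma colon_ideal:
  assumes p: "p \<in> Pk" and np: "\<And>n. [:xpoly:] ^ n * p \<notin> J"
  shows "xD_ideal {r \<in> Pk. r * p \<in> J}"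
  unfolding xD_ideal_def
proof (intro conjI ballI allI)
  fix r assume "r \<in> {r \<in> Pk. r * p \<in> J}"
  then have r: "r \<in> Pk" "r * p \<in> J" by auto
  have "(xD r * p) ^ 2 = (xD r * p) * xD (r * p) + (- (xD r * xD p)) * (r * p)"
    by (simp add: is_der_mult[OF is_der_xD] power2_eq_square algebra_simps)
  also have "\<dots> \<in> J"
    using r p by (intro J_simps(3) J_simps(4)[OF _ J_simps(5)[OF r(2)]] J_simps(4)[OF _ r(2)]
        Pk_uminus Pk_mult xD_Pk)
  finally have "xD r * p \<in> J"
    by (rule J_radical[rotated]) (intro Pk_mult xD_Pk r p)
  then show "xD r \<in> {r \<in> Pk. r * p \<in> J}" using r xD_Pk by simp
next
  fix q r assume q: "q \<in> {r \<in> Pk. r * p \<in> J}" and r: "r \<in> {r \<in> Pk. r * p \<in> J}"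
  then have "(q + r) * p \<in> J" unfolding distrib_right by (intro J_simps(3)) blast+
  then show "q + r \<in> {r \<in> Pk. r * p \<in> J}" using q r by (blast intro: Pk_add)
next
  fix q r assume q: "q \<in> Pk" and r: "r \<in> {r \<in> Pk. r * p \<in> J}"
  then have "q * r * p \<in> J" unfolding mult.assoc by (blast intro: J_simps(4))
  then show "q * r \<in> {r \<in> Pk. r * p \<in> J}" using q r by (blast intro: Pk_mult)
next
  show "0 \<in> {r \<in> Pk. r * p \<in> J}" using J_simps(2) Pk_zero by simp
qed (use np in blast)+

text \<open>By maximality the colon ideals of \<open>[:xpoly:]\<close> and of any polynomial that has no multiple
\<open>[:xpoly:] ^ n * q\<close> in \<open>J\<close> are equal to \<open>J\<close>.\<close>

lemma J_prime:
  assumes pq: "p \<in> Pk" "q \<in> Pk" "p * q \<in> J"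
  shows "p \<in> J \<or> q \<in> J"
proof (rule ccontr)
  assume neg: "\<not> (p \<in> J \<or> q \<in> J)"
  have sub: "J \<subseteq> {r \<in> Pk. r * z \<in> J}" if "z \<in> Pk" for z
    using J_simps(1) J_simps(4)[OF that] by (auto simp: mult.commute[of _ z])
  have cancel: "r \<in> J" if "r \<in> Pk" "[:xpoly:] * r \<in> J" for r
  proof -
    have X: "[:xpoly:] \<in> Pk" by (rule X_polys[OF subring_k])
    have "[:xpoly:] ^ n * [:xpoly:] \<notin> J" for n
      using J_simps(6)[of "Suc n"] unfolding power_Suc2 .
    from Jmax[OF colon_ideal[OF X this] sub[OF X]] show ?thesis
      using that by (auto simp: mult.commute)
  qed
  have "[:xpoly:] ^ n * r \<in> J \<Longrightarrow> r \<in> J" if r: "r \<in> Pk" for r n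
  proof (induction n)
    case (Suc n)
    then have "[:xpoly:] * ([:xpoly:] ^ n * r) \<in> J" by (simp only: power_Suc mult.assoc)
    then have "[:xpoly:] ^ n * r \<in> J"
      by (rule cancel[rotated]) (intro Pk_mult Pk_power X_polys subring_k r)
    then show ?case by (rule Suc.IH)
  qed simp
  then have "[:xpoly:] ^ n * q \<notin> J" for n using neg pq by blast
  from Jmax[OF colon_ideal[OF pq(2) this] sub[OF pq(2)]] show False
    using neg pq by blast
qed

lemma J_const: "c \<in> \<kappa> \<Longrightarrow> [:[:c:]:] \<in> J \<Longrightarrow> c = 0"
proof (rule ccontr)
  assume c: "c \<in> \<kappa>" "[:[:c:]:] \<in> J" "c \<noteq> 0"
  then have "[:[:inverse c:]:] * [:[:c:]:] \<in> J" by (intro J_simps(4) const_Pk k_inverse)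
  then show False using J_simps(6)[of 0] c by (simp add: one_pCons)
qed

text \<open>If \<open>J\<close> contains non-zero polynomials in the first variable alone, then one of least degree has a root
\<open>a\<close>, and its derivation forces the second coordinate to be \<open>a'\<close>. Otherwise a non-zero element of \<open>J\<close> of
least degree in the second variable has, by Blum's axiom of order one, a zero \<open>(a, a')\<close> at which
finitely many given non-zero polynomials in \<open>a\<close> do not vanish; the partial derivative is among the
polynomials that can be avoided in this way. If \<open>J = 0\<close>, the solution \<open>1\<close> suffices.\<close>

lemma point_of_maximal_ideal:
  assumes alg: "\<And>q::'u poly. degree q > 0 \<Longrightarrow> \<exists>a. poly q a = 0"
    and blum: "\<And>p (c::'u poly). degree p > 0 \<Longrightarrow> c \<noteq> 0 \<Longrightarrow> \<exists>a. ev p a (D a) = 0 \<and> poly c a \<noteq> 0"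
  shows "\<exists>a. a \<noteq> 0 \<and> a * D (D a) = D a \<and> (\<forall>p\<in>J. ev p a (D a) = 0)"
proof -
  note SS = subring_polys[OF subring_k]
  define I where "I = {c \<in> polys \<kappa>. [:c:] \<in> J}"
  consider c where "c \<in> I" "c \<noteq> 0" | p where "I \<subseteq> {0}" "p \<in> J" "p \<noteq> 0" | "J \<subseteq> {0}" by blast
  then show ?thesis
  proof cases
    case 1
    interpret I: prime_poly_ideal \<kappa> I
    proof
      fix p q assume "p \<in> I" "q \<in> I"
      then show "p + q \<in> I" using subring_add[OF SS] J_simps(3)[of "[:p:]" "[:q:]"] by (auto simp: I_def)
    next
      fix p q assume "p \<in> polys \<kappa>" "q \<in> I"
      then show "p * q \<in> I"
        using subring_mult[OF SS] J_simps(4)[OF polys_const[OF SS], of p "[:q:]"] by (auto simp: I_def mult.commute)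
    next
      fix p q assume "p \<in> polys \<kappa>" "q \<in> polys \<kappa>" "p * q \<in> I"
      then show "p \<in> I \<or> q \<in> I"
        using J_prime[of "[:p:]" "[:q:]"] polys_const[OF SS] by (auto simp: I_def mult.commute)
    next
      fix c assume "[:c:] \<in> I"
      then show "c = 0" using J_const[of c] polys_coeff[of "[:c:]" \<kappa> 0] by (auto simp: I_def)
    qed (auto simp: I_def subring_k)
    obtain g where g: "g \<in> I" "g \<noteq> 0" "\<And>h. h \<in> I \<Longrightarrow> h \<noteq> 0 \<Longrightarrow> degree g \<le> degree h" "degree g > 0"
      using I.minimal_element[OF 1] by blast
    have gk: "g \<in> polys \<kappa>" "[:g:] \<in> J" using g by (auto simp: I_def)
    obtain \<alpha> where \<alpha>: "poly g \<alpha> = 0" using alg[OF g(4)] by blast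
    have nz: "poly h \<alpha> \<noteq> 0" if h: "h \<in> polys \<kappa>" "h \<notin> I" for h
    proof -
      obtain c a b where "c \<noteq> 0" and c: "[:c:] = a * g + b * h"
        using I.coprime_up_to_constant[OF g(1-3) h] by blast
      have "c = poly a \<alpha> * poly g \<alpha> + poly b \<alpha> * poly h \<alpha>"
        using arg_cong[OF c, of "\<lambda>p. poly p \<alpha>"] by simp
      then show ?thesis using \<alpha> \<open>c \<noteq> 0\<close> by auto
    qed
    have pg0: "pderiv g \<noteq> 0" using g(4) by (simp add: pderiv_eq_0_iff)
    have "pderiv g \<notin> I" using g(3)[OF _ pg0] g(4) by (auto simp: degree_pderiv)
    then have g': "poly (pderiv g) \<alpha> \<noteq> 0" using nz polys_pderiv[OF subring_k gk(1)] by blast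
    have "xpoly \<notin> I" using J_simps(6)[of 1] by (auto simp: I_def)
    then have \<alpha>0: "\<alpha> \<noteq> 0" using nz[OF xpoly_polys[OF subring_k]] by (auto simp: xpoly_def)
    \<comment> \<open>The derivation of \<open>g\<close>, divided by \<open>x\<close>: it is linear in the second variable.\<close>
    define q where "q = [:map_poly D g, pderiv g:]"
    have qP: "q \<in> Pk" unfolding q_def
      using gk by (intro polys_pCons polys_zero SS polys_pderiv subring_k polys_map_poly[of \<kappa>]) (auto intro: k_D D_zero)
    have "xD [:g:] = [:xpoly:] * q"
      unfolding xD_def q_def by (simp add: map_poly_pCons[of "map_poly D"] map_poly_pCons[of pderiv])
    then have "[:xpoly:] * q \<in> J" using J_simps(5)[OF gk(2)] by simp
    then have qJ: "q \<in> J" using J_prime[OF X_polys[OF subring_k] qP] J_simps(6)[of 1] by auto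
    have q0: "q \<noteq> 0" and dq: "degree q = 1" and lq: "lead_coeff q = pderiv g"
      using pg0 by (auto simp: q_def)
    have evq: "ev q \<alpha> (D \<alpha>) = 0"
      using D_poly[of g \<alpha>] \<alpha> by (simp add: q_def ev_simps D_zero mult.commute)
    have zero: "ev p \<alpha> (D \<alpha>) = 0" if p: "p \<in> J" for p
    proof -
      obtain n z r where *: "z \<in> Pk" "r \<in> Pk" "smult (lead_coeff q ^ n) p = z * q + r"
          "r = 0 \<or> degree r < degree q"
        using pseudo_division[OF SS qP q0] p J_simps(1) by blast
      then have "degree r = 0" using dq by auto
      then obtain c where r: "r = [:c:]" using degree_eq_zeroE by blast
      have ck: "c \<in> polys \<kappa>" using polys_coeff[OF *(2), of 0] by (simp add: r)
      have "r = [:lead_coeff q ^ n:] * p + (- z) * q" using *(3) by simp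
      also have "\<dots> \<in> J"
        using * qP p qJ
        by (intro J_simps(3,4) polys_const SS subring_power polys_coeff Pk_uminus)
      finally have "c \<in> I" using ck by (simp add: I_def r)
      then obtain l h where "smult (lead_coeff g ^ l) c = h * g"
        using I.divides_up_to_lead_coeff[OF g(1-3)] by blast
      then have "lead_coeff g ^ l * poly c \<alpha> = poly h \<alpha> * poly g \<alpha>"
        by (metis poly_smult poly_mult)
      then have "poly c \<alpha> = 0" using \<alpha> g(2) by simp
      moreover have "poly (pderiv g) \<alpha> ^ n * ev p \<alpha> (D \<alpha>) = ev z \<alpha> (D \<alpha>) * ev q \<alpha> (D \<alpha>) + ev r \<alpha> (D \<alpha>)"
        using arg_cong[OF *(3), of "\<lambda>p. ev p \<alpha> (D \<alpha>)"] by (simp add: lq ev_simps)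
      ultimately show ?thesis using evq g' by (simp add: r ev_simps)
    qed
    have "ev (pderiv q) \<alpha> (D \<alpha>) = poly (pderiv g) \<alpha>"
      by (simp add: q_def pderiv_pCons ev_simps)
    then have "\<alpha> * D (D \<alpha>) = D \<alpha>"
      using xD_ev[of \<alpha> q] zero[OF J_simps(5)[OF qJ]] evq g' by (simp add: D_zero)
    then show ?thesis using zero \<alpha>0 by blast
  next
    case 2
    interpret J: prime_poly_ideal "polys \<kappa>" J
    proof
      fix c assume c: "[:c:] \<in> J"
      then have "c \<in> polys \<kappa>" using polys_coeff[of "[:c:]" "polys \<kappa>" 0] J_simps(1) by auto
      then show "c = 0" using c 2(1) by (auto simp: I_def)
    next
      fix p q assume "p \<in> Pk" "q \<in> Pk" "p * q \<in> J"
      then show "p \<in> J \<or> q \<in> J" by (rule J_prime)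
    qed (simp_all add: SS J_simps)
    obtain g where g: "g \<in> J" "g \<noteq> 0" "\<And>h. h \<in> J \<Longrightarrow> h \<noteq> 0 \<Longrightarrow> degree g \<le> degree h" "degree g > 0"
      using J.minimal_element[OF 2(2,3)] by blast
    have gk: "g \<in> Pk" using g J_simps(1) by blast
    have pg0: "pderiv g \<noteq> 0" using g(4) by (simp add: pderiv_eq_0_iff)
    have "pderiv g \<notin> J" using g(3)[OF _ pg0] g(4) by (auto simp: degree_pderiv)
    then obtain c a b where c: "c \<noteq> 0" "[:c:] = a * g + b * pderiv g"
      using J.coprime_up_to_constant[OF g(1-3) polys_pderiv[OF SS gk]] by blast
    \<comment> \<open>The factors ensure in turn that the partial derivative, the denominators of the division by \<open>g\<close> and the first coordinate do not vanish.\<close>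
    have "c * lead_coeff g * xpoly \<noteq> 0" using c g(2) by (auto simp: xpoly_def)
    then obtain \<alpha> where \<alpha>: "ev g \<alpha> (D \<alpha>) = 0" "poly (c * lead_coeff g * xpoly) \<alpha> \<noteq> 0"
      using blum[OF g(4)] by blast
    then have nz: "\<alpha> \<noteq> 0" "poly (lead_coeff g) \<alpha> \<noteq> 0" "poly c \<alpha> \<noteq> 0" by (auto simp: xpoly_def)
    have zero: "ev p \<alpha> (D \<alpha>) = 0" if p: "p \<in> J" for p
    proof -
      obtain n q where "smult (lead_coeff g ^ n) p = q * g"
        using J.divides_up_to_lead_coeff[OF g(1-3) p] by blast
      then have "poly (lead_coeff g ^ n) \<alpha> * ev p \<alpha> (D \<alpha>) = ev q \<alpha> (D \<alpha>) * ev g \<alpha> (D \<alpha>)"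
        by (metis ev_simps(2,9))
      then show ?thesis using \<alpha>(1) nz by simp
    qed
    have "poly c \<alpha> = ev a \<alpha> (D \<alpha>) * ev g \<alpha> (D \<alpha>) + ev b \<alpha> (D \<alpha>) * ev (pderiv g) \<alpha> (D \<alpha>)"
      using arg_cong[OF c(2), of "\<lambda>p. ev p \<alpha> (D \<alpha>)"] by (simp add: ev_simps)
    then have "ev (pderiv g) \<alpha> (D \<alpha>) \<noteq> 0" using nz \<alpha>(1) by auto
    then have "\<alpha> * D (D \<alpha>) = D \<alpha>"
      using xD_ev[of \<alpha> g] zero[OF J_simps(5)[OF g(1)]] \<alpha>(1) by (simp add: D_zero)
    then show ?thesis using zero nz by blast
  next
    case 3
    then show ?thesis by (intro exI[of _ 1]) (auto simp: D_one D_zero ev_simps)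
  qed
qed

end

lemma point_of_xD_ideal:
  assumes J0: "xD_ideal J0"
    and alg: "\<And>q::'u poly. degree q > 0 \<Longrightarrow> \<exists>a. poly q a = 0"
    and blum: "\<And>p (c::'u poly). degree p > 0 \<Longrightarrow> c \<noteq> 0 \<Longrightarrow> \<exists>a. ev p a (D a) = 0 \<and> poly c a \<noteq> 0"
  shows "\<exists>a. a \<noteq> 0 \<and> a * D (D a) = D a \<and> (\<forall>p\<in>J0. ev p a (D a) = 0)"
proof -
  let ?\<A> = "{J. xD_ideal J \<and> J0 \<subseteq> J}"
  have "\<exists>J\<in>?\<A>. \<forall>J'\<in>?\<A>. J \<subseteq> J' \<longrightarrow> J' = J"
  proof (rule subset_Zorn_nonempty)
    show "?\<A> \<noteq> {}" using J0 by blast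
    fix C assume C: "C \<noteq> {}" "subset.chain ?\<A> C"
    then have CA: "\<And>J. J \<in> C \<Longrightarrow> xD_ideal J \<and> J0 \<subseteq> J" and
      ch: "\<And>J J'. J \<in> C \<Longrightarrow> J' \<in> C \<Longrightarrow> J \<subseteq> J' \<or> J' \<subseteq> J"
      unfolding subset_chain_def by blast+
    have "xD_ideal (\<Union>C)"
      unfolding xD_ideal_def
    proof (intro conjI ballI allI)
      fix p q assume "p \<in> \<Union>C" "q \<in> \<Union>C"
      then obtain J J' where "J \<in> C" "p \<in> J" "J' \<in> C" "q \<in> J'" by blast
      then obtain K where "K \<in> C" "p \<in> K" "q \<in> K" using ch by blast
      then show "p + q \<in> \<Union>C" using CA unfolding xD_ideal_def by blast
    qed (use CA C in \<open>unfold xD_ideal_def, blast+\<close>)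
    then show "\<Union>C \<in> ?\<A>" using CA C by blast
  qed
  then obtain J where "J \<in> ?\<A>" and max: "\<forall>J'\<in>?\<A>. J \<subseteq> J' \<longrightarrow> J' = J" by (rule bexE)
  then have J: "xD_ideal J" "J0 \<subseteq> J" by simp_all
  have maxJ: "J' = J" if "xD_ideal J'" "J \<subseteq> J'" for J'
  proof -
    have "J0 \<subseteq> J'" using J(2) that(2) by (rule subset_trans)
    with that(1) have "J' \<in> ?\<A>" by (intro CollectI conjI)
    from max[THEN bspec, OF this] that(2) show ?thesis by (rule mp)
  qed
  have "\<exists>a. a \<noteq> 0 \<and> a * D (D a) = D a \<and> (\<forall>p\<in>J. ev p a (D a) = 0)"
    by (rule point_of_maximal_ideal[OF J(1)]) (rule maxJ alg blum; assumption)+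
  then obtain a where "a \<noteq> 0" "a * D (D a) = D a" "\<forall>p\<in>J. ev p a (D a) = 0" by (elim exE conjE)
  then show ?thesis using J(2) by (intro exI[of _ a]) (simp add: subset_iff)
qed

section \<open>The specialization to a non-zero solution\<close>

abbreviation fpp :: "'u poly poly \<Rightarrow> 'u poly poly" where "fpp \<equiv> map_poly (map_poly f)"

lemma f_hom: "ring_hom_on R f"
  by (simp add: ring_hom_on_def f_one f_zero f_add f_mult)

lemmas fp_hom = ring_hom_on_map_poly[OF subring_R f_hom]
lemmas fpp_hom = ring_hom_on_map_poly[OF subring_polys[OF subring_R] fp_hom]
lemmas subring_PR = subring_polys[OF subring_polys[OF subring_R]]
lemmas PR_zero = subring_zero[OF subring_PR] and PR_one = subring_one[OF subring_PR]
  and PR_add = subring_add[OF subring_PR] and PR_mult = subring_mult[OF subring_PR]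
  and PR_uminus = subring_uminus[OF subring_PR] and PR_of_nat = subring_of_nat[OF subring_PR]
  and PR_power = subring_power[OF subring_PR]

lemma fpp_simps: "p \<in> polys (polys R) \<Longrightarrow> q \<in> polys (polys R) \<Longrightarrow> fpp (p + q) = fpp p + fpp q"
  "p \<in> polys (polys R) \<Longrightarrow> q \<in> polys (polys R) \<Longrightarrow> fpp (p * q) = fpp p * fpp q"
  using fpp_hom by (auto simp: ring_hom_on_def)

lemma fpp_pCons: "fpp (pCons c p) = pCons (map_poly f c) (fpp p)"
  by (rule map_poly_pCons) simp

lemma fp_pCons: "map_poly f (pCons c p) = pCons (f c) (map_poly f p)"
  by (rule map_poly_pCons) (rule f_zero)

lemma fpp_const: "fpp [:[:a:]:] = [:[:f a:]:]"
  by (simp add: fpp_pCons fp_pCons)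

lemma fpp_X: "fpp [:xpoly:] = [:xpoly:]" and fpp_U: "fpp [:0, 1:] = [:0, 1:]"
  and fpp_XU: "fpp [:0, xpoly:] = [:0, xpoly:]"
  by (simp_all add: fpp_pCons fp_pCons xpoly_def f_zero f_one one_pCons)

lemma fpp_power: "p \<in> polys (polys R) \<Longrightarrow> fpp (p ^ n) = fpp p ^ n"
proof (induction n)
  case 0
  then show ?case using fpp_hom by (simp add: ring_hom_on_def)
next
  case (Suc n)
  then show ?case by (simp add: fpp_simps PR_power)
qed

lemma fpp_Pk: "p \<in> polys (polys R) \<Longrightarrow> fpp p \<in> Pk"
  by (intro polys_map_poly[of "polys R"] polys_map_poly[of R]) (auto simp: f_zero)

lemma fpp_xD:
  assumes p: "p \<in> polys (polys R)"
  shows "fpp (xD p) = xD (fpp p)"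
proof -
  note [simp] = coeff_map_poly[of f, OF f_zero] coeff_map_poly[of D, OF D_zero]
  have c: "coeff (coeff p i) j \<in> R" for i j using p by (simp add: polys_def)
  have fn: "f (of_nat n * r) = of_nat n * f r" if "r \<in> R" for n r
    using that f_mult[OF R_of_nat] f_of_nat by simp
  have 1: "fpp (map_poly (map_poly D) p) = map_poly (map_poly D) (fpp p)"
    by (intro poly_eqI) (simp add: coeff_map_poly f_D c)
  have 2: "fpp (map_poly pderiv p) = map_poly pderiv (fpp p)"
    by (intro poly_eqI) (simp add: coeff_map_poly coeff_pderiv fn c del: of_nat_Suc)
  have nc: "coeff (of_nat n * q) j = of_nat n * coeff q j" for n j and q :: "'u poly"
    by (simp add: of_nat_poly)
  have 3: "fpp (pderiv p) = pderiv (fpp p)"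
    by (intro poly_eqI) (simp add: coeff_map_poly coeff_pderiv nc fn c del: of_nat_Suc)
  have m1: "map_poly (map_poly D) p \<in> polys (polys R)"
    using p by (intro polys_map_poly[of "polys R"] polys_map_poly[of R]) (auto intro: R_D D_zero)
  have m2: "map_poly pderiv p \<in> polys (polys R)"
    using p by (intro polys_map_poly[of "polys R"]) (auto intro: polys_pderiv subring_R)
  have m3: "pderiv p \<in> polys (polys R)" by (intro polys_pderiv subring_polys subring_R p)
  have X: "[:xpoly:] \<in> polys (polys R)" by (rule X_polys[OF subring_R])
  have U: "[:0, 1:] \<in> polys (polys R)" "[:0, xpoly:] \<in> polys (polys R)"
    by (intro polys_pCons subring_zero subring_one polys_zero subring_polys subring_R xpoly_polys)+
  show ?thesis
    unfolding xD_def
    by (simp only: fpp_simps fpp_X fpp_U fpp_XU 1 2 3 m1 m2 m3 X U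
        PR_add PR_mult)
qed

text \<open>The elements of the differential ring generated by \<open>x\<close> are polynomials in \<open>x\<close> and \<open>D x\<close> over \<open>R\<close>,
divided by powers of \<open>x\<close>. So it suffices to find a solution \<open>a \<noteq> 0\<close> at which the images under \<open>f\<close> of all
polynomial relations between \<open>x\<close> and \<open>D x\<close> vanish.\<close>

lemma specializes_to_nonzero:
  assumes x0: "x \<noteq> 0" and eqn: "x * D (D x) = D x"
    and proper: "\<And>k n. inverse x ^ k \<notin> lin \<mm> (mons (inverse x) (D x * inverse x) n)"
    and alg: "\<And>q::'u poly. degree q > 0 \<Longrightarrow> \<exists>a. poly q a = 0"
    and blum: "\<And>p (c::'u poly). degree p > 0 \<Longrightarrow> c \<noteq> 0 \<Longrightarrow> \<exists>a. ev p a (D a) = 0 \<and> poly c a \<noteq> 0"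
  shows "\<exists>x'. specializes x x'"
proof -
  define u y s where "u = D x" "y = inverse x" "s = D x * inverse x"
  let ?PR = "polys (polys R)"
  define J where "J = {fpp p | p. p \<in> ?PR \<and> ev p x u = 0}"
  have Xn: "[:xpoly:] ^ n \<notin> J" for n
  proof
    assume "[:xpoly:] ^ n \<in> J"
    then obtain p where p: "p \<in> ?PR" "ev p x u = 0" "fpp p = [:xpoly:] ^ n" by (auto simp: J_def)
    define w where "w = [:xpoly:] ^ n + (- 1) * p"
    have XP: "[:xpoly:] ^ n \<in> ?PR" by (intro PR_power X_polys subring_R)
    have m1: "- 1 \<in> ?PR" by (intro PR_uminus PR_one)
    have "fpp (- 1) = - 1" by (simp add: one_pCons fpp_pCons fp_pCons f_uminus R_one f_one)
    then have "fpp w = 0"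
      unfolding w_def using p XP m1
      by (simp only: fpp_simps PR_mult fpp_power[OF X_polys[OF subring_R]] fpp_X) simp
    moreover have wR: "w \<in> ?PR" unfolding w_def
      by (intro PR_add PR_mult XP m1 p)
    ultimately have "w \<in> polys (polys \<mm>)"
    proof -
      have "f (coeff (coeff w i) j) = coeff (coeff (fpp w) i) j" for i j
        by (simp add: coeff_map_poly coeff_map_poly[of f, OF f_zero])
      then have "f (coeff (coeff w i) j) = 0" for i j using \<open>fpp w = 0\<close> by simp
      then show ?thesis using wR by (simp add: polys_def \<mm>_def)
    qed
    from ev_in_lin[OF this] obtain N where N: "ev w x u \<in> lin \<mm> (mons x u N)" by (rule lin_allmons_bounded)
    have "y ^ (N + n) * ev w x u \<in> lin \<mm> (mons y s (N + n))"
    proof (rule lin_mult_elem[OF N])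
      fix h assume "h \<in> mons x u N"
      then obtain i j where h: "h = x ^ i * u ^ j" "i + j \<le> N" by (auto simp: mons_def)
      have xy: "x * y = 1" using x0 by (simp add: u_y_s_def)
      have su: "s = u * y" by (simp add: u_y_s_def)
      have "y ^ (N + n) = y ^ (N + n - (i + j)) * y ^ i * y ^ j" using h(2) by (simp flip: power_add)
      then have "y ^ (N + n) * h = y ^ (N + n - (i + j)) * (x * y) ^ i * (u * y) ^ j"
        by (simp add: h power_mult_distrib mult_ac)
      also have "\<dots> = y ^ (N + n - (i + j)) * s ^ j" by (simp add: xy su)
      also have "\<dots> \<in> mons y s (N + n)" using h(2) by (intro monsI) simp
      finally show "y ^ (N + n) * h \<in> mons y s (N + n)" .
    qed
    moreover have "ev w x u = x ^ n" by (simp add: w_def ev_simps p xpoly_def)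
    moreover have "y ^ (N + n) * x ^ n = y ^ N"
      using x0 by (simp add: u_y_s_def power_add mult.assoc flip: power_mult_distrib)
    ultimately show False using proper unfolding u_y_s_def by metis
  qed
  have "xD_ideal J"
    unfolding xD_ideal_def
  proof (intro conjI ballI allI)
    show "J \<subseteq> Pk" using fpp_Pk by (auto simp: J_def)
    show "0 \<in> J" unfolding J_def using PR_zero by (auto intro!: exI[of _ 0] simp: ev_simps)
  next
    fix p q assume "p \<in> J" "q \<in> J"
    then obtain p' q' where "p' \<in> ?PR" "q' \<in> ?PR" "p = fpp p'" "q = fpp q'" "ev p' x u = 0" "ev q' x u = 0"
      by (auto simp: J_def)
    then have "p + q = fpp (p' + q') \<and> p' + q' \<in> ?PR \<and> ev (p' + q') x u = 0"
      by (auto simp: fpp_simps ev_simps intro: PR_add)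
    then show "p + q \<in> J" unfolding J_def by blast
  next
    fix p q assume p: "p \<in> Pk" and "q \<in> J"
    then obtain q' where q: "q' \<in> ?PR" "q = fpp q'" "ev q' x u = 0" by (auto simp: J_def)
    \<comment> \<open>Coefficients of \<open>p\<close> are lifted to \<open>R\<close>, with \<open>0\<close> lifted to \<open>0\<close>.\<close>
    have "\<exists>p'\<in>?PR. p = fpp p'"
    proof -
      define h where "h = (\<lambda>c. if c = 0 then 0 else inv_into R f c)"
      have h: "h c \<in> R \<and> f (h c) = c" if "c \<in> \<kappa>" for c
        using that by (auto simp: h_def R_zero f_zero inv_into_into f_inv_into_f)
      have h0: "h 0 = 0" by (simp add: h_def)
      have "map_poly (map_poly h) p \<in> ?PR"
        using p h h0 by (intro polys_map_poly[of "polys \<kappa>"] polys_map_poly[of \<kappa>]) auto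
      moreover have "p = fpp (map_poly (map_poly h) p)"
        using p h by (intro poly_eqI)
          (simp add: coeff_map_poly coeff_map_poly[of f, OF f_zero] coeff_map_poly[of h, OF h0] polys_def)
      ultimately show ?thesis by blast
    qed
    then obtain p' where p': "p' \<in> ?PR" "p = fpp p'" by blast
    then have "p * q = fpp (p' * q') \<and> p' * q' \<in> ?PR \<and> ev (p' * q') x u = 0"
      using q by (auto simp: fpp_simps ev_simps intro: PR_mult)
    then show "p * q \<in> J" unfolding J_def by blast
  next
    fix p assume "p \<in> J"
    then obtain p' where p': "p' \<in> ?PR" "p = fpp p'" "ev p' x u = 0" by (auto simp: J_def)
    have "ev (xD p') x u = 0" using xD_ev[of x p'] p'(3) eqn by (simp add: u_y_s_def D_zero)
    then have "xD p = fpp (xD p') \<and> xD p' \<in> ?PR \<and> ev (xD p') x u = 0"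
      using p' by (simp add: fpp_xD xD_polys[OF subring_R R_D])
    then show "xD p \<in> J" unfolding J_def by blast
  next
    fix n show "[:xpoly:] ^ n \<notin> J" by (rule Xn)
  qed
  from point_of_xD_ideal[OF this alg blum]
  obtain a where a: "a \<noteq> 0" "a * D (D a) = D a" "\<And>p. p \<in> J \<Longrightarrow> ev p a (D a) = 0" by blast
  have *: "\<exists>n. \<exists>p\<in>?PR. x ^ n * c = ev p x (D x) \<and> a ^ n * d = ev (fpp p) a (D a)"
    if "(c, d) \<in> ext_graph x a" for c d
    using that
  proof induction
    case (ext_R r)
    then have "[:[:r:]:] \<in> ?PR" by (intro polys_const subring_polys subring_R)
    then show ?case by (intro exI[of _ 0] bexI[of _ "[:[:r:]:]"]) (auto simp: fpp_const ev_simps)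
  next
    case ext_gen
    have "ev (fpp [:xpoly:]) a (D a) = a" "ev [:xpoly:] x (D x) = x"
      unfolding fpp_X by (simp_all add: ev_simps xpoly_def)
    then show ?case using X_polys[OF subring_R]
      by (intro exI[of _ 0] bexI[of _ "[:xpoly:]"]) auto
  next
    case (ext_add c d c' d')
    then obtain n p n' p' where p: "p \<in> ?PR" "p' \<in> ?PR" "x ^ n * c = ev p x (D x)" "a ^ n * d = ev (fpp p) a (D a)"
      "x ^ n' * c' = ev p' x (D x)" "a ^ n' * d' = ev (fpp p') a (D a)" by blast
    define q where "q = [:xpoly:] ^ n' * p + [:xpoly:] ^ n * p'"
    have XP: "[:xpoly:] ^ n \<in> ?PR" for n by (intro PR_power X_polys subring_R)
    have qP: "q \<in> ?PR" unfolding q_def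
      by (intro PR_add PR_mult XP p)
    have fq: "fpp q = [:xpoly:] ^ n' * fpp p + [:xpoly:] ^ n * fpp p'"
      unfolding q_def using p XP
      by (simp only: fpp_simps PR_mult fpp_power[OF X_polys[OF subring_R]] fpp_X)
    have "x ^ (n + n') * (c + c') = x ^ n' * (x ^ n * c) + x ^ n * (x ^ n' * c')"
      "a ^ (n + n') * (d + d') = a ^ n' * (a ^ n * d) + a ^ n * (a ^ n' * d')"
      by (simp_all add: power_add algebra_simps)
    then have "x ^ (n + n') * (c + c') = ev q x (D x) \<and> a ^ (n + n') * (d + d') = ev (fpp q) a (D a)"
      unfolding fq unfolding q_def p by (simp add: ev_simps xpoly_def)
    then show ?case using qP by blast
  next
    case (ext_mult c d c' d')
    then obtain n p n' p' where p: "p \<in> ?PR" "p' \<in> ?PR" "x ^ n * c = ev p x (D x)" "a ^ n * d = ev (fpp p) a (D a)"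
      "x ^ n' * c' = ev p' x (D x)" "a ^ n' * d' = ev (fpp p') a (D a)" by blast
    have "x ^ (n + n') * (c * c') = (x ^ n * c) * (x ^ n' * c')"
      "a ^ (n + n') * (d * d') = (a ^ n * d) * (a ^ n' * d')" by (simp_all add: power_add)
    then have "x ^ (n + n') * (c * c') = ev (p * p') x (D x) \<and> a ^ (n + n') * (d * d') = ev (fpp (p * p')) a (D a)"
      unfolding p using p(1,2) by (simp add: ev_simps fpp_simps)
    then show ?case using subring_mult[OF subring_PR p(1,2)] by blast
  next
    case (ext_D c d)
    then obtain n p where p: "p \<in> ?PR" "x ^ n * c = ev p x (D x)" "a ^ n * d = ev (fpp p) a (D a)" by blast
    have key: "z ^ Suc n * D e = ev (xD q + (- of_nat n * [:0, 1:]) * q) z (D z)"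
      if z: "z * D (D z) = D z" and e: "z ^ n * e = ev q z (D z)" for z e q
    proof -
      have zn: "z * D (z ^ n) = of_nat n * D z * z ^ n"
        unfolding D_power[of z n] by (cases n) (auto simp: algebra_simps simp del: of_nat_Suc)
      have "z * D (z ^ n * e) = (z * D (z ^ n)) * e + z ^ Suc n * D e" by (simp add: D_mult algebra_simps)
      then have "z ^ Suc n * D e = z * D (ev q z (D z)) - (of_nat n * D z) * (z ^ n * e)"
        by (simp add: e[symmetric] zn algebra_simps)
      then show ?thesis using z by (simp add: xD_ev e ev_simps ev_def[of "of_nat n"])
    qed
    have nP: "- of_nat n * [:0, 1:] \<in> ?PR"
      by (intro PR_mult PR_uminus PR_of_nat
          polys_pCons subring_zero subring_one polys_zero subring_polys subring_R)
    define q where "q = xD p + (- of_nat n * [:0, 1:]) * p"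
    have qP: "q \<in> ?PR" unfolding q_def
      by (intro PR_add PR_mult nP p xD_polys[OF subring_R R_D])
    have "fpp (- of_nat n * [:0, 1:]) = - of_nat n * [:0, 1:]"
      by (simp add: of_nat_poly fpp_pCons fp_pCons f_zero f_uminus f_of_nat R_of_nat)
    then have "fpp q = xD (fpp p) + (- of_nat n * [:0, 1:]) * fpp p"
      unfolding q_def using nP p
      by (simp only: fpp_simps PR_mult xD_polys[OF subring_R R_D] fpp_xD)
    then show ?case using qP key[OF eqn p(2)] key[OF a(2) p(3)] unfolding q_def by metis
  qed
  have "specializes x a"
    unfolding specializes_def
  proof safe
    fix b assume "(0, b) \<in> ext_graph x a"
    then obtain n p where p: "p \<in> ?PR" "x ^ n * 0 = ev p x (D x)" "a ^ n * b = ev (fpp p) a (D a)" using * by blast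
    then have "fpp p \<in> J" unfolding J_def by (auto simp: u_y_s_def)
    then show "b = 0" using a p by simp
  qed
  then show ?thesis ..
qed

text \<open>The cases are whether \<open>1\<close>, only some power of \<open>y\<close>, or no power of \<open>y\<close> lies in \<open>\<mm> R[y, s]\<close>. The
hypotheses on the field are Blum's axioms of orders zero and one.\<close>

theorem solution_specializes:
  assumes x0: "x \<noteq> 0" and eqn: "x * D (D x) = D x"
    and alg: "\<And>q::'u poly. degree q > 0 \<Longrightarrow> \<exists>a. poly q a = 0"
    and blum: "\<And>p (c::'u poly). degree p > 0 \<Longrightarrow> c \<noteq> 0 \<Longrightarrow> \<exists>a. ev p a (D a) = 0 \<and> poly c a \<noteq> 0"
  shows "(\<exists>x'. specializes x x') \<or> specializes (inverse x) 0"
proof -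
  let ?y = "inverse x" and ?s = "D x * inverse x"
  consider n where "1 \<in> lin \<mm> (mons ?y ?s n)"
    | k n where "?y ^ k \<in> lin \<mm> (mons ?y ?s n)" "\<And>n. 1 \<notin> lin \<mm> (mons ?y ?s n)"
    | "\<And>k n. ?y ^ k \<notin> lin \<mm> (mons ?y ?s n)" by blast
  then show ?thesis
  proof cases
    case 1
    then show ?thesis using specializes_zero_if_unit[OF x0 refl eqn refl refl] by blast
  next
    case 2
    have "specializes ?y 0"
      by (rule specializes_zero_if_nilpotent[OF D_y[OF x0 refl eqn refl refl] D_s[OF x0 refl eqn refl refl] 2])
    then show ?thesis ..
  next
    case 3
    then show ?thesis using specializes_to_nonzero[OF x0 eqn _ alg blum] by blast
  qed
qed

end

section \<open>Functions given by differential polynomials\<close>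

definition mon_eval :: "('u::field_char_0 \<Rightarrow> 'u) \<Rightarrow> ('i \<times> nat \<Rightarrow>\<^sub>0 nat) \<Rightarrow> ('i \<Rightarrow> 'u) \<Rightarrow> 'u" where
  "mon_eval D m x = (\<Prod>(i, j)\<in>Poly_Mapping.keys m. (D ^^ j) (x i) ^ Poly_Mapping.lookup m (i, j))"

lemma mon_eval_superset:
  assumes "finite K" "Poly_Mapping.keys m \<subseteq> K"
  shows "mon_eval D m x = (\<Prod>(i, j)\<in>K. (D ^^ j) (x i) ^ Poly_Mapping.lookup m (i, j))"
  unfolding mon_eval_def
  by (rule prod.mono_neutral_left[OF assms]) (auto simp: in_keys_iff)

lemma mon_eval_zero: "mon_eval D 0 x = 1"
  by (simp add: mon_eval_def)

lemma mon_eval_single: "mon_eval D (Poly_Mapping.single (i, j) n) x = (D ^^ j) (x i) ^ n"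
  by (subst mon_eval_superset[of "{(i, j)}"]) auto

lemma mon_eval_add: "mon_eval D (m + m') x = mon_eval D m x * mon_eval D m' x"
proof -
  let ?K = "Poly_Mapping.keys m \<union> Poly_Mapping.keys m'"
  have "Poly_Mapping.keys (m + m') \<subseteq> ?K" by (rule Poly_Mapping.keys_add)
  then show ?thesis
    by (simp add: mon_eval_superset[of ?K] lookup_add power_add prod.distrib case_prod_unfold)
qed

lemma dpoly_eval_superset:
  assumes "finite M" "Poly_Mapping.keys g \<subseteq> M"
  shows "dpoly_eval D g x = (\<Sum>m\<in>M. Poly_Mapping.lookup g m * mon_eval D m x)"
  unfolding dpoly_eval_def mon_eval_def
  by (rule sum.mono_neutral_left[OF assms]) (auto simp: in_keys_iff)

lemma dpoly_eval_zero: "dpoly_eval D 0 x = 0"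
  by (simp add: dpoly_eval_def)

lemma dpoly_eval_single: "dpoly_eval D (Poly_Mapping.single m c) x = c * mon_eval D m x"
  by (subst dpoly_eval_superset[of "{m}"]) auto

lemma dpoly_eval_add: "dpoly_eval D (f + g) x = dpoly_eval D f x + dpoly_eval D g x"
proof -
  let ?M = "Poly_Mapping.keys f \<union> Poly_Mapping.keys g"
  have "Poly_Mapping.keys (f + g) \<subseteq> ?M" by (rule Poly_Mapping.keys_add)
  then show ?thesis
    by (simp add: dpoly_eval_superset[of ?M] lookup_add distrib_right sum.distrib)
qed

lemma dpoly_eval_sum: "dpoly_eval D (sum F A) x = (\<Sum>a\<in>A. dpoly_eval D (F a) x)"
  by (induction A rule: infinite_finite_induct) (auto simp: dpoly_eval_zero dpoly_eval_add)

lemma dpoly_sum_singles: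
  "g = (\<Sum>m\<in>Poly_Mapping.keys g. Poly_Mapping.single m (Poly_Mapping.lookup g m))"
  by (rule poly_mapping_eqI)
    (auto simp: lookup_sum lookup_single when_def in_keys_iff)

lemma dpoly_mult_singles:
  "f * g = (\<Sum>m\<in>Poly_Mapping.keys f. \<Sum>m'\<in>Poly_Mapping.keys g.
     Poly_Mapping.single (m + m') (Poly_Mapping.lookup f m * Poly_Mapping.lookup g m'))"
  for f g :: "('i, 'u::comm_semiring_1) dpoly"
  by (subst dpoly_sum_singles[of f], subst dpoly_sum_singles[of g])
    (simp add: sum_product mult_single)

lemma dpoly_eval_mult: "dpoly_eval D (f * g) x = dpoly_eval D f x * dpoly_eval D g x"
  unfolding dpoly_mult_singles dpoly_eval_sum dpoly_eval_single mon_eval_add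
  by (simp add: dpoly_eval_def mon_eval_def[symmetric] sum_product mult_ac)

text \<open>Working with functions instead of polynomials gives closure under derivation, substitution and
clearing of denominators by induction.\<close>

inductive_set dfun :: "('u::field_char_0 \<Rightarrow> 'u) \<Rightarrow> 'u set \<Rightarrow> 'i set \<Rightarrow> (('i \<Rightarrow> 'u) \<Rightarrow> 'u) set"
  for D K I where
  dfun_const: "c \<in> K \<Longrightarrow> (\<lambda>_. c) \<in> dfun D K I"
| dfun_var: "i \<in> I \<Longrightarrow> (\<lambda>x. (D ^^ j) (x i)) \<in> dfun D K I"
| dfun_add: "g \<in> dfun D K I \<Longrightarrow> h \<in> dfun D K I \<Longrightarrow> (\<lambda>x. g x + h x) \<in> dfun D K I"
| dfun_mult: "g \<in> dfun D K I \<Longrightarrow> h \<in> dfun D K I \<Longrightarrow> (\<lambda>x. g x * h x) \<in> dfun D K I"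

lemma dfun_cong: "h \<in> dfun D K I \<Longrightarrow> (\<And>i. i \<in> I \<Longrightarrow> x i = y i) \<Longrightarrow> h x = h y"
  by (induction rule: dfun.induct) auto

lemma dfun_sum: "0 \<in> K \<Longrightarrow> (\<And>a. a \<in> A \<Longrightarrow> h a \<in> dfun D K I) \<Longrightarrow> (\<lambda>x. \<Sum>a\<in>A. h a x) \<in> dfun D K I"
  by (induction A rule: infinite_finite_induct) (auto intro: dfun_const dfun_add)

lemma dfun_prod: "1 \<in> K \<Longrightarrow> (\<And>a. a \<in> A \<Longrightarrow> h a \<in> dfun D K I) \<Longrightarrow> (\<lambda>x. \<Prod>a\<in>A. h a x) \<in> dfun D K I"
  by (induction A rule: infinite_finite_induct) (auto intro: dfun_const dfun_mult)

lemma dfun_power: "1 \<in> K \<Longrightarrow> h \<in> dfun D K I \<Longrightarrow> (\<lambda>x. h x ^ n) \<in> dfun D K I"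
  by (induction n) (auto intro: dfun_const dfun_mult)

lemma dfun_of_dpoly:
  assumes K: "0 \<in> K" "1 \<in> K" and g: "g \<in> dpolys_over K I"
  shows "dpoly_eval D g \<in> dfun D K I"
proof -
  have "(\<lambda>x. \<Sum>m\<in>Poly_Mapping.keys g. Poly_Mapping.lookup g m *
      (\<Prod>(i, j)\<in>Poly_Mapping.keys m. (D ^^ j) (x i) ^ Poly_Mapping.lookup m (i, j))) \<in> dfun D K I"
  proof (intro dfun_sum dfun_mult dfun_prod K)
    fix m ij assume m: "m \<in> Poly_Mapping.keys g" and ij: "ij \<in> Poly_Mapping.keys m"
    obtain i j where ij': "ij = (i, j)" by force
    have "(i, j) \<in> dpoly_indets g" using m ij ij' by (auto simp: dpoly_indets_def)
    then have "i \<in> I" using g by (force simp: dpolys_over_def)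
    then show "(\<lambda>x. case ij of (i, j) \<Rightarrow> (D ^^ j) (x i) ^ Poly_Mapping.lookup m (i, j)) \<in> dfun D K I"
      unfolding ij' prod.case by (intro dfun_power dfun_var K)
  qed (use g in \<open>auto simp: dpolys_over_def intro: dfun_const\<close>)
  then show ?thesis by (simp add: dpoly_eval_def[abs_def])
qed

lemma dpolys_over_indets: "g \<in> dpolys_over K I \<Longrightarrow> fst ` dpoly_indets g \<subseteq> I"
  by (simp add: dpolys_over_def)

lemma dpoly_of_dfun:
  fixes h :: "('i \<Rightarrow> 'u::field_char_0) \<Rightarrow> 'u"
  assumes S: "subring K" and h: "h \<in> dfun D K I"
  shows "\<exists>g\<in>dpolys_over K I. h = dpoly_eval D g"
  using h
proof induction
  case (dfun_const c)
  have "Poly_Mapping.single 0 c \<in> dpolys_over K I"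
    using dfun_const subring_zero[OF S]
    by (auto simp: dpolys_over_def dpoly_indets_def lookup_single when_def split: if_splits)
  then show ?case
    by (intro bexI[of _ "Poly_Mapping.single 0 c"]) (auto simp: dpoly_eval_single mon_eval_zero)
next
  case (dfun_var i j)
  let ?g = "Poly_Mapping.single (Poly_Mapping.single (i, j) 1) 1 :: ('i, 'u) dpoly"
  have "?g \<in> dpolys_over K I"
    using dfun_var subring_zero[OF S] subring_one[OF S]
    by (auto simp: dpolys_over_def dpoly_indets_def lookup_single when_def split: if_splits)
  then show ?case
    by (intro bexI[of _ ?g]) (auto simp: dpoly_eval_single mon_eval_single)
next
  case (dfun_add h1 h2)
  then obtain g1 g2 where g: "g1 \<in> dpolys_over K I" "g2 \<in> dpolys_over K I"
    "h1 = dpoly_eval D g1" "h2 = dpoly_eval D g2" by blast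
  have "dpoly_indets (g1 + g2) \<subseteq> dpoly_indets g1 \<union> dpoly_indets g2"
    using Poly_Mapping.keys_add[of g1 g2] unfolding dpoly_indets_def by blast
  from image_mono[OF this, of fst] have "fst ` dpoly_indets (g1 + g2) \<subseteq> I"
    unfolding image_Un by (rule order_trans) (intro Un_least dpolys_over_indets[OF g(1)] dpolys_over_indets[OF g(2)])
  then have "g1 + g2 \<in> dpolys_over K I"
    using g subring_add[OF S] by (auto simp: dpolys_over_def lookup_add)
  then show ?case by (intro bexI[of _ "g1 + g2"]) (auto simp: g dpoly_eval_add)
next
  case (dfun_mult h1 h2)
  then obtain g1 g2 where g: "g1 \<in> dpolys_over K I" "g2 \<in> dpolys_over K I"
    "h1 = dpoly_eval D g1" "h2 = dpoly_eval D g2" by blast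
  have "dpoly_indets (g1 * g2) \<subseteq> dpoly_indets g1 \<union> dpoly_indets g2"
  proof
    fix z assume "z \<in> dpoly_indets (g1 * g2)"
    then obtain m where m: "m \<in> Poly_Mapping.keys (g1 * g2)" "z \<in> Poly_Mapping.keys m"
      by (auto simp: dpoly_indets_def)
    then obtain a b where "m = a + b" "a \<in> Poly_Mapping.keys g1" "b \<in> Poly_Mapping.keys g2"
      using Poly_Mapping.keys_mult[of g1 g2] by blast
    then show "z \<in> dpoly_indets g1 \<union> dpoly_indets g2"
      using m(2) Poly_Mapping.keys_add[of a b] by (auto simp: dpoly_indets_def)
  qed
  moreover have "Poly_Mapping.lookup (g1 * g2) m \<in> K" for m
    unfolding dpoly_mult_singles lookup_sum lookup_single
    using g subring_zero[OF S] by (intro subring_sum[OF S]) (auto simp: when_def dpolys_over_def intro: subring_mult[OF S])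
  moreover from image_mono[OF calculation(1), of fst] have "fst ` dpoly_indets (g1 * g2) \<subseteq> I"
    unfolding image_Un by (rule order_trans) (intro Un_least dpolys_over_indets[OF g(1)] dpolys_over_indets[OF g(2)])
  ultimately have "g1 * g2 \<in> dpolys_over K I" by (simp add: dpolys_over_def)
  then show ?case by (intro bexI[of _ "g1 * g2"]) (auto simp: g dpoly_eval_mult)
qed

lemma diff_place_trivial:
  assumes "derivation D"
  shows "diff_place D UNIV id"
  using assms by unfold_locales (auto simp: derivation_def)

lemma dfun_D:
  assumes D: "derivation D" and K: "\<And>c. c \<in> K \<Longrightarrow> D c \<in> K" and h: "h \<in> dfun D K I"
  shows "(\<lambda>x. D (h x)) \<in> dfun D K I"
  using h
proof induction
  case (dfun_const c)
  then show ?case by (intro dfun.dfun_const K)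
next
  case (dfun_var i j)
  then show ?case using dfun.dfun_var[where j = "Suc j" and D = D and K = K] by simp
next
  case (dfun_add g h)
  then show ?case using D dfun.dfun_add by (simp add: derivation_def)
next
  case (dfun_mult g h)
  have "(\<lambda>x. D (g x) * h x + g x * D (h x)) \<in> dfun D K I"
    by (intro dfun.dfun_add dfun.dfun_mult dfun_mult)
  then show ?case using D by (simp add: derivation_def)
qed

lemma dfun_D_funpow:
  assumes "derivation D" "\<And>c. c \<in> K \<Longrightarrow> D c \<in> K" "h \<in> dfun D K I"
  shows "(\<lambda>x. (D ^^ j) (h x)) \<in> dfun D K I"
  by (induction j) (auto intro: dfun_D assms)

lemma dfun_substitute:
  assumes D: "derivation D" and K: "\<And>c. c \<in> K' \<Longrightarrow> D c \<in> K'" "K \<subseteq> K'" and h: "h \<in> dfun D K I"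
    and t: "\<And>i. i \<in> I \<Longrightarrow> t i \<in> dfun D K' I'"
  shows "(\<lambda>z. h (\<lambda>i. t i z)) \<in> dfun D K' I'"
  using h by induction (use K in \<open>auto intro: dfun.intros dfun_D_funpow[OF D K(1)] t\<close>)

section \<open>Blum's axioms for polynomials in two variables\<close>

definition mono2 :: "nat \<times> nat \<Rightarrow> (unit \<times> nat \<Rightarrow>\<^sub>0 nat)" where
  "mono2 = (\<lambda>(i, j). Poly_Mapping.single ((), 0) i + Poly_Mapping.single ((), 1) j)"

lemma lookup_mono2: "Poly_Mapping.lookup (mono2 (i, j)) ((), k) = (if k = 0 then i else if k = 1 then j else 0)"
  by (auto simp: mono2_def lookup_add lookup_single)

lemma inj_mono2: "inj mono2"
proof
  fix a b :: "nat \<times> nat" assume "mono2 a = mono2 b"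
  then have "Poly_Mapping.lookup (mono2 (fst a, snd a)) ((), k) = Poly_Mapping.lookup (mono2 (fst b, snd b)) ((), k)" for k
    by simp
  from this[of 0] this[of 1] show "a = b" by (cases a, cases b) (simp add: lookup_mono2)
qed

text \<open>The differential polynomial in one indeterminate whose value at \<open>a\<close> is \<open>ev p a (D a)\<close>.\<close>

definition dpoly2 :: "'u::field_char_0 poly poly \<Rightarrow> (unit, 'u) dpoly" where
  "dpoly2 p = (\<Sum>j\<le>degree p. \<Sum>i\<le>degree (coeff p j). Poly_Mapping.single (mono2 (i, j)) (coeff (coeff p j) i))"

lemma dpoly2_eval: "dpoly_eval D (dpoly2 p) (\<lambda>_. a) = ev p a (D a)"
proof -
  have "mon_eval D (mono2 (i, j)) (\<lambda>_. a) = a ^ i * D a ^ j" for i j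
    by (simp add: mono2_def mon_eval_add mon_eval_single)
  then have "dpoly_eval D (dpoly2 p) (\<lambda>_. a) = (\<Sum>j\<le>degree p. poly (coeff p j) a * D a ^ j)"
    by (simp add: dpoly2_def dpoly_eval_sum dpoly_eval_single poly_altdef sum_distrib_right mult.assoc)
  also have "\<dots> = ev p a (D a)"
    by (simp add: ev_def poly_altdef[of p] poly_sum poly_power)
  finally show ?thesis .
qed

lemma lookup_dpoly2: "Poly_Mapping.lookup (dpoly2 p) (mono2 (i, j)) = coeff (coeff p j) i"
proof -
  have "Poly_Mapping.lookup (dpoly2 p) (mono2 (i, j))
      = (\<Sum>j'\<le>degree p. \<Sum>i'\<le>degree (coeff p j'). if i' = i \<and> j' = j then coeff (coeff p j') i' else 0)"
    by (simp add: dpoly2_def lookup_sum lookup_single when_def inj_eq[OF inj_mono2])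
  also have "\<dots> = (\<Sum>j'\<le>degree p. if j' = j then coeff (coeff p j) i else 0)"
  proof (rule sum.cong)
    fix j'
    have "(\<Sum>i'\<le>degree (coeff p j). if i' = i then coeff (coeff p j) i' else 0) = coeff (coeff p j) i"
      by (simp add: coeff_eq_0)
    then show "(\<Sum>i'\<le>degree (coeff p j'). if i' = i \<and> j' = j then coeff (coeff p j') i' else 0)
        = (if j' = j then coeff (coeff p j) i else 0)" by (cases "j' = j") auto
  qed simp
  also have "\<dots> = coeff (coeff p j) i" by (simp add: coeff_eq_0)
  finally show ?thesis .
qed

lemma keys_dpoly2: "m \<in> Poly_Mapping.keys (dpoly2 p) \<Longrightarrow> \<exists>i j. m = mono2 (i, j) \<and> j \<le> degree p"
proof (rule ccontr)
  assume m: "m \<in> Poly_Mapping.keys (dpoly2 p)" and neg: "\<not> (\<exists>i j. m = mono2 (i, j) \<and> j \<le> degree p)"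
  then have "mono2 (i, j) \<noteq> m" if "j \<le> degree p" for i j using that by blast
  then have "Poly_Mapping.lookup (dpoly2 p) m = 0"
    unfolding dpoly2_def lookup_sum by (intro sum.neutral ballI) (simp add: lookup_single when_def)
  then show False using m by (simp add: in_keys_iff)
qed

lemma dpoly2_indets: "z \<in> dpoly_indets (dpoly2 p) \<Longrightarrow> snd z = 0 \<or> (snd z = 1 \<and> degree p > 0)"
proof -
  assume "z \<in> dpoly_indets (dpoly2 p)"
  then obtain i j where j: "j \<le> degree p" and z: "z \<in> Poly_Mapping.keys (mono2 (i, j))"
    using keys_dpoly2 by (fastforce simp: dpoly_indets_def)
  obtain k where "z = ((), k)" by (cases z) auto
  then show ?thesis using z j by (auto simp: in_keys_iff lookup_mono2 split: if_splits)
qed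

lemma dpoly2_indetsI:
  assumes "coeff (coeff p j) i \<noteq> 0" "k = 0 \<and> i > 0 \<or> k = 1 \<and> j > 0"
  shows "((), k) \<in> dpoly_indets (dpoly2 p)"
proof -
  have "mono2 (i, j) \<in> Poly_Mapping.keys (dpoly2 p)" using assms(1) by (simp add: in_keys_iff lookup_dpoly2)
  moreover have "((), k) \<in> Poly_Mapping.keys (mono2 (i, j))" using assms(2) by (auto simp: in_keys_iff lookup_mono2)
  ultimately show ?thesis by (auto simp: dpoly_indets_def)
qed

lemma finite_dpoly_indets: "finite (dpoly_indets g)"
  by (simp add: dpoly_indets_def)

lemma dpoly_order_ge: "((), k) \<in> dpoly_indets g \<Longrightarrow> int k \<le> dpoly_order g"
  by (auto simp: dpoly_order_def finite_dpoly_indets intro!: Max_ge image_eqI[of k snd "((), k)"])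

lemma dpoly_order_le: "(\<And>z. z \<in> dpoly_indets g \<Longrightarrow> snd z \<le> k) \<Longrightarrow> dpoly_order g \<le> int k"
  by (auto simp: dpoly_order_def finite_dpoly_indets)

lemma dpolys_over_UNIV: "g \<in> dpolys_over UNIV UNIV"
  by (simp add: dpolys_over_def)

lemma blum_axiom:
  assumes "model_DCF0 D K" "f \<in> dpolys_over K UNIV" "g \<in> dpolys_over K UNIV" "g \<noteq> 0"
    "dpoly_order g < dpoly_order f"
  shows "\<exists>a\<in>K. dpoly_eval D f (\<lambda>_. a) = 0 \<and> dpoly_eval D g (\<lambda>_. a) \<noteq> 0"
  using assms unfolding model_DCF0_def by blast

lemma roots_exist:
  fixes q :: "'u::field_char_0 poly"
  assumes U: "model_DCF0 D (UNIV :: 'u set)" and q: "degree q > 0"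
  shows "\<exists>a. poly q a = 0"
proof -
  let ?f = "dpoly2 [:q:]" and ?g = "1 :: (unit, 'u) dpoly"
  have "((), 0) \<in> dpoly_indets ?f"
    by (rule dpoly2_indetsI[of _ 0 "degree q"]) (use q in auto)
  then have "0 \<le> dpoly_order ?f" using dpoly_order_ge[of 0] by simp
  moreover have "dpoly_order ?g = - 1" by (simp add: dpoly_order_def dpoly_indets_def)
  ultimately have "\<exists>a. dpoly_eval D ?f (\<lambda>_. a) = 0"
    using blum_axiom[OF U dpolys_over_UNIV dpolys_over_UNIV, of ?g ?f] by auto
  then show ?thesis by (simp add: dpoly2_eval ev_simps)
qed

lemma blum_order_one:
  fixes p :: "'u::field_char_0 poly poly"
  assumes U: "model_DCF0 D (UNIV :: 'u set)" and p: "degree p > 0" and c: "c \<noteq> 0"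
  shows "\<exists>a. ev p a (D a) = 0 \<and> poly c a \<noteq> 0"
proof -
  let ?f = "dpoly2 p" and ?g = "dpoly2 [:c:]"
  have "lead_coeff p \<noteq> 0" using p by auto
  then have "coeff (coeff p (degree p)) (degree (lead_coeff p)) \<noteq> 0"
    by (metis leading_coeff_0_iff)
  then have "((), 1) \<in> dpoly_indets ?f" by (rule dpoly2_indetsI) (use p in simp)
  then have "1 \<le> dpoly_order ?f" using dpoly_order_ge[of 1] by simp
  moreover have "dpoly_order ?g \<le> 0"
    using dpoly_order_le[of ?g 0] dpoly2_indets[of _ "[:c:]"] by fastforce
  moreover have "?g \<noteq> 0"
  proof
    assume "?g = 0"
    then have "lead_coeff c = 0" using lookup_dpoly2[of "[:c:]" "degree c" 0] by simp
    then show False using c by simp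
  qed
  ultimately have "\<exists>a. dpoly_eval D ?f (\<lambda>_. a) = 0 \<and> dpoly_eval D ?g (\<lambda>_. a) \<noteq> 0"
    using blum_axiom[OF U dpolys_over_UNIV dpolys_over_UNIV, of ?g ?f] by auto
  then show ?thesis by (simp add: dpoly2_eval ev_simps)
qed

section \<open>Homogeneity over the ambient field\<close>

text \<open>Blum's axiom with a derivative of high order as the equation.\<close>

lemma nonvanishing_point:
  fixes P :: "(unit, 'u::field_char_0) dpoly"
  assumes F: "model_DCF0 D F" and P: "P \<in> dpolys_over F UNIV" "P \<noteq> 0"
  shows "\<exists>a\<in>F. dpoly_eval D P (\<lambda>_. a) \<noteq> 0"
proof -
  define N where "N = nat (dpoly_order P + 1)"
  let ?f = "Poly_Mapping.single (Poly_Mapping.single ((), N) 1) 1 :: (unit, 'u) dpoly"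
  have "?f \<in> dpolys_over F UNIV"
    using F by (auto simp: dpolys_over_def model_DCF0_def delta_subfield_def lookup_single when_def)
  moreover have "((), N) \<in> dpoly_indets ?f" by (simp add: dpoly_indets_def)
  then have "dpoly_order P < dpoly_order ?f" using dpoly_order_ge[of N ?f] unfolding N_def by linarith
  ultimately show ?thesis using F P unfolding model_DCF0_def by blast
qed

text \<open>Functions with values in \<open>F\<close> that are linearly independent over \<open>F\<close> remain so over a larger field. At a
point where one function does not vanish, that function is eliminated; the remaining ones are
changed by multiples from \<open>F\<close> and stay independent over \<open>F\<close>.\<close>

lemma independent_over_extension:
  fixes \<phi> :: "'m \<Rightarrow> 'a \<Rightarrow> 'u::field"
  assumes "finite M"
    and F: "0 \<in> F" "1 \<in> F" "\<And>x y. x \<in> F \<Longrightarrow> y \<in> F \<Longrightarrow> x + y \<in> F" "\<And>x y. x \<in> F \<Longrightarrow> y \<in> F \<Longrightarrow> x * y \<in> F"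
      "\<And>x. x \<in> F \<Longrightarrow> - x \<in> F" "\<And>x. x \<in> F \<Longrightarrow> inverse x \<in> F"
    and "\<And>m a. m \<in> M \<Longrightarrow> a \<in> A \<Longrightarrow> \<phi> m a \<in> F"
    and "\<And>c. (\<And>m. c m \<in> F) \<Longrightarrow> (\<And>a. a \<in> A \<Longrightarrow> (\<Sum>m\<in>M. c m * \<phi> m a) = 0) \<Longrightarrow> \<forall>m\<in>M. c m = 0"
    and "\<And>a. a \<in> A \<Longrightarrow> (\<Sum>m\<in>M. c m * \<phi> m a) = 0"
  shows "\<forall>m\<in>M. c m = 0"
  using assms(1,8,9,10)
proof (induction M arbitrary: \<phi> c rule: finite_induct)
  case empty
  then show ?case by simp
next
  case (insert k M)
  obtain b where b: "b \<in> A" "\<phi> k b \<noteq> 0"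
  proof (rule ccontr)
    assume "\<not> thesis"
    then have "\<And>a. a \<in> A \<Longrightarrow> \<phi> k a = 0" using that by blast
    then have z: "(\<Sum>m\<in>insert k M. (if m = k then 1 else 0) * \<phi> m a) = 0" if "a \<in> A" for a
      using that insert.hyps by (auto intro!: sum.neutral)
    have "\<forall>m\<in>insert k M. (if m = k then 1 else 0) = (0 :: 'u)"
      by (rule insert.prems(2)) (use F z in auto)
    then show False by simp
  qed
  define \<rho> where "\<rho> m = \<phi> m b / \<phi> k b" for m
  define \<psi> where "\<psi> m a = \<phi> m a - \<rho> m * \<phi> k a" for m a
  have l: "\<rho> m \<in> F" if "m \<in> M" for m
    unfolding \<rho>_def divide_inverse using b(1) that by (intro F insert.prems) auto
  have sumeq: "(\<Sum>m\<in>M. e m * \<psi> m a) = (\<Sum>m\<in>insert k M. (if m = k then - (\<Sum>m\<in>M. e m * \<rho> m) else e m) * \<phi> m a)"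
    for e a
  proof -
    have "(\<Sum>m\<in>insert k M. (if m = k then - (\<Sum>m\<in>M. e m * \<rho> m) else e m) * \<phi> m a)
        = - (\<Sum>m\<in>M. e m * \<rho> m) * \<phi> k a + (\<Sum>m\<in>M. e m * \<phi> m a)"
      using insert.hyps by (simp, intro sum.cong) auto
    also have "\<dots> = (\<Sum>m\<in>M. e m * \<psi> m a)"
      by (simp add: \<psi>_def right_diff_distrib sum_subtractf sum_distrib_right mult.assoc)
    finally show ?thesis by simp
  qed
  have ck: "c k = - (\<Sum>m\<in>M. c m * \<rho> m)"
  proof -
    have "c k * \<phi> k b + (\<Sum>m\<in>M. c m * \<phi> m b) = 0"
      using insert.prems(3)[OF b(1)] insert.hyps by simp
    moreover have "(\<Sum>m\<in>M. c m * \<rho> m) = (\<Sum>m\<in>M. c m * \<phi> m b) / \<phi> k b"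
      by (simp add: \<rho>_def sum_divide_distrib)
    ultimately have "(c k + (\<Sum>m\<in>M. c m * \<rho> m)) * \<phi> k b = 0"
      using b(2) by (simp add: distrib_right)
    then show ?thesis using b(2) by (simp add: eq_neg_iff_add_eq_0)
  qed
  have "\<forall>m\<in>M. c m = 0"
  proof (rule insert.IH)
    show "\<psi> m a \<in> F" if "m \<in> M" "a \<in> A" for m a
    proof -
      have "\<phi> m a + - (\<rho> m * \<phi> k a) \<in> F" using that by (intro F l insert.prems) auto
      then show ?thesis by (simp add: \<psi>_def)
    qed
  next
    fix e assume e: "\<And>m. e m \<in> F" "\<And>a. a \<in> A \<Longrightarrow> (\<Sum>m\<in>M. e m * \<psi> m a) = 0"
    have "sum g B \<in> F" if "\<And>m. m \<in> B \<Longrightarrow> g m \<in> F" for g and B :: "'m set"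
      using that by (induction B rule: infinite_finite_induct) (auto intro: F)
    from this[of M "\<lambda>m. e m * \<rho> m"] have "- (\<Sum>m\<in>M. e m * \<rho> m) \<in> F"
      by (intro F(5)) (auto intro: F e l)
    then have "\<forall>m\<in>insert k M. (if m = k then - (\<Sum>m\<in>M. e m * \<rho> m) else e m) = 0"
      using e by (intro insert.prems(2)) (auto simp: sumeq)
    then show "\<forall>m\<in>M. e m = 0" using insert.hyps(2) by (metis insertI2)
  next
    fix a assume a: "a \<in> A"
    have "(\<Sum>m\<in>insert k M. (if m = k then - (\<Sum>m\<in>M. c m * \<rho> m) else c m) * \<phi> m a)
        = (\<Sum>m\<in>insert k M. c m * \<phi> m a)"
      by (intro sum.cong) (auto simp: ck)
    then show "(\<Sum>m\<in>M. c m * \<psi> m a) = 0" using insert.prems(3)[OF a] sumeq by metis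
  qed
  then show ?case using ck by simp
qed

text \<open>The coefficients of \<open>P\<close> are arbitrary, only the points are restricted to \<open>F\<close>. The differential monomials
are independent as functions on \<open>F\<close> over \<open>F\<close>, hence over the whole field.\<close>

lemma vanishing_on_model:
  fixes P :: "(unit, 'u::field_char_0) dpoly"
  assumes F: "model_DCF0 D F" and zero: "\<And>a. a \<in> F \<Longrightarrow> dpoly_eval D P (\<lambda>_. a) = 0"
  shows "P = 0"
proof -
  have K: "0 \<in> F" "1 \<in> F" "\<And>x y. x \<in> F \<Longrightarrow> y \<in> F \<Longrightarrow> x + y \<in> F" "\<And>x y. x \<in> F \<Longrightarrow> y \<in> F \<Longrightarrow> x * y \<in> F"
    "\<And>x. x \<in> F \<Longrightarrow> - x \<in> F" "\<And>x. x \<in> F \<Longrightarrow> inverse x \<in> F" "\<And>x. x \<in> F \<Longrightarrow> D x \<in> F"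
    using F by (auto simp: model_DCF0_def delta_subfield_def)
  have Dj: "(D ^^ j) a \<in> F" if "a \<in> F" for a j using that by (induction j) (auto intro: K)
  have pw: "a ^ n \<in> F" if "a \<in> F" for a n using that by (induction n) (auto intro: K)
  have pr: "(\<Prod>p\<in>B. (D ^^ snd p) a ^ Poly_Mapping.lookup m (fst p, snd p)) \<in> F"
    if "a \<in> F" for a and m :: "unit \<times> nat \<Rightarrow>\<^sub>0 nat" and B
    using that by (induction B rule: infinite_finite_induct) (auto intro!: K pw Dj)
  have me: "mon_eval D m (\<lambda>_. a) \<in> F" if "a \<in> F" for a and m :: "unit \<times> nat \<Rightarrow>\<^sub>0 nat"
    unfolding mon_eval_def case_prod_unfold by (rule pr[OF that])
  have "\<forall>m\<in>Poly_Mapping.keys P. Poly_Mapping.lookup P m = 0"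
  proof (rule independent_over_extension[where F = F and A = F and \<phi> = "\<lambda>m a. mon_eval D m (\<lambda>_. a)"])
    fix c :: "(unit \<times> nat \<Rightarrow>\<^sub>0 nat) \<Rightarrow> 'u"
    assume c: "\<And>m. c m \<in> F"
      and z: "\<And>a. a \<in> F \<Longrightarrow> (\<Sum>m\<in>Poly_Mapping.keys P. c m * mon_eval D m (\<lambda>_. a)) = 0"
    define Q where "Q = (\<Sum>m\<in>Poly_Mapping.keys P. Poly_Mapping.single m (c m))"
    have lQ: "Poly_Mapping.lookup Q m = (if m \<in> Poly_Mapping.keys P then c m else 0)" for m
      by (simp add: Q_def lookup_sum lookup_single when_def)
    have "Q \<in> dpolys_over F UNIV" using c K by (simp add: dpolys_over_def lQ)
    moreover have "dpoly_eval D Q (\<lambda>_. a) = 0" if "a \<in> F" for a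
      using z[OF that] by (simp add: Q_def dpoly_eval_sum dpoly_eval_single)
    ultimately have "Q = 0" using nonvanishing_point[OF F] by blast
    then show "\<forall>m\<in>Poly_Mapping.keys P. c m = 0" using lQ by (metis lookup_zero)
  next
    show "\<And>a. a \<in> F \<Longrightarrow> (\<Sum>m\<in>Poly_Mapping.keys P. Poly_Mapping.lookup P m * mon_eval D m (\<lambda>_. a)) = 0"
      using zero by (simp add: dpoly_eval_def mon_eval_def)
  qed (use K me in auto)
  then show ?thesis by (metis in_keys_iff lookup_zero poly_mapping_eqI)
qed

lemma UNIV_subring: "subring UNIV" by (simp add: subring_def)

text \<open>Homogeneity is an identity in the scalar \<open>c\<close> for each fixed point. After multiplication by \<open>c\<close>, which
takes care of \<open>c = 0\<close>, it holds on all of \<open>F\<close>, hence everywhere.\<close>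

lemma delta_homogeneous_extends:
  assumes F: "model_DCF0 D F" and g: "delta_homogeneous D F J g"
  shows "\<exists>d. \<forall>c. c \<noteq> 0 \<longrightarrow> (\<forall>x. dpoly_eval D g (\<lambda>i. if i \<in> J then c * x i else x i) = c ^ d * dpoly_eval D g x)"
proof -
  obtain d where d: "\<And>c x. c \<in> F - {0} \<Longrightarrow>
      dpoly_eval D g (\<lambda>i. if i \<in> J then c * x i else x i) = c ^ d * dpoly_eval D g x"
    using g by (auto simp: delta_homogeneous_def)
  have D: "derivation D" using F by (simp add: model_DCF0_def)
  have "dpoly_eval D g (\<lambda>i. if i \<in> J then c * x i else x i) = c ^ d * dpoly_eval D g x" if c: "c \<noteq> 0" for c x
  proof -
    define z where "z = (\<lambda>_::unit. c)"
    have 1: "dpoly_eval D g \<in> dfun D UNIV UNIV" by (intro dfun_of_dpoly dpolys_over_UNIV) auto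
    have v: "(\<lambda>z. z ()) \<in> dfun D UNIV UNIV" using dfun_var[where j = 0 and D = D and K = UNIV and I = UNIV] by simp
    have "(\<lambda>z. if i \<in> J then z () * x i else x i) \<in> dfun D UNIV UNIV" for i
      using dfun_mult[OF v dfun_const[OF UNIV_I[of "x i"]]] dfun_const[OF UNIV_I[of "x i"], where D = D and I = UNIV]
      by (cases "i \<in> J") simp_all
    then have 2: "(\<lambda>z. dpoly_eval D g (\<lambda>i. if i \<in> J then z () * x i else x i)) \<in> dfun D UNIV UNIV"
      using dfun_substitute[OF D _ _ 1, of UNIV "\<lambda>i z. if i \<in> J then z () * x i else x i"] by simp
    have "(\<lambda>z. z () * (dpoly_eval D g (\<lambda>i. if i \<in> J then z () * x i else x i)
        + (- 1) * (z () ^ d * dpoly_eval D g x))) \<in> dfun D UNIV UNIV"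
      by (intro dfun_mult dfun_add v 2 dfun_power dfun_const) auto
    from dpoly_of_dfun[OF UNIV_subring this] obtain P :: "(unit, 'a) dpoly" where
      "(\<lambda>z. z () * (dpoly_eval D g (\<lambda>i. if i \<in> J then z () * x i else x i)
        + (- 1) * (z () ^ d * dpoly_eval D g x))) = dpoly_eval D P" by (rule bexE)
    from fun_cong[OF this] have P: "z () * (dpoly_eval D g (\<lambda>i. if i \<in> J then z () * x i else x i)
        + (- 1) * (z () ^ d * dpoly_eval D g x)) = dpoly_eval D P z" for z .
    have "P = 0"
    proof (rule vanishing_on_model[OF F])
      fix a assume "a \<in> F"
      then show "dpoly_eval D P (\<lambda>_. a) = 0" using d[of a x] P[of "\<lambda>_. a", symmetric] by (cases "a = 0") auto
    qed
    then show ?thesis using P[of "\<lambda>_. c"] c by (simp add: dpoly_eval_zero)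
  qed
  then show ?thesis by blast
qed

text \<open>If \<open>x\<^sub>i\<^sup>N h\<close> has no denominator, then neither has \<open>x\<^sub>i\<^bsup>N+1\<^esup> h'\<close>, by the product rule.\<close>

lemma clear_denominators:
  assumes D: "derivation D" and K: "subring K" "\<And>c. c \<in> K \<Longrightarrow> D c \<in> K" and i: "i \<in> I"
    and h: "h \<in> dfun D K I"
  shows "\<exists>N. \<exists>H\<in>dfun D K I. \<forall>x. x i \<noteq> 0 \<longrightarrow> H x = x i ^ N * h (\<lambda>k. x k / x i)"
proof -
  interpret diff_place D UNIV id by (rule diff_place_trivial[OF D])
  have xi: "(\<lambda>x. x i) \<in> dfun D K I" using dfun_var[OF i, where j = 0] by simp
  have pw: "(\<lambda>x. x i ^ n) \<in> dfun D K I" for n by (intro dfun_power xi subring_one K)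
  have n: "(\<lambda>x. of_nat n) \<in> dfun D K I" for n by (intro dfun_const subring_of_nat K)
  have m1: "(\<lambda>x. - 1) \<in> dfun D K I" by (intro dfun_const subring_uminus subring_one K)
  have D_closed: "\<exists>N. \<exists>H\<in>dfun D K I. \<forall>x. x i \<noteq> 0 \<longrightarrow> H x = x i ^ N * D (h x)"
    if ex: "\<exists>N. \<exists>H\<in>dfun D K I. \<forall>x. x i \<noteq> 0 \<longrightarrow> H x = x i ^ N * h x" for h
  proof -
    obtain N H where H: "H \<in> dfun D K I" "\<And>x. x i \<noteq> 0 \<Longrightarrow> H x = x i ^ N * h x" using ex by blast
    have G: "(\<lambda>x. x i * D (H x) + (- 1) * ((of_nat N * D (x i)) * H x)) \<in> dfun D K I"
      by (intro dfun_add dfun_mult xi n m1 H dfun_D[OF D K(2)])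
    have "x i * D (H x) + (- 1) * ((of_nat N * D (x i)) * H x) = x i ^ Suc N * D (h x)" if "x i \<noteq> 0" for x
    proof -
      have Hx: "H x = x i ^ N * h x" using that by (rule H(2))
      have "x i * D (x i ^ N) = of_nat N * x i ^ N * D (x i)"
        unfolding D_power[of "x i" N] by (cases N) (auto simp: algebra_simps simp del: of_nat_Suc)
      moreover have "x i * D (H x) = (x i * D (x i ^ N)) * h x + x i ^ Suc N * D (h x)"
        by (simp add: Hx D_mult algebra_simps)
      ultimately show ?thesis by (simp add: Hx algebra_simps)
    qed
    then show ?thesis by (intro exI[of _ "Suc N"] bexI[OF _ G]) simp
  qed
  show ?thesis using h
  proof induction
    case (dfun_const c)
    then show ?case by (intro exI[of _ 0] bexI[of _ "\<lambda>_. c"]) (auto intro: dfun.dfun_const)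
  next
    case (dfun_var k j)
    show ?case
    proof (induction j)
      case 0
      have "(\<lambda>x. x k) \<in> dfun D K I" using dfun.dfun_var[OF dfun_var, where j = 0] by simp
      then show ?case by (intro exI[of _ 1] bexI[of _ "\<lambda>x. x k"]) auto
    next
      case (Suc j)
      then show ?case using D_closed[of "\<lambda>x. (D ^^ j) (x k / x i)"] by simp
    qed
  next
    case (dfun_add g h)
    then obtain N G M H where *: "G \<in> dfun D K I" "\<And>x. x i \<noteq> 0 \<Longrightarrow> G x = x i ^ N * g (\<lambda>k. x k / x i)"
      "H \<in> dfun D K I" "\<And>x. x i \<noteq> 0 \<Longrightarrow> H x = x i ^ M * h (\<lambda>k. x k / x i)" by blast
    have "(\<lambda>x. x i ^ M * G x + x i ^ N * H x) \<in> dfun D K I"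
      by (intro dfun.dfun_add dfun.dfun_mult pw *)
    then show ?case
      by (intro exI[of _ "N + M"] bexI[of _ "\<lambda>x. x i ^ M * G x + x i ^ N * H x"])
        (auto simp: * power_add algebra_simps)
  next
    case (dfun_mult g h)
    then obtain N G M H where *: "G \<in> dfun D K I" "\<And>x. x i \<noteq> 0 \<Longrightarrow> G x = x i ^ N * g (\<lambda>k. x k / x i)"
      "H \<in> dfun D K I" "\<And>x. x i \<noteq> 0 \<Longrightarrow> H x = x i ^ M * h (\<lambda>k. x k / x i)" by blast
    have "(\<lambda>x. G x * H x) \<in> dfun D K I" by (intro dfun.dfun_mult *)
    then show ?case
      by (intro exI[of _ "N + M"] bexI[of _ "\<lambda>x. G x * H x"])
        (auto simp: * power_add algebra_simps)
  qed
qed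

text \<open>One additional factor \<open>x\<^sub>i\<close> makes the polynomial vanish for \<open>x\<^sub>i = 0\<close>, so that homogeneity holds at these
points as well.\<close>

lemma homogenization:
  assumes F: "model_DCF0 D F" and i: "i \<in> I" and h: "h \<in> dfun D F I"
  shows "\<exists>g\<in>dpolys_over F I. delta_homogeneous D F I g
    \<and> (\<exists>N. \<forall>x. dpoly_eval D g x = (if x i = 0 then 0 else x i ^ N * h (\<lambda>k. x k / x i)))"
proof -
  have D: "derivation D" and K: "subring F" "\<And>c. c \<in> F \<Longrightarrow> D c \<in> F"
    using F by (auto simp: model_DCF0_def delta_subfield_def subring_def)
  obtain N H where H: "H \<in> dfun D F I" "\<And>x. x i \<noteq> 0 \<Longrightarrow> H x = x i ^ N * h (\<lambda>k. x k / x i)"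
    using clear_denominators[OF D K i h] by blast
  have "(\<lambda>x. (D ^^ 0) (x i) * H x) \<in> dfun D F I" by (intro dfun_mult dfun_var i H)
  then obtain g where g: "g \<in> dpolys_over F I" "(\<lambda>x. (D ^^ 0) (x i) * H x) = dpoly_eval D g"
    using dpoly_of_dfun[OF K(1)] by blast
  have eval: "dpoly_eval D g x = (if x i = 0 then 0 else x i ^ Suc N * h (\<lambda>k. x k / x i))" for x
    using fun_cong[OF g(2), of x] H(2)[of x] by (auto simp: mult.assoc)
  have "delta_homogeneous D F I g"
    unfolding delta_homogeneous_def
  proof (intro exI[of _ "Suc N"] ballI allI)
    fix c x assume c: "c \<in> F - {0}"
    have "h (\<lambda>k. (if k \<in> I then c * x k else x k) / (c * x i)) = h (\<lambda>k. x k / x i)"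
      using c by (intro dfun_cong[OF h]) auto
    then show "dpoly_eval D g (\<lambda>k. if k \<in> I then c * x k else x k) = c ^ Suc N * dpoly_eval D g x"
      using c i by (simp add: eval power_mult_distrib)
  qed
  then show ?thesis using g(1) eval by blast
qed

section \<open>Saturation in several variables\<close>

lemma tval_cong: "(\<And>n. n \<in> tfree t \<Longrightarrow> e n = e' n) \<Longrightarrow> tval D e t = tval D e' t"
  by (induction t) auto

lemma fsat_cong: "(\<And>n. n \<in> ffree \<phi> \<Longrightarrow> e n = e' n) \<Longrightarrow> fsat D e \<phi> \<longleftrightarrow> fsat D e' \<phi>"
proof (induction \<phi> arbitrary: e e')
  case (FEq s t)
  then show ?case using tval_cong[of s e e'] tval_cong[of t e e'] by simp
next
  case (FEx \<phi>)
  have "fsat D (case_nat a e) \<phi> \<longleftrightarrow> fsat D (case_nat a e') \<phi>" for a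
    by (rule FEx.IH) (use FEx.prems in \<open>auto split: nat.split\<close>)
  then show ?case by simp
next
  case (FAnd \<phi> \<psi>)
  have "fsat D e \<phi> \<longleftrightarrow> fsat D e' \<phi>" "fsat D e \<psi> \<longleftrightarrow> fsat D e' \<psi>"
    by (rule FAnd.IH; use FAnd.prems in simp)+
  then show ?case by simp
next
  case (FNot \<phi>)
  have "fsat D e \<phi> \<longleftrightarrow> fsat D e' \<phi>" by (rule FNot.IH) (use FNot.prems in simp)
  then show ?case by simp
qed

text \<open>The variables from \<open>d\<close> on become parameters. Under a quantifier \<open>d\<close> increases, so that exactly the
free variables other than the first ones are instantiated.\<close>

primrec tinst :: "nat \<Rightarrow> (nat \<Rightarrow> 'u) \<Rightarrow> 'u dterm \<Rightarrow> 'u dterm" where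
  "tinst d e (TVar n) = (if n < d then TVar n else TParam (e (n - d)))"
| "tinst d e (TParam a) = TParam a"
| "tinst d e TZero = TZero"
| "tinst d e TOne = TOne"
| "tinst d e (TAdd s t) = TAdd (tinst d e s) (tinst d e t)"
| "tinst d e (TNeg t) = TNeg (tinst d e t)"
| "tinst d e (TMult s t) = TMult (tinst d e s) (tinst d e t)"
| "tinst d e (TDeriv t) = TDeriv (tinst d e t)"

primrec finst :: "nat \<Rightarrow> (nat \<Rightarrow> 'u) \<Rightarrow> 'u dformula \<Rightarrow> 'u dformula" where
  "finst d e (FEq s t) = FEq (tinst d e s) (tinst d e t)"
| "finst d e (FNot \<phi>) = FNot (finst d e \<phi>)"
| "finst d e (FAnd \<phi> \<psi>) = FAnd (finst d e \<phi>) (finst d e \<psi>)"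
| "finst d e (FEx \<phi>) = FEx (finst (Suc d) e \<phi>)"

lemma tval_tinst: "tval D e' (tinst d e t) = tval D (\<lambda>n. if n < d then e' n else e (n - d)) t"
  by (induction t) auto

lemma fsat_finst: "fsat D e' (finst d e \<phi>) \<longleftrightarrow> fsat D (\<lambda>n. if n < d then e' n else e (n - d)) \<phi>"
proof (induction \<phi> arbitrary: d e')
  case (FEx \<phi>)
  have "(\<lambda>n. if n < Suc d then case_nat a e' n else e (n - Suc d))
      = case_nat a (\<lambda>n. if n < d then e' n else e (n - d))" for a
    by (rule ext) (simp split: nat.split)
  then show ?case by (simp add: FEx.IH)
qed (auto simp: tval_tinst)

lemma tfree_tinst: "tfree (tinst d e t) \<subseteq> {..<d}"
  by (induction t) auto

lemma ffree_finst: "ffree (finst d e \<phi>) \<subseteq> {..<d}"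
proof (induction \<phi> arbitrary: d)
  case (FEq s t)
  then show ?case using tfree_tinst by auto
next
  case (FEx \<phi>)
  then show ?case using FEx.IH[of "Suc d"] by auto
qed auto

lemma params_tinst: "set_dterm (tinst d e t) \<subseteq> set_dterm t \<union> e ` {n. n + d \<in> tfree t}"
  by (induction t) (auto intro!: imageI)

lemma params_finst: "set_dformula (finst d e \<phi>) \<subseteq> set_dformula \<phi> \<union> e ` {n. n + d \<in> ffree \<phi>}"
proof (induction \<phi> arbitrary: d)
  case (FEq s t)
  then show ?case using params_tinst[of d e s] params_tinst[of d e t] by auto
next
  case (FEx \<phi>)
  then show ?case using FEx.IH[of "Suc d"] by auto
next
  case (FAnd \<phi> \<psi>)
  then show ?case using FAnd.IH[of d] by (simp add: image_def) blast
qed auto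

primrec conj_list :: "'u dformula list \<Rightarrow> 'u dformula" where
  "conj_list [] = FEq TZero TZero"
| "conj_list (\<phi> # \<Phi>) = FAnd \<phi> (conj_list \<Phi>)"

lemma fsat_conj_list: "fsat D e (conj_list \<Phi>) \<longleftrightarrow> (\<forall>\<phi>\<in>set \<Phi>. fsat D e \<phi>)"
  and ffree_conj_list: "ffree (conj_list \<Phi>) = (\<Union>\<phi>\<in>set \<Phi>. ffree \<phi>)"
  and params_conj_list: "set_dformula (conj_list \<Phi>) = (\<Union>\<phi>\<in>set \<Phi>. set_dformula \<phi>)"
  by (induction \<Phi>) auto

lemma insert_lesspoll_infinite:
  assumes "A \<prec> B" "infinite B"
  shows "insert a A \<prec> B"
proof (cases "finite A")
  case True
  then show ?thesis using assms by (intro finite_lesspoll_infinite) auto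
next
  case False
  then have "insert a A \<approx> A" by (rule infinite_insert_eqpoll)
  then show ?thesis using assms(1) by (rule eq_lesspoll_trans)
qed

lemma Un_finite_lesspoll_infinite:
  assumes "finite C" "A \<prec> B" "infinite B"
  shows "A \<union> C \<prec> B"
  using assms by (induction C rule: finite_induct) (auto intro: insert_lesspoll_infinite)

text \<open>Induction on the number of variables. Quantifying away the first variable in all finite
conjunctions gives a type in one variable less; with its realization as additional parameters, the
original set is a type in one variable over a set that is still small.\<close>

lemma saturated_several_variables:
  fixes D :: "'u::field_char_0 \<Rightarrow> 'u"
  assumes sat: "saturated D" and A: "A \<prec> (UNIV :: 'u set)"
    and "\<And>\<phi>. \<phi> \<in> \<Phi> \<Longrightarrow> set_dformula \<phi> \<subseteq> A \<and> ffree \<phi> \<subseteq> {..<N}"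
    and "\<And>\<Psi>. finite \<Psi> \<Longrightarrow> \<Psi> \<subseteq> \<Phi> \<Longrightarrow> \<exists>e. \<forall>\<phi>\<in>\<Psi>. fsat D e \<phi>"
  shows "\<exists>e. \<forall>\<phi>\<in>\<Phi>. fsat D e \<phi>"
  using assms(3,4)
proof (induction N arbitrary: \<Phi>)
  case 0
  have "fsat D (\<lambda>_. 0) \<phi>" if \<phi>: "\<phi> \<in> \<Phi>" for \<phi>
  proof -
    obtain e where "\<forall>\<psi>\<in>{\<phi>}. fsat D e \<psi>" using 0(2)[of "{\<phi>}"] \<phi> by blast
    then show ?thesis using fsat_cong[of \<phi> e "\<lambda>_. 0" D] 0(1)[OF \<phi>] by auto
  qed
  then show ?case by blast
next
  case (Suc N)
  define \<Phi>' where "\<Phi>' = {FEx (conj_list L) | L. set L \<subseteq> \<Phi>}"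
  have "\<exists>e. \<forall>\<phi>\<in>\<Phi>'. fsat D e \<phi>"
  proof (rule Suc.IH)
    fix \<phi> assume "\<phi> \<in> \<Phi>'"
    then obtain L where L: "\<phi> = FEx (conj_list L)" "set L \<subseteq> \<Phi>" by (auto simp: \<Phi>'_def)
    have "set_dformula (conj_list L) \<subseteq> A" unfolding params_conj_list using L(2) Suc.prems(1) by blast
    moreover have "ffree (conj_list L) \<subseteq> {..<Suc N}" unfolding ffree_conj_list using L(2) Suc.prems(1) by blast
    ultimately show "set_dformula \<phi> \<subseteq> A \<and> ffree \<phi> \<subseteq> {..<N}" by (auto simp: L(1))
  next
    fix \<Psi> assume fin: "finite \<Psi>" and sub: "\<Psi> \<subseteq> \<Phi>'"
    then have "\<forall>\<psi>\<in>\<Psi>. \<exists>L. \<psi> = FEx (conj_list L) \<and> set L \<subseteq> \<Phi>" by (auto simp: \<Phi>'_def)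
    then obtain L where L: "\<And>\<psi>. \<psi> \<in> \<Psi> \<Longrightarrow> \<psi> = FEx (conj_list (L \<psi>)) \<and> set (L \<psi>) \<subseteq> \<Phi>" by metis
    have "finite (\<Union>\<psi>\<in>\<Psi>. set (L \<psi>))" "(\<Union>\<psi>\<in>\<Psi>. set (L \<psi>)) \<subseteq> \<Phi>" using fin L by auto
    then obtain e where e: "\<forall>\<phi>\<in>(\<Union>\<psi>\<in>\<Psi>. set (L \<psi>)). fsat D e \<phi>" using Suc.prems(2) by meson
    have "fsat D (\<lambda>n. e (Suc n)) \<psi>" if "\<psi> \<in> \<Psi>" for \<psi>
    proof -
      have "case_nat (e 0) (\<lambda>n. e (Suc n)) = e" by (rule ext) (simp split: nat.split)
      then have "fsat D (case_nat (e 0) (\<lambda>n. e (Suc n))) (conj_list (L \<psi>))"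
        unfolding fsat_conj_list using e that by auto
      then have "fsat D (\<lambda>n. e (Suc n)) (FEx (conj_list (L \<psi>)))" by auto
      then show ?thesis using L[OF that] by simp
    qed
    then show "\<exists>e. \<forall>\<phi>\<in>\<Psi>. fsat D e \<phi>" by blast
  qed
  then obtain e where e: "\<And>\<phi>. \<phi> \<in> \<Phi>' \<Longrightarrow> fsat D e \<phi>" by blast
  define B where "B = A \<union> e ` {..<N}"
  have B: "B \<prec> (UNIV :: 'u set)"
    unfolding B_def using A infinite_UNIV_char_0 by (intro Un_finite_lesspoll_infinite) auto
  have inst: "fsat D (\<lambda>_. a) (finst 1 e \<phi>) \<longleftrightarrow> fsat D (case_nat a e) \<phi>" for a \<phi>
  proof -
    have "(\<lambda>n. if n < 1 then a else e (n - 1)) = case_nat a e" by (rule ext) (simp split: nat.split)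
    then show ?thesis by (simp only: fsat_finst)
  qed
  have "\<exists>a. \<forall>\<psi>\<in>finst 1 e ` \<Phi>. fsat D (\<lambda>_. a) \<psi>"
  proof (rule sat[unfolded saturated_def, rule_format, of B], intro conjI B ballI allI impI)
    fix \<psi> assume "\<psi> \<in> finst 1 e ` \<Phi>"
    then obtain \<phi> where \<phi>: "\<phi> \<in> \<Phi>" "\<psi> = finst 1 e \<phi>" by blast
    show "set_dformula \<psi> \<subseteq> B"
      using params_finst[of 1 e \<phi>] Suc.prems(1)[OF \<phi>(1)] by (fastforce simp: \<phi>(2) B_def)
    show "ffree \<psi> \<subseteq> {0}" using ffree_finst[of 1 e \<phi>] by (auto simp: \<phi>(2))
  next
    fix \<Psi> assume "finite \<Psi> \<and> \<Psi> \<subseteq> finst 1 e ` \<Phi>"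
    then obtain \<Xi> where \<Xi>: "\<Xi> \<subseteq> \<Phi>" "finite \<Xi>" "\<Psi> = finst 1 e ` \<Xi>"
      using finite_subset_image[of \<Psi> "finst 1 e" \<Phi>] by blast
    obtain L where L: "set L = \<Xi>" using finite_list[OF \<Xi>(2)] by blast
    then have "FEx (conj_list L) \<in> \<Phi>'" using \<Xi>(1) by (auto simp: \<Phi>'_def)
    then obtain a where "fsat D (case_nat a e) (conj_list L)" using e by fastforce
    then have "\<forall>\<phi>\<in>\<Xi>. fsat D (\<lambda>_. a) (finst 1 e \<phi>)" unfolding inst fsat_conj_list L .
    then show "\<exists>a. \<forall>\<phi>\<in>\<Psi>. fsat D (\<lambda>_. a) \<phi>" unfolding \<Xi>(3) by blast
  qed
  then show ?case using inst by auto
qed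

lemma dfun_term:
  assumes "h \<in> dfun D K I"
  shows "\<exists>t. set_dterm t \<subseteq> K \<and> tfree t \<subseteq> idx ` I \<and> (\<forall>e. tval D e t = h (\<lambda>i. e (idx i)))"
  using assms
proof induction
  case (dfun_const c)
  then show ?case by (intro exI[of _ "TParam c"]) auto
next
  case (dfun_var i j)
  have "\<exists>t. set_dterm t = {} \<and> tfree t = {idx i} \<and> (\<forall>e. tval D e t = (D ^^ j) (e (idx i)))"
  proof (induction j)
    case 0
    show ?case by (intro exI[of _ "TVar (idx i)"]) auto
  next
    case (Suc j)
    then obtain t where "set_dterm t = {} \<and> tfree t = {idx i} \<and> (\<forall>e. tval D e t = (D ^^ j) (e (idx i)))" by blast
    then show ?case by (intro exI[of _ "TDeriv t"]) auto
  qed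
  then show ?case using dfun_var by fastforce
next
  case (dfun_add g h)
  then obtain s t where "set_dterm s \<subseteq> K" "tfree s \<subseteq> idx ` I" "\<And>e. tval D e s = g (\<lambda>i. e (idx i))"
    "set_dterm t \<subseteq> K" "tfree t \<subseteq> idx ` I" "\<And>e. tval D e t = h (\<lambda>i. e (idx i))" by blast
  then show ?case by (intro exI[of _ "TAdd s t"]) auto
next
  case (dfun_mult g h)
  then obtain s t where "set_dterm s \<subseteq> K" "tfree s \<subseteq> idx ` I" "\<And>e. tval D e s = g (\<lambda>i. e (idx i))"
    "set_dterm t \<subseteq> K" "tfree t \<subseteq> idx ` I" "\<And>e. tval D e t = h (\<lambda>i. e (idx i))" by blast
  then show ?case by (intro exI[of _ "TMult s t"]) auto
qed

section \<open>Points of projective space\<close>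

definition pt :: "nat \<Rightarrow> (nat \<Rightarrow> 'u::field_char_0) \<Rightarrow> 'u proj_point" where
  "pt n x = proj_rel n `` {x}"

lemma mem_pt: "x \<in> hom_coords n \<Longrightarrow> y \<in> pt n x \<longleftrightarrow> (\<exists>c. c \<noteq> 0 \<and> y = (\<lambda>i. c * x i))"
  by (auto simp: pt_def proj_rel_def hom_coords_def)

lemma pt_self: "x \<in> hom_coords n \<Longrightarrow> x \<in> pt n x"
  by (auto simp: mem_pt intro!: exI[of _ 1])

lemma pt_proj_space: "x \<in> hom_coords n \<Longrightarrow> pt n x \<in> proj_space n"
  unfolding pt_def proj_space_def by (rule quotientI)

lemma proj_space_pt:
  assumes "P \<in> proj_space n"
  obtains x where "x \<in> hom_coords n" "P = pt n x"
  using assms unfolding proj_space_def pt_def by (auto elim: quotientE)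

lemma hom_coords_scale: "x \<in> hom_coords n \<Longrightarrow> c \<noteq> 0 \<Longrightarrow> (\<lambda>i. c * x i) \<in> hom_coords n"
  by (auto simp: hom_coords_def)

lemma pt_scale:
  assumes "x \<in> hom_coords n" "c \<noteq> 0"
  shows "pt n (\<lambda>i. c * x i) = pt n x"
proof (rule set_eqI)
  fix y
  show "y \<in> pt n (\<lambda>i. c * x i) \<longleftrightarrow> y \<in> pt n x"
    unfolding mem_pt[OF assms(1)] mem_pt[OF hom_coords_scale[OF assms]]
  proof (intro iffI; elim exE conjE)
    fix d assume "d \<noteq> 0" "y = (\<lambda>i. d * (c * x i))"
    then show "\<exists>c. c \<noteq> 0 \<and> y = (\<lambda>i. c * x i)" using assms(2) by (intro exI[of _ "d * c"]) auto
  next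
    fix d assume "d \<noteq> 0" "y = (\<lambda>i. d * x i)"
    then show "\<exists>d. d \<noteq> 0 \<and> y = (\<lambda>i. d * (c * x i))" using assms(2) by (intro exI[of _ "d / c"]) auto
  qed
qed

context
  fixes D :: "'u::field_char_0 \<Rightarrow> 'u" and F :: "'u set"
  assumes F: "model_DCF0 D F"
begin

text \<open>A coordinate outside the group of homogeneous ones is \<open>0\<close>, so that scaling the group scales the
whole vector.\<close>

lemma bizero_scale:
  assumes hom: "delta_homogeneous D F (Inl ` {..m}) g" "delta_homogeneous D F (Inr ` {..n}) g"
    and x: "x \<in> hom_coords m" and y: "y \<in> hom_coords n" and c: "c \<noteq> 0" "e \<noteq> 0"
  shows "dpoly_eval D g (case_sum (\<lambda>i. c * x i) (\<lambda>i. e * y i)) = 0 \<longleftrightarrow> dpoly_eval D g (case_sum x y) = 0"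
proof -
  obtain d where d: "\<And>c x. c \<noteq> 0 \<Longrightarrow> dpoly_eval D g (\<lambda>i. if i \<in> Inl ` {..m} then c * x i else x i) = c ^ d * dpoly_eval D g x"
    using delta_homogeneous_extends[OF F hom(1)] by blast
  obtain d' where d': "\<And>c x. c \<noteq> 0 \<Longrightarrow> dpoly_eval D g (\<lambda>i. if i \<in> Inr ` {..n} then c * x i else x i) = c ^ d' * dpoly_eval D g x"
    using delta_homogeneous_extends[OF F hom(2)] by blast
  have x0: "i \<notin> {..m} \<Longrightarrow> x i = 0" for i using x by (simp add: hom_coords_def)
  have y0: "i \<notin> {..n} \<Longrightarrow> y i = 0" for i using y by (simp add: hom_coords_def)
  have eq1: "case_sum (\<lambda>i. c * x i) (\<lambda>i. e * y i)
      = (\<lambda>i. if i \<in> Inl ` {..m} then c * case_sum x (\<lambda>i. e * y i) i else case_sum x (\<lambda>i. e * y i) i)"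
  proof (rule ext)
    fix i :: "nat + nat"
    show "case_sum (\<lambda>i. c * x i) (\<lambda>i. e * y i) i
      = (if i \<in> Inl ` {..m} then c * case_sum x (\<lambda>i. e * y i) i else case_sum x (\<lambda>i. e * y i) i)"
    proof (cases i)
      case (Inl k)
      then show ?thesis using x0[of k] by (cases "k \<in> {..m}") auto
    qed auto
  qed
  have eq2: "case_sum x (\<lambda>i. e * y i)
      = (\<lambda>i. if i \<in> Inr ` {..n} then e * case_sum x y i else case_sum x y i)"
  proof (rule ext)
    fix i :: "nat + nat"
    show "case_sum x (\<lambda>i. e * y i) i = (if i \<in> Inr ` {..n} then e * case_sum x y i else case_sum x y i)"
    proof (cases i)
      case (Inr k)
      then show ?thesis using y0[of k] by (cases "k \<in> {..n}") auto
    qed auto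
  qed
  have "dpoly_eval D g (case_sum (\<lambda>i. c * x i) (\<lambda>i. e * y i)) = c ^ d * (e ^ d' * dpoly_eval D g (case_sum x y))"
    unfolding d'[OF c(2), symmetric] eq2[symmetric] d[OF c(1), symmetric] eq1 ..
  then show ?thesis using c by simp
qed

lemma mem_biproj_zeros:
  assumes S: "S \<subseteq> {g \<in> dpolys_over F (Inl ` {..m} \<union> Inr ` {..n}).
      delta_homogeneous D F (Inl ` {..m}) g \<and> delta_homogeneous D F (Inr ` {..n}) g}"
    and x: "x \<in> hom_coords m" and y: "y \<in> hom_coords n"
  shows "(pt m x, pt n y) \<in> biproj_zeros D m n S \<longleftrightarrow> (\<forall>g\<in>S. dpoly_eval D g (case_sum x y) = 0)"
proof
  assume "(pt m x, pt n y) \<in> biproj_zeros D m n S"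
  then show "\<forall>g\<in>S. dpoly_eval D g (case_sum x y) = 0"
    using pt_self[OF x] pt_self[OF y] by (auto simp: biproj_zeros_def)
next
  assume z: "\<forall>g\<in>S. dpoly_eval D g (case_sum x y) = 0"
  have "dpoly_eval D g (case_sum x' y') = 0" if g: "g \<in> S" and xy: "x' \<in> pt m x" "y' \<in> pt n y" for g x' y'
  proof -
    obtain c e where "c \<noteq> 0" "x' = (\<lambda>i. c * x i)" "e \<noteq> 0" "y' = (\<lambda>i. e * y i)"
      using xy mem_pt[OF x] mem_pt[OF y] by blast
    moreover have "delta_homogeneous D F (Inl ` {..m}) g" "delta_homogeneous D F (Inr ` {..n}) g"
      using g S by auto
    ultimately show ?thesis using bizero_scale[OF _ _ x y, of g c e] g z by simp
  qed
  then show "(pt m x, pt n y) \<in> biproj_zeros D m n S"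
    using pt_proj_space[OF x] pt_proj_space[OF y] by (auto simp: biproj_zeros_def)
qed

lemma subring_F: "subring F" and F_D: "c \<in> F \<Longrightarrow> D c \<in> F" and derivation_D: "derivation D"
  using F by (auto simp: model_DCF0_def delta_subfield_def subring_def)

lemma affine_embed_pt: "affine_embed a = pt 1 ((\<lambda>_. 0)(0 := a, 1 := 1))"
  by (simp add: affine_embed_def pt_def)

lemma affine_coords: "(\<lambda>_. 0)(0 := a, 1 := b) \<in> hom_coords 1 \<longleftrightarrow> a \<noteq> 0 \<or> b \<noteq> (0 :: 'u)"
proof -
  let ?x = "(\<lambda>_. 0)(0 := a, 1 := b) :: nat \<Rightarrow> 'u"
  have x: "?x 0 = a" "?x 1 = b" by simp_all
  have "(\<exists>i\<le>1. ?x i \<noteq> 0) \<longleftrightarrow> a \<noteq> 0 \<or> b \<noteq> 0"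
  proof
    assume "\<exists>i\<le>1. ?x i \<noteq> 0"
    then obtain i where i: "i \<le> 1" "?x i \<noteq> 0" by blast
    then consider "i = 0" | "i = 1" by linarith
    then show "a \<noteq> 0 \<or> b \<noteq> 0" using i(2) x by cases auto
  next
    assume "a \<noteq> 0 \<or> b \<noteq> 0"
    then show "\<exists>i\<le>1. ?x i \<noteq> 0" using x by (metis le_numeral_extra(3,4) zero_le_one)
  qed
  then show ?thesis by (simp add: hom_coords_def)
qed

text \<open>An intersection of zero sets is the zero set of the union. The family is not empty, since the whole
line belongs to it.\<close>

lemma proj_variety_closure: "proj_variety D F 1 (proj_closure D F X)"
proof -
  define \<S> where "\<S> = {S. S \<subseteq> {g \<in> dpolys_over F {..1}. delta_homogeneous D F {..1} g}
    \<and> affine_embed ` X \<subseteq> proj_zeros D 1 S}"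
  have "affine_embed a \<in> proj_space 1" for a :: 'u
    unfolding affine_embed_pt by (intro pt_proj_space) (simp add: affine_coords[of a 1, simplified])
  then have "{} \<in> \<S>" by (auto simp: \<S>_def proj_zeros_def)
  then have "\<Inter> (proj_zeros D 1 ` \<S>) = proj_zeros D 1 (\<Union>\<S>)"
    unfolding proj_zeros_def by auto
  moreover have "proj_closure D F X = \<Inter> (proj_zeros D 1 ` \<S>)"
    unfolding proj_closure_def proj_variety_def \<S>_def by (rule arg_cong[of _ _ Inter]) blast
  ultimately have "proj_closure D F X = proj_zeros D 1 (\<Union>\<S>)" by simp
  moreover have "\<Union>\<S> \<subseteq> {g \<in> dpolys_over F {..1}. delta_homogeneous D F {..1} g}"
    unfolding \<S>_def by blast
  ultimately show ?thesis unfolding proj_variety_def by (intro exI[of _ "\<Union>\<S>"] conjI)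
qed

text \<open>The homogenization of the equation with the additional factor \<open>x\<^sub>1\<close> vanishes at infinity and exactly at
the solutions otherwise.\<close>

lemma closure_affine_part:
  assumes P: "P \<in> proj_closure D F {x. x * D (D x) = D x}" and x: "x \<in> P" "x 1 \<noteq> 0"
  defines "z \<equiv> x 0 / x 1"
  shows "z * D (D z) = D z"
proof -
  let ?h = "\<lambda>x :: nat \<Rightarrow> 'u. (D ^^ 0) (x 0) * (D ^^ 2) (x 0) + (- 1) * (D ^^ 1) (x 0)"
  have "?h \<in> dfun D F {..1}"
    by (intro dfun_add dfun_mult dfun_var dfun_const subring_uminus subring_one subring_F) auto
  from homogenization[OF F _ this, of 1] obtain g N where g: "g \<in> dpolys_over F {..1}" "delta_homogeneous D F {..1} g"
    "\<And>x. dpoly_eval D g x = (if x 1 = 0 then 0 else x 1 ^ N * ?h (\<lambda>k. x k / x 1))" by auto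
  have "affine_embed ` {x. x * D (D x) = D x} \<subseteq> proj_zeros D 1 {g}"
  proof
    fix P assume "P \<in> affine_embed ` {x. x * D (D x) = D x}"
    then obtain a where a: "a * D (D a) = D a" "P = pt 1 ((\<lambda>_. 0)(0 := a, 1 := 1))"
      by (auto simp: affine_embed_pt)
    have c: "(\<lambda>_. 0)(0 := a, 1 := 1) \<in> hom_coords 1" using affine_coords[of a 1] by simp
    have "dpoly_eval D g y = 0" if "y \<in> P" for y
      using that a(1) unfolding a(2) mem_pt[OF c] by (auto simp: g(3) numeral_2_eq_2)
    then show "P \<in> proj_zeros D 1 {g}" using pt_proj_space[OF c] a(2) by (simp add: proj_zeros_def)
  qed
  moreover have "proj_variety D F 1 (proj_zeros D 1 {g})" using g unfolding proj_variety_def by blast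
  ultimately have "P \<in> proj_zeros D 1 {g}" using P unfolding proj_closure_def by blast
  then have "dpoly_eval D g x = 0" using x(1) by (auto simp: proj_zeros_def)
  then show ?thesis using x(2) by (simp add: g(3) z_def numeral_2_eq_2)
qed

end

section \<open>Closed images\<close>

text \<open>The requirements on \<open>(v, u)\<close> are formulas over \<open>F\<close>, so they only have to be met finitely many at a
time. Finitely many polynomials that do not vanish at \<open>w\<close> are multiplied and homogenized with respect
to the coordinate that is \<open>1\<close> at \<open>w\<close>; the result does not vanish on the whole projection.\<close>

lemma generic_specialization:
  fixes D :: "'u::field_char_0 \<Rightarrow> 'u" and F :: "'u set"
  assumes F: "model_DCF0 D F" and sat: "saturated D" and small: "F \<prec> (UNIV :: 'u set)"
    and S: "S \<subseteq> {g \<in> dpolys_over F (Inl ` {..1} \<union> Inr ` {..n}).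
      delta_homogeneous D F (Inl ` {..1}) g \<and> delta_homogeneous D F (Inr ` {..n}) g}"
    and w: "w \<in> hom_coords n" "i \<le> n" "w i = 1"
    and closure: "\<And>g. g \<in> dpolys_over F {..n} \<Longrightarrow> delta_homogeneous D F {..n} g \<Longrightarrow>
      (\<And>P Q y. (P, Q) \<in> biproj_zeros D 1 n S \<Longrightarrow> y \<in> Q \<Longrightarrow> dpoly_eval D g y = 0) \<Longrightarrow> dpoly_eval D g w = 0"
  shows "\<exists>v u. v \<in> hom_coords 1 \<and> u \<in> hom_coords n \<and> (pt 1 v, pt n u) \<in> biproj_zeros D 1 n S
    \<and> (\<forall>h\<in>dfun D F {..n}. h w \<noteq> 0 \<longrightarrow> h u \<noteq> 0)"
proof -
  note K = subring_F[OF F]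
  define J where "J = Inl ` {..1::nat} \<union> Inr ` {..n}"
  \<comment> \<open>The coordinates of \<open>u\<close> are the variables \<open>0, \<dots>, n\<close>, those of \<open>v\<close> the next two.\<close>
  define idx where "idx = case_sum (\<lambda>k. n + 1 + k) (\<lambda>k::nat. k)"
  define good where "good t \<longleftrightarrow> set_dterm t \<subseteq> F \<and> tfree t \<subseteq> {..<n + 3}" for t :: "'u dterm"
  define Eqs where "Eqs = {FEq t TZero | t g. good t \<and> g \<in> S \<and> (\<forall>e. tval D e t = dpoly_eval D g (\<lambda>k. e (idx k)))}"
  define Neqs where "Neqs = {FNot (FEq t TZero) | t h. good t \<and> h \<in> dfun D F {..n} \<and> h w \<noteq> 0 \<and> (\<forall>e. tval D e t = h e)}"
  define Pt where "Pt = FNot (FAnd (FEq (TVar (n + 1)) TZero) (FEq (TVar (n + 2)) TZero) :: 'u dformula)"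
  define \<Phi> where "\<Phi> = insert Pt (Eqs \<union> Neqs)"
  have SJ: "dpoly_eval D g \<in> dfun D F J" if "g \<in> S" for g
    using that S subring_zero[OF K] subring_one[OF K] unfolding J_def by (intro dfun_of_dpoly) auto
  have "\<exists>e. \<forall>\<phi>\<in>\<Phi>. fsat D e \<phi>"
  proof (rule saturated_several_variables[OF sat small, where N = "n + 3"])
    fix \<phi> assume "\<phi> \<in> \<Phi>"
    then show "set_dformula \<phi> \<subseteq> F \<and> ffree \<phi> \<subseteq> {..<n + 3}"
      by (auto simp: \<Phi>_def Pt_def Eqs_def Neqs_def good_def)
  next
    fix \<Psi> assume \<Psi>: "finite \<Psi>" "\<Psi> \<subseteq> \<Phi>"
    have "\<forall>\<phi>\<in>\<Psi> \<inter> Neqs. \<exists>h. h \<in> dfun D F {..n} \<and> h w \<noteq> 0 \<and> (\<forall>e. fsat D e \<phi> \<longleftrightarrow> h e \<noteq> 0)"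
      by (auto simp: Neqs_def)
    then obtain h where h: "\<And>\<phi>. \<phi> \<in> \<Psi> \<inter> Neqs \<Longrightarrow> h \<phi> \<in> dfun D F {..n}"
      "\<And>\<phi>. \<phi> \<in> \<Psi> \<inter> Neqs \<Longrightarrow> h \<phi> w \<noteq> 0" "\<And>\<phi> e. \<phi> \<in> \<Psi> \<inter> Neqs \<Longrightarrow> fsat D e \<phi> \<longleftrightarrow> h \<phi> e \<noteq> 0"
      by metis
    define H where "H x = (\<Prod>\<phi>\<in>\<Psi> \<inter> Neqs. h \<phi> x)" for x
    have Hd: "H \<in> dfun D F {..n}"
      unfolding H_def[abs_def] by (rule dfun_prod[OF subring_one[OF K]]) (rule h(1))
    have "i \<in> {..n}" using w(2) by simp
    from homogenization[OF F this Hd] obtain g N where g: "g \<in> dpolys_over F {..n}"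
      "delta_homogeneous D F {..n} g"
      "\<And>x. dpoly_eval D g x = (if x i = 0 then 0 else x i ^ N * H (\<lambda>k. x k / x i))" by blast
    have "H w \<noteq> 0" using h(2) \<Psi>(1) by (simp add: H_def)
    then have "dpoly_eval D g w \<noteq> 0" by (simp add: g(3) w(3))
    then obtain P Q y where PQ: "(P, Q) \<in> biproj_zeros D 1 n S" "y \<in> Q" "dpoly_eval D g y \<noteq> 0"
      using closure[OF g(1,2)] by blast
    then have y: "y i \<noteq> 0" "H (\<lambda>k. y k / y i) \<noteq> 0" by (auto simp: g(3) split: if_splits)
    obtain x where x: "x \<in> hom_coords 1" "P = pt 1 x"
      using PQ(1) proj_space_pt[of P 1] by (auto simp: biproj_zeros_def)
    obtain y0 where y0: "y0 \<in> hom_coords n" "Q = pt n y0"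
      using PQ(1) proj_space_pt[of Q n] by (auto simp: biproj_zeros_def)
    define y' where "y' = (\<lambda>k. y k / y i)"
    obtain c where c: "c \<noteq> 0" "y = (\<lambda>k. c * y0 k)" using PQ(2) mem_pt[OF y0(1)] y0(2) by blast
    then have "y' = (\<lambda>k. inverse (y0 i) * y0 k)" "y0 i \<noteq> 0"
      using y(1) by (auto simp: y'_def divide_inverse)
    then have y'Q: "y' \<in> Q" unfolding y0(2) mem_pt[OF y0(1)]
      by (intro exI[of _ "inverse (y0 i)"]) auto
    define e where "e k = (if k \<le> n then y' k else x (k - (n + 1)))" for k
    have Hy: "h \<phi> e \<noteq> 0" if \<phi>: "\<phi> \<in> \<Psi> \<inter> Neqs" for \<phi>
    proof -
      have "h \<phi> y' \<noteq> 0" using y(2) \<Psi>(1) \<phi> unfolding H_def y'_def by auto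
      moreover have "h \<phi> y' = h \<phi> e" by (rule dfun_cong[OF h(1)[OF \<phi>]]) (simp add: e_def)
      ultimately show ?thesis by simp
    qed
    have "fsat D e \<phi>" if \<phi>: "\<phi> \<in> \<Psi>" for \<phi>
    proof -
      consider "\<phi> = Pt" | "\<phi> \<in> Eqs" | "\<phi> \<in> Neqs" using \<phi> \<Psi>(2) by (auto simp: \<Phi>_def)
      then show ?thesis
      proof cases
        case 1
        obtain k where "k \<le> 1" "x k \<noteq> 0" using x(1) by (auto simp: hom_coords_def)
        then have "x 0 \<noteq> 0 \<or> x 1 \<noteq> 0" by (cases k) auto
        then show ?thesis by (auto simp: 1 Pt_def e_def)
      next
        case 2
        then obtain t g where t: "\<phi> = FEq t TZero" "g \<in> S" "\<And>e. tval D e t = dpoly_eval D g (\<lambda>k. e (idx k))"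
          by (auto simp: Eqs_def)
        have "dpoly_eval D g (\<lambda>k. e (idx k)) = dpoly_eval D g (case_sum x y')"
          by (rule dfun_cong[OF SJ[OF t(2)]]) (auto simp: J_def idx_def e_def)
        also have "\<dots> = 0"
          using PQ(1) t(2) y'Q pt_self[OF x(1)] unfolding x(2) by (auto simp: biproj_zeros_def)
        finally show ?thesis by (simp add: t(1,3))
      next
        case 3
        then show ?thesis using h(3)[of \<phi> e] Hy[of \<phi>] \<phi> by blast
      qed
    qed
    then show "\<exists>e. \<forall>\<phi>\<in>\<Psi>. fsat D e \<phi>" by blast
  qed
  then obtain e where e: "\<And>\<phi>. \<phi> \<in> \<Phi> \<Longrightarrow> fsat D e \<phi>" by blast
  define v :: "nat \<Rightarrow> 'u" where "v = (\<lambda>_. 0)(0 := e (n + 1), 1 := e (n + 2))"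
  define u :: "nat \<Rightarrow> 'u" where "u k = (if k \<le> n then e k else 0)" for k
  have term_ex: "\<exists>t. good t \<and> (\<forall>e. tval D e t = h (\<lambda>k. e (idx k)))" if h: "h \<in> dfun D F J" for h
  proof -
    have "idx ` J \<subseteq> {..<n + 3}" by (auto simp: idx_def J_def)
    moreover obtain t where "set_dterm t \<subseteq> F" "tfree t \<subseteq> idx ` J" "\<forall>e. tval D e t = h (\<lambda>k. e (idx k))"
      using dfun_term[OF h, of idx] by (elim exE conjE)
    ultimately show ?thesis unfolding good_def by (intro exI[of _ t] conjI) (assumption, force)
  qed
  have nz: "h u \<noteq> 0" if h: "h \<in> dfun D F {..n}" "h w \<noteq> 0" for h
  proof -
    obtain t where "set_dterm t \<subseteq> F" "tfree t \<subseteq> (\<lambda>k. k) ` {..n}" and te: "\<forall>e. tval D e t = h (\<lambda>k. e k)"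
      using dfun_term[OF h(1), of "\<lambda>k. k"] by blast
    then have "good t" unfolding good_def by (intro conjI) (assumption, force)
    moreover have te': "tval D e t = h e" for e using te by (rule spec)
    ultimately have "FNot (FEq t TZero) \<in> \<Phi>" using h unfolding \<Phi>_def Neqs_def by blast
    then have "h e \<noteq> 0" using e[of "FNot (FEq t TZero)"] te' by simp
    moreover have "h u = h e" by (rule dfun_cong[OF h(1)]) (simp add: u_def)
    ultimately show ?thesis by simp
  qed
  have "(\<lambda>x. (D ^^ 0) (x i)) \<in> dfun D F {..n}" using w(2) by (intro dfun_var) simp
  from nz[OF this] have "u i \<noteq> 0" using w(3) by simp
  then have u: "u \<in> hom_coords n" using w(2) by (auto simp: hom_coords_def u_def)
  have "fsat D e Pt" by (rule e) (simp add: \<Phi>_def)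
  then have v: "v \<in> hom_coords 1" unfolding v_def affine_coords[OF F] by (auto simp: Pt_def)
  have "dpoly_eval D g (case_sum v u) = 0" if g: "g \<in> S" for g
  proof -
    obtain t where t: "good t" "\<And>e. tval D e t = dpoly_eval D g (\<lambda>k. e (idx k))"
      using term_ex[OF SJ[OF g]] by blast
    then have "FEq t TZero \<in> \<Phi>" using g unfolding \<Phi>_def Eqs_def by blast
    then have "dpoly_eval D g (\<lambda>k. e (idx k)) = 0" using e[of "FEq t TZero"] t(2) by simp
    moreover have "dpoly_eval D g (case_sum v u) = dpoly_eval D g (\<lambda>k. e (idx k))"
    proof (rule dfun_cong[OF SJ[OF g]])
      fix k assume "k \<in> J"
      then consider "k = Inl 0" | "k = Inl 1" | j where "k = Inr j" "j \<le> n"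
        by (auto simp: J_def le_Suc_eq)
      then show "case_sum v u k = e (idx k)" by cases (auto simp: v_def u_def idx_def)
    qed
    ultimately show ?thesis by simp
  qed
  then have "(pt 1 v, pt n u) \<in> biproj_zeros D 1 n S" using mem_biproj_zeros[OF F S v u] by simp
  then show ?thesis using u v nz by blast
qed

text \<open>The hypothesis says that \<open>h(u) = 0\<close> implies \<open>h(w) = 0\<close>. This makes \<open>a(u) / b(u) \<mapsto> a(w) / b(w)\<close> well
defined.\<close>

lemma place_of_specialization:
  fixes D :: "'u::field_char_0 \<Rightarrow> 'u" and F :: "'u set" and u w :: "'i \<Rightarrow> 'u"
  assumes F: "model_DCF0 D F"
    and nz: "\<And>h. h \<in> dfun D F I \<Longrightarrow> h w \<noteq> 0 \<Longrightarrow> h u \<noteq> 0"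
  shows "\<exists>R f. diff_place D R f \<and> (\<forall>h\<in>dfun D F I. h u \<in> R \<and> f (h u) = h w)"
proof -
  note K = subring_F[OF F] and KD = F_D[OF F] and der = derivation_D[OF F]
  interpret T: diff_place D UNIV id by (rule diff_place_trivial[OF der])
  define A where "A = dfun D F I"
  note A_simps = dfun_add[of _ D F I, folded A_def] dfun_mult[of _ D F I, folded A_def]
    dfun_const[of _ F D I, folded A_def]
  have A_one: "(\<lambda>_. 1) \<in> A" by (intro A_simps subring_one K)
  have A_neg: "(\<lambda>x. (- 1) * a x) \<in> A" if "a \<in> A" for a
    using that by (intro A_simps subring_uminus subring_one K)
  have A_D: "(\<lambda>x. D (a x)) \<in> A" if "a \<in> A" for a
    using that dfun_D[OF der KD] unfolding A_def by blast
  have nzA: "h u \<noteq> 0" if "h \<in> A" "h w \<noteq> 0" for h using nz that unfolding A_def by blast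
  define G where "G = {(a u / b u, a w / b w) | a b. a \<in> A \<and> b \<in> A \<and> b w \<noteq> 0}"
  have GI: "(a u / b u, a w / b w) \<in> G" if "a \<in> A" "b \<in> A" "b w \<noteq> 0" for a b
    using that by (auto simp: G_def)
  have uniq: "s = s'" if rs: "(r, s) \<in> G" "(r, s') \<in> G" for r s s'
  proof -
    obtain a b a' b' where ab: "a \<in> A" "b \<in> A" "b w \<noteq> 0" "a' \<in> A" "b' \<in> A" "b' w \<noteq> 0"
      "a u / b u = a' u / b' u" "s = a w / b w" "s' = a' w / b' w"
      using rs by (auto simp: G_def)
    have "a u * b' u + (- 1) * (a' u * b u) = 0"
      using ab nzA[of b] nzA[of b'] by (simp add: field_simps)
    moreover have "(\<lambda>x. a x * b' x + (- 1) * (a' x * b x)) \<in> A"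
      using ab by (intro A_simps subring_uminus subring_one K)
    ultimately have "a w * b' w + (- 1) * (a' w * b w) = 0" using nzA by blast
    then have "a w * b' w = a' w * b w" by simp
    then show ?thesis unfolding ab(8,9) using ab(3,6) by (simp add: frac_eq_eq)
  qed
  define f where "f r = (THE s. (r, s) \<in> G)" for r
  have f_eq: "f r = s" if "(r, s) \<in> G" for r s
    unfolding f_def using that uniq by blast
  define R where "R = fst ` G"
  have R_cases: "\<exists>a b. a \<in> A \<and> b \<in> A \<and> b w \<noteq> 0 \<and> b u \<noteq> 0 \<and> r = a u / b u \<and> f r = a w / b w" if r: "r \<in> R" for r
  proof -
    obtain p where p: "p \<in> G" "r = fst p" using r unfolding R_def by blast
    then obtain a b where ab: "a \<in> A" "b \<in> A" "b w \<noteq> 0" "p = (a u / b u, a w / b w)"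
      unfolding G_def by blast
    then have "f r = a w / b w" using p f_eq[OF GI[OF ab(1-3)]] by simp
    then show ?thesis using ab p nzA[OF ab(2,3)] by auto
  qed
  have RI: "a u / b u \<in> R \<and> f (a u / b u) = a w / b w" if "a \<in> A" "b \<in> A" "b w \<noteq> 0" for a b
    using GI[OF that] f_eq unfolding R_def by force
  have RI1: "a u \<in> R \<and> f (a u) = a w" if "a \<in> A" for a using RI[OF that A_one] by simp
  have "diff_place D R f"
  proof
    show "D (a + b) = D a + D b" "D (a * b) = D a * b + a * D b" for a b
      by (rule T.D_add, rule T.D_mult)
    show "1 \<in> R" "f 1 = 1" using RI1[OF A_one] by auto
    fix r assume r: "r \<in> R"
    then obtain a b where ab: "a \<in> A" "b \<in> A" "b w \<noteq> 0" "b u \<noteq> 0" "r = a u / b u" "f r = a w / b w"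
      using R_cases by blast
    have "(\<lambda>x. (- 1) * a x) \<in> A" by (rule A_neg[OF ab(1)])
    from RI[OF this ab(2,3)] show "- r \<in> R" by (simp add: ab(5))
    have quot: "D (a z / b z) = (D (a z) * b z + (- 1) * (a z * D (b z))) / (b z * b z)" if "b z \<noteq> 0" for z
      using that unfolding divide_inverse T.D_mult T.D_inverse[OF that] by (simp add: field_simps power2_eq_square)
    have "(\<lambda>x. D (a x) * b x + (- 1) * (a x * D (b x))) \<in> A"
      by (rule A_simps(1)[OF A_simps(2)[OF A_D[OF ab(1)] ab(2)] A_neg[OF A_simps(2)[OF ab(1) A_D[OF ab(2)]]]])
    moreover have "(\<lambda>x. b x * b x) \<in> A" by (rule A_simps(2)[OF ab(2) ab(2)])
    moreover have "b w * b w \<noteq> 0" using ab(3) by simp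
    ultimately have q: "(D (a u) * b u + (- 1) * (a u * D (b u))) / (b u * b u) \<in> R
      \<and> f ((D (a u) * b u + (- 1) * (a u * D (b u))) / (b u * b u))
        = (D (a w) * b w + (- 1) * (a w * D (b w))) / (b w * b w)" by (rule RI)
    show "D r \<in> R" "f (D r) = D (f r)"
      using q unfolding ab(6) unfolding ab(5) quot[OF ab(3)] quot[OF ab(4)] by simp_all
    show "inverse r \<in> R" if "f r \<noteq> 0"
      using RI[OF ab(2,1)] that ab by auto
    fix s assume s: "s \<in> R"
    then obtain a' b' where ab': "a' \<in> A" "b' \<in> A" "b' w \<noteq> 0" "b' u \<noteq> 0" "s = a' u / b' u" "f s = a' w / b' w"
      using R_cases by blast
    have bb: "(\<lambda>x. b x * b' x) \<in> A" "b w * b' w \<noteq> 0" using ab ab' by (auto intro: A_simps)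
    have "(\<lambda>x. a x * b' x + a' x * b x) \<in> A" using ab ab' by (intro A_simps)
    from RI[OF this bb] show "r + s \<in> R" "f (r + s) = f r + f s"
      using ab ab' by (auto simp: add_frac_eq)
    have "(\<lambda>x. a x * a' x) \<in> A" using ab ab' by (intro A_simps)
    from RI[OF this bb] show "r * s \<in> R" "f (r * s) = f r * f s"
      using ab ab' by auto
  qed
  moreover have "h u \<in> R \<and> f (h u) = h w" if "h \<in> dfun D F I" for h using RI1 that unfolding A_def by blast
  ultimately show ?thesis by blast
qed

lemma (in diff_place) specializes_dfun:
  assumes spec: "specializes z z'" and h: "h \<in> dfun D K I"
    and K: "\<And>c. c \<in> K \<Longrightarrow> c \<in> R \<and> f c = c"
    and pq: "\<And>i. i \<in> I \<Longrightarrow> (p i, q i) \<in> ext_graph z z'" and "h p = 0"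
  shows "h q = 0"
proof -
  have "(h p, h q) \<in> ext_graph z z'" using h
  proof induction
    case (dfun_const c)
    then show ?case using ext_R[of c] K[of c] by simp
  next
    case (dfun_var i j)
    then show ?case by (induction j) (auto intro: pq ext_D)
  qed (auto intro: ext_add ext_mult)
  then show ?thesis using spec \<open>h p = 0\<close> by (auto simp: specializes_def)
qed

lemma (in diff_place) specializes_zero_zero: "specializes 0 0"
proof (rule specializes_zero_if_nil[of "{}"])
  have "nil_ideal {} \<subseteq> \<mm>"
  proof
    fix a assume "a \<in> nil_ideal {}"
    then show "a \<in> \<mm>" by induction (use m_R in \<open>auto intro: m_add m_mult\<close>)
  qed
  then show "1 \<notin> nil_ideal {}" using one_notin_m by blast
qed (auto intro: nil_m m_zero)

theorem proposition4p2:
  fixes D :: "'u::field_char_0 \<Rightarrow> 'u" and F :: "'u set"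
  assumes "model_DCF0 D (UNIV :: 'u set)"
    and "saturated D"
    and "model_DCF0 D F"
    and "F \<prec> (UNIV :: 'u set)"
  shows "delta_complete D F 1 (proj_closure D F {x. x * D (D x) = D x})"
  unfolding delta_complete_def
proof (intro conjI allI impI)
  note U = assms(1) and F = assms(3)
  let ?V = "proj_closure D F {x. x * D (D x) = D x}"
  show "proj_variety D F 1 ?V" by (rule proj_variety_closure[OF F])
  fix n W Z
  assume "proj_variety D F n W \<and> biproj_closed D F 1 n Z \<and> Z \<subseteq> ?V \<times> W"
  then have ZV: "Z \<subseteq> ?V \<times> W" and "biproj_closed D F 1 n Z" by auto
  then obtain S where S: "S \<subseteq> {g \<in> dpolys_over F (Inl ` {..1} \<union> Inr ` {..n}).
      delta_homogeneous D F (Inl ` {..1}) g \<and> delta_homogeneous D F (Inr ` {..n}) g}"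
    and Z: "Z = biproj_zeros D 1 n S" by (auto simp: biproj_closed_def)
  define T where "T = {g \<in> dpolys_over F {..n}. delta_homogeneous D F {..n} g
    \<and> (\<forall>(P, Q)\<in>Z. \<forall>y\<in>Q. dpoly_eval D g y = 0)}"
  have "snd ` Z = proj_zeros D n T"
  proof
    show "snd ` Z \<subseteq> proj_zeros D n T"
    proof
      fix Q assume "Q \<in> snd ` Z"
      then obtain P where PQ: "(P, Q) \<in> Z" by force
      then have "Q \<in> proj_space n" by (simp add: Z biproj_zeros_def)
      then show "Q \<in> proj_zeros D n T" using PQ by (auto simp: proj_zeros_def T_def)
    qed
    show "proj_zeros D n T \<subseteq> snd ` Z"
    proof
      fix Q assume Q: "Q \<in> proj_zeros D n T"
      then obtain w0 where w0: "w0 \<in> hom_coords n" "Q = pt n w0"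
        by (auto simp: proj_zeros_def elim: proj_space_pt)
      then obtain i where i: "i \<le> n" "w0 i \<noteq> 0" by (auto simp: hom_coords_def)
      define w where "w = (\<lambda>k. inverse (w0 i) * w0 k)"
      have w: "w \<in> hom_coords n" "w i = 1" and Qw: "Q = pt n w"
        using w0 i hom_coords_scale[OF w0(1), of "inverse (w0 i)"] pt_scale[OF w0(1), of "inverse (w0 i)"]
        by (auto simp: w_def)
      have "\<exists>v u. v \<in> hom_coords 1 \<and> u \<in> hom_coords n \<and> (pt 1 v, pt n u) \<in> biproj_zeros D 1 n S
        \<and> (\<forall>h\<in>dfun D F {..n}. h w \<noteq> 0 \<longrightarrow> h u \<noteq> 0)"
      proof (rule generic_specialization[OF F assms(2,4) S w(1) i(1) w(2)])
        fix g assume "g \<in> dpolys_over F {..n}" "delta_homogeneous D F {..n} g"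
          "\<And>P Q y. (P, Q) \<in> biproj_zeros D 1 n S \<Longrightarrow> y \<in> Q \<Longrightarrow> dpoly_eval D g y = 0"
        then have "g \<in> T" by (auto simp: T_def Z)
        then show "dpoly_eval D g w = 0" using Q pt_self[OF w(1)] by (auto simp: proj_zeros_def Qw)
      qed
      then obtain v u where v: "v \<in> hom_coords 1" and u: "u \<in> hom_coords n"
        and vu: "(pt 1 v, pt n u) \<in> Z" and nz: "\<And>h. h \<in> dfun D F {..n} \<Longrightarrow> h w \<noteq> 0 \<Longrightarrow> h u \<noteq> 0"
        by (auto simp: Z)
      have "\<exists>R f. diff_place D R f \<and> (\<forall>h\<in>dfun D F {..n}. h u \<in> R \<and> f (h u) = h w)"
        by (rule place_of_specialization[OF F]) (rule nz)
      then obtain R f where "diff_place D R f"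
        and Rf: "\<And>h. h \<in> dfun D F {..n} \<Longrightarrow> h u \<in> R \<and> f (h u) = h w" by blast
      interpret diff_place D R f by fact
      have KR: "c \<in> R \<and> f c = c" if "c \<in> F" for c using Rf[OF dfun_const[OF that]] .
      have uw: "(u j, w j) \<in> ext_graph z z'" if "j \<le> n" for j z z'
      proof -
        have "(\<lambda>x. (D ^^ 0) (x j)) \<in> dfun D F {..n}" using that by (intro dfun_var) simp
        from Rf[OF this] show ?thesis using ext_R[of "u j" z z'] by simp
      qed
      have one: "(1, 1) \<in> ext_graph z z'" for z z' using ext_R[OF R_one, of z z'] f_one by simp
      have lift: "Q \<in> snd ` Z"
        if ab: "pt 1 ((\<lambda>_. 0)(0 := a, 1 := b)) = pt 1 v" "a \<noteq> 0 \<or> b \<noteq> 0" "a' \<noteq> 0 \<or> b' \<noteq> 0"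
          and spec: "specializes z z'" "(a, a') \<in> ext_graph z z'" "(b, b') \<in> ext_graph z z'" for a b a' b' z z'
      proof -
        let ?p = "(\<lambda>_. 0)(0 := a, 1 := b) :: nat \<Rightarrow> 'u" and ?q = "(\<lambda>_. 0)(0 := a', 1 := b') :: nat \<Rightarrow> 'u"
        have p: "?p \<in> hom_coords 1" and q: "?q \<in> hom_coords 1"
          using ab affine_coords[OF F] by blast+
        have "dpoly_eval D g (case_sum ?q w) = 0" if g: "g \<in> S" for g
        proof (rule specializes_dfun[where h = "dpoly_eval D g" and p = "case_sum ?p u" and K = F
              and I = "Inl ` {..1} \<union> Inr ` {..n}", OF spec(1)])
          show "c \<in> R \<and> f c = c" if "c \<in> F" for c using that by (rule KR)
          show "dpoly_eval D g \<in> dfun D F (Inl ` {..1} \<union> Inr ` {..n})"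
            using g S subring_zero[OF subring_F[OF F]] subring_one[OF subring_F[OF F]] by (intro dfun_of_dpoly) auto
          have "(pt 1 ?p, pt n u) \<in> biproj_zeros D 1 n S" using vu unfolding Z ab(1) .
          then show "dpoly_eval D g (case_sum ?p u) = 0" unfolding mem_biproj_zeros[OF F S p u] using g by (rule bspec)
          fix k assume "k \<in> Inl ` {..1::nat} \<union> Inr ` {..n}"
          then consider "k = Inl 0" | "k = Inl 1" | j where "k = Inr j" "j \<le> n"
            by (auto simp: le_Suc_eq)
          then show "(case_sum ?p u k, case_sum ?q w k) \<in> ext_graph z z'"
            by cases (use spec uw in auto)
        qed
        then have "(pt 1 ?q, pt n w) \<in> Z" unfolding Z mem_biproj_zeros[OF F S q w(1)] by (rule ballI)
        then show ?thesis unfolding Qw by force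
      qed
      have v_eq: "v k = ((\<lambda>_. 0)(0 := v 0, 1 := v 1)) k" for k
      proof -
        consider "k = 0" | "k = 1" | "k > 1" by linarith
        then show ?thesis by cases (use v in \<open>auto simp: hom_coords_def\<close>)
      qed
      obtain k where "k \<le> 1" "v k \<noteq> 0" using v by (auto simp: hom_coords_def)
      then have v_nz: "v 0 \<noteq> 0 \<or> v 1 \<noteq> 0" by (cases k) auto
      show "Q \<in> snd ` Z"
      proof (cases "v 1 = 0")
        case True
        then have v0: "v 0 \<noteq> 0" using v_nz by simp
        have "v = (\<lambda>k. v 0 * ((\<lambda>_. 0)(0 := 1, 1 := 0)) k)"
          by (rule ext, subst v_eq) (use True in simp)
        moreover have "(\<lambda>_. 0)(0 := 1 :: 'u, 1 := 0) \<in> hom_coords 1" unfolding affine_coords[OF F] by simp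
        ultimately have "pt 1 v = pt 1 ((\<lambda>_. 0)(0 := 1, 1 := 0))" using v0 by (metis pt_scale)
        then show ?thesis using lift[of 1 0 1 0 0 0] specializes_zero_zero one ext_gen[of 0 0] by simp
      next
        case False
        define z where "z = v 0 / v 1"
        have eqn: "z * D (D z) = D z" unfolding z_def
          by (rule closure_affine_part[OF F _ pt_self[OF v] False]) (use vu ZV in blast)
        have "v = (\<lambda>k. v 1 * ((\<lambda>_. 0)(0 := z, 1 := 1)) k)"
          by (rule ext, subst v_eq) (use False in \<open>simp add: z_def\<close>)
        moreover have z1: "(\<lambda>_. 0)(0 := z, 1 := 1) \<in> hom_coords 1" unfolding affine_coords[OF F] by simp
        ultimately have v1: "pt 1 v = pt 1 ((\<lambda>_. 0)(0 := z, 1 := 1))" using False by (metis pt_scale)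
        have "(\<exists>z'. specializes z z') \<or> (z \<noteq> 0 \<and> specializes (inverse z) 0)"
        proof (cases "z = 0")
          case True
          then show ?thesis using specializes_zero_zero by blast
        next
          case z: False
          then show ?thesis
            using solution_specializes[OF z eqn roots_exist[OF U] blum_order_one[OF U]] by blast
        qed
        then show ?thesis
        proof (elim disjE exE conjE)
          fix z' assume "specializes z z'"
          then show ?thesis using lift[of z 1 z' 1 z z'] v1 one ext_gen[of z z'] by simp
        next
          assume z: "z \<noteq> 0" "specializes (inverse z) 0"
          have e: "(\<lambda>_. 0)(0 := z, 1 := 1) = (\<lambda>k. z * ((\<lambda>_. 0)(0 := 1, 1 := inverse z)) k)"
            by (rule ext) (use z(1) in simp)
          have c: "(\<lambda>_. 0)(0 := 1, 1 := inverse z) \<in> hom_coords 1" unfolding affine_coords[OF F] by simp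
          have "pt 1 v = pt 1 ((\<lambda>_. 0)(0 := 1, 1 := inverse z))" unfolding v1 e by (rule pt_scale[OF c z(1)])
          then show ?thesis
            by (rule lift[OF sym _ _ z(2) one ext_gen]) simp_all
        qed
      qed
    qed
  qed
  then show "proj_variety D F n (snd ` Z)"
    unfolding proj_variety_def by (intro exI[of _ T]) (auto simp: T_def)
qed

end
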